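(* The odd writhe $J(K)$, the writhe polynomial $W_K(t)$ and the Henrich–Turaev polynomial $P_K(t)$ are concordance invariants of virtual knots; that is, if $K_0$ and $K_1$ are concordant virtual knots, then $J(K_0)=J(K_1)$, $W_{K_0}(t)=W_{K_1}(t)$ and $P_{K_0}(t)=P_{K_1}(t)$.
   Context: A virtual link diagram is a regular immersion of a disjoint union of (oriented) circles in the plane whose double points are each marked as either a classical crossing (with over/under information) or a virtual crossing. Two diagrams are equivalent if they are related by planar isotopies and generalized Reidemeister moves: the three classical Reidemeister moves, their three analogues in which all crossings are virtual, and the mixed move in which an arc having two consecutive virtual crossings is moved across a classical crossing. A virtual link is an equivalence class of diagrams; a virtual knot is a virtual link with one component. A Gauss diagram of a virtual knot diagram is a counterclockwise-oriented circle together with one directed signed chord (arrow) for each classical crossing, connecting the two preimages of the crossing, directed from the over-crossing point to the under-crossing point, and labelled by the sign of the crossing ($+1$ if right-handed, $-1$ if left-handed). A cobordism between virtual knots $K_0$ and $K_1$ is a finite sequence of births (adding a disjoint unknotted circle), deaths (removing a disjoint unknotted circle) and oriented saddle moves (interspersed with generalized Reidemeister moves) transforming $K_0$ into $K_1$, such that the associated surface co-bounding $K_0\sqcup-K_1$ is connected. If it has $s$ saddles, $b$ births and $d$ deaths, its genus is $(s-b-d)/2$. $K_0$ and $K_1$ are concordant if there is a genus zero cobordism between them, i.e. one with $s=b+d$. Let $K$ be a virtual knot with Gauss diagram $D$ and let $C(D)$ be the set of chords of $D$. For $x\in C(D)$ let $\operatorname{sign}(x)=\pm1$ be its sign. Rotate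 $D$ so that $x$ points downwards; let $r_+$ (respectively $\ell_+$) be the number of positive arrows crossing $x$ from left to right (respectively from right to left), and let $r_-,\ell_-$ be the analogous numbers for negative arrows. Put $\operatorname{ind}(x)=r_+-r_--\ell_++\ell_-$. Define $$J(K)=\sum_{\operatorname{ind}(x)\text{ odd}}\operatorname{sign}(x),\quad W_K(t)=\sum_{\operatorname{ind}(x)\neq0}\operatorname{sign}(x)\,t^{\operatorname{ind}(x)},\quad P_K(t)=\sum_{\operatorname{ind}(x)\neq0}\operatorname{sign}(x)\,t^{|\operatorname{ind}(x)|},$$ each sum being over $x\in C(D)$ satisfying the stated condition. These are known to be invariants of virtual knots (independent of the choice of $D$). *)

theory Defs
  imports "HOL-Analysis.Analysis" "HOL-Computational_Algebra.Formal_Laurent_Series"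
begin

section \<open>Virtual link diagrams\<close>

text \<open>
  A diagram is an immersion of finitely many oriented circles into the plane. The circles carry
  labels from the finite set \<open>circles D\<close>; the circle with label \<open>c\<close> is \<open>\<real>/\<int>\<close>, and its image is
  traced out by the 1-periodic map \<open>curve D c\<close>.

  The marking of the double points is stored at their preimages: \<open>over D c t\<close> says that the
  passage through parameter \<open>t\<close> of circle \<open>c\<close> is the over-passage of a classical crossing. A double
  point is classical if exactly one of its two preimages is an over-passage, and virtual if neither
  is. The values of \<open>curve\<close> and \<open>over\<close> at labels outside \<open>circles D\<close> are irrelevant.
\<close>

record diagram =
  circles :: "nat set"
  curve :: "nat \<Rightarrow> real \<Rightarrow> complex"
  over :: "nat \<Rightarrow> real \<Rightarrow> bool"

text \<open>The disjoint union of the circles, each point represented by its parameter in \<open>[0,1)\<close>.\<close>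

definition points :: "diagram \<Rightarrow> (nat \<times> real) set" where
  "points D = circles D \<times> {0..<1}"

definition position :: "diagram \<Rightarrow> nat \<times> real \<Rightarrow> complex" where
  "position D = (\<lambda>(c, t). curve D c t)"

definition velocity :: "diagram \<Rightarrow> nat \<times> real \<Rightarrow> complex" where
  "velocity D = (\<lambda>(c, t). vector_derivative (curve D c) (at t))"

definition is_over :: "diagram \<Rightarrow> nat \<times> real \<Rightarrow> bool" where
  "is_over D = (\<lambda>(c, t). over D c t)"

definition plane_det :: "complex \<Rightarrow> complex \<Rightarrow> real" where
  "plane_det v w = Re v * Im w - Im v * Re w"

definition double_points :: "diagram \<Rightarrow> ((nat \<times> real) \<times> (nat \<times> real)) set" where
  "double_points D =
    {(p, q). p \<in> points D \<and> q \<in> points D \<and> p \<noteq> q \<and> position D p = position D q}"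

definition immersed_circle :: "(real \<Rightarrow> complex) \<Rightarrow> bool" where
  "immersed_circle \<gamma> \<longleftrightarrow>
    \<gamma> C1_differentiable_on UNIV \<and>
    (\<forall>t. \<gamma> (t + 1) = \<gamma> t) \<and>
    (\<forall>t. vector_derivative \<gamma> (at t) \<noteq> 0)"

text \<open>
  The last four conditions say: finitely many multiple points, all transverse, none of multiplicity
  three or more, and over-passages only at double points whose other preimage is not an over-passage.
\<close>

definition virtual_link_diagram :: "diagram \<Rightarrow> bool" where
  "virtual_link_diagram D \<longleftrightarrow>
    finite (circles D) \<and>
    (\<forall>c\<in>circles D. immersed_circle (curve D c) \<and> (\<forall>t. over D c (t + 1) = over D c t)) \<and>
    finite (double_points D) \<and>
    (\<forall>(p, q)\<in>double_points D. plane_det (velocity D p) (velocity D q) \<noteq> 0) \<and>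
    (\<forall>p q r. (p, q) \<in> double_points D \<and> (p, r) \<in> double_points D \<longrightarrow> q = r) \<and>
    (\<forall>p\<in>points D. is_over D p \<longrightarrow> (\<exists>q. (p, q) \<in> double_points D \<and> \<not> is_over D q))"

section \<open>Planar isotopies\<close>

definition plane_diffeo :: "(complex \<Rightarrow> complex) \<Rightarrow> bool" where
  "plane_diffeo \<phi> \<longleftrightarrow>
    bij \<phi> \<and>
    (\<exists>\<phi>' :: complex \<Rightarrow> complex \<Rightarrow>\<^sub>L complex.
      (\<forall>z. (\<phi> has_derivative blinfun_apply (\<phi>' z)) (at z) \<and> bij (blinfun_apply (\<phi>' z))) \<and>
      continuous_on UNIV \<phi>')"

definition plane_isotopy :: "(real \<Rightarrow> complex \<Rightarrow> complex) \<Rightarrow> bool" where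
  "plane_isotopy H \<longleftrightarrow>
    H 0 = id \<and>
    (\<forall>s\<in>{0..1}. bij (H s)) \<and>
    continuous_on ({0..1} \<times> UNIV) (\<lambda>(s, z). H s z) \<and>
    (\<exists>H' :: real \<Rightarrow> complex \<Rightarrow> complex \<Rightarrow>\<^sub>L complex.
      (\<forall>s\<in>{0..1}. \<forall>z. (H s has_derivative blinfun_apply (H' s z)) (at z) \<and>
                        bij (blinfun_apply (H' s z))) \<and>
      continuous_on ({0..1} \<times> UNIV) (\<lambda>(s, z). H' s z))"

text \<open>Lifts to \<open>\<real>\<close> of orientation-preserving diffeomorphisms of the circle \<open>\<real>/\<int>\<close>.\<close>

definition circle_diffeo :: "(real \<Rightarrow> real) \<Rightarrow> bool" where
  "circle_diffeo h \<longleftrightarrow>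
    h C1_differentiable_on UNIV \<and>
    (\<forall>t. h (t + 1) = h t + 1) \<and>
    (\<forall>t. vector_derivative h (at t) > 0)"

text \<open>
  Planar isotopy of diagrams; the parametrizations and the labels of the circles (changed by \<open>\<pi>\<close>) are
  immaterial.
\<close>

definition planar_isotopic :: "(nat \<Rightarrow> nat) \<Rightarrow> diagram \<Rightarrow> diagram \<Rightarrow> bool" where
  "planar_isotopic \<pi> D D' \<longleftrightarrow>
    bij_betw \<pi> (circles D) (circles D') \<and>
    (\<exists>H. plane_isotopy H \<and>
      (\<forall>c\<in>circles D. \<exists>h. circle_diffeo h \<and>
        (\<forall>t. curve D' (\<pi> c) t = H 1 (curve D c (h t)) \<and>
             over D' (\<pi> c) t = over D c (h t))))"

section \<open>Generalized Reidemeister moves\<close>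

text \<open>
  A strand \<open>(c, a, b)\<close> is the piece of the circle \<open>c\<close> between the parameters \<open>a\<close> and \<open>b\<close>, where
  \<open>a > b\<close> is allowed: \<open>strand_param (c, a, b) x\<close> runs from \<open>a\<close> to \<open>b\<close> as \<open>x\<close> runs from -1 to 1,
  against the orientation of the circle if \<open>a > b\<close>.
\<close>

type_synonym strand = "nat \<times> real \<times> real"

definition strand_set :: "strand \<Rightarrow> (nat \<times> real) set" where
  "strand_set = (\<lambda>(c, a, b). {(c, t) | t. \<exists>m::int. t + of_int m \<in> closed_segment a b})"

definition strand_param :: "strand \<Rightarrow> real \<Rightarrow> nat \<times> real" where
  "strand_param = (\<lambda>(c, a, b) x. (c, ((1 - x) * a + (1 + x) * b) / 2))"

text \<open>The part of \<open>D\<close> in the closed disc \<open>B\<close> consists of the disjoint, properly embedded or immersed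
  strands \<open>S\<close>.\<close>

definition meets_in_strands :: "diagram \<Rightarrow> complex set \<Rightarrow> strand set \<Rightarrow> bool" where
  "meets_in_strands D B S \<longleftrightarrow>
    (\<forall>(c, a, b)\<in>S. c \<in> circles D \<and> a \<noteq> b \<and> \<bar>a - b\<bar> < 1 \<and>
      (\<forall>t\<in>open_segment a b. curve D c t \<in> interior B)) \<and>
    pairwise (\<lambda>s s'. disjnt (strand_set s) (strand_set s')) S \<and>
    {(c, t). c \<in> circles D \<and> curve D c t \<in> B} = (\<Union>s\<in>S. strand_set s)"

definition replaces_strands :: "complex set \<Rightarrow> strand set \<Rightarrow> diagram \<Rightarrow> diagram \<Rightarrow> bool" where
  "replaces_strands B S D D' \<longleftrightarrow>
    circles D' = circles D \<and>
    meets_in_strands D B S \<and> meets_in_strands D' B S \<and>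
    (\<forall>c\<in>circles D. \<forall>t. curve D c t \<notin> B \<longrightarrow>
      curve D' c t = curve D c t \<and> over D' c t = over D c t)"

definition follows :: "diagram \<Rightarrow> strand \<Rightarrow> (real \<Rightarrow> complex) \<Rightarrow> bool" where
  "follows D s w \<longleftrightarrow> (\<forall>x\<in>{-1..1}. position D (strand_param s x) = w x)"

abbreviation over_at :: "diagram \<Rightarrow> strand \<Rightarrow> real \<Rightarrow> bool" where
  "over_at D s x \<equiv> is_over D (strand_param s x)"

definition square :: "complex set" where
  "square = {z. \<bar>Re z\<bar> \<le> 1 \<and> \<bar>Im z\<bar> \<le> 1}"

text \<open>
  Each move replaces the strands inside a disc \<open>\<phi> ` square\<close>. Since \<open>\<phi>\<close> may reverse the orientation
  of the plane and strands may run against the orientation of their circle, all mirror images and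
  all orientations of the moves are included.

  First move: one strand with a single self-crossing is replaced by a strand without crossings. The
  crossing may be of any kind, so this comprises the classical and the virtual version.
\<close>

definition reidemeister1 :: "diagram \<Rightarrow> diagram \<Rightarrow> bool" where
  "reidemeister1 D D' \<longleftrightarrow>
    (\<exists>\<phi> c a b u v. plane_diffeo \<phi> \<and>
      replaces_strands (\<phi> ` square) {(c, a, b)} D D' \<and>
      a < u \<and> u < v \<and> v < b \<and>
      (\<forall>s\<in>{a..b}. \<forall>t\<in>{a..b}. s < t \<longrightarrow> (curve D c s = curve D c t \<longleftrightarrow> s = u \<and> t = v)) \<and>
      inj_on (curve D' c) {a..b})"

text \<open>
  Second move, in suitable coordinates: one strand is the segment \<open>y = 0\<close>, the other is the graph of
  \<open>f\<close>, crossing the first one twice, and is replaced by the graph of \<open>g > 0\<close>. Either both crossings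
  are virtual, or the same strand is on top at both.
\<close>

definition reidemeister2 :: "diagram \<Rightarrow> diagram \<Rightarrow> bool" where
  "reidemeister2 D D' \<longleftrightarrow>
    (\<exists>\<phi> s1 s2 f g. plane_diffeo \<phi> \<and> s1 \<noteq> s2 \<and>
      replaces_strands (\<phi> ` square) {s1, s2} D D' \<and>
      follows D s1 (\<lambda>x. \<phi> (Complex x 0)) \<and> follows D' s1 (\<lambda>x. \<phi> (Complex x 0)) \<and>
      follows D s2 (\<lambda>x. \<phi> (Complex x (f x))) \<and> follows D' s2 (\<lambda>x. \<phi> (Complex x (g x))) \<and>
      f (-1) = g (-1) \<and> f 1 = g 1 \<and>
      card {x \<in> {-1..1}. f x = 0} = 2 \<and>
      (\<forall>x\<in>{-1..1}. g x > 0) \<and>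
      (\<forall>x\<in>{-1..1}. \<forall>y\<in>{-1..1}. f x = 0 \<and> f y = 0 \<longrightarrow>
        over_at D s1 x = over_at D s1 y \<and> over_at D s2 x = over_at D s2 y))"

text \<open>
  Third move, in suitable coordinates: two strands are the diagonals \<open>y = x\<close> and \<open>y = -x\<close>, crossing
  at the origin, and a third strand, the graph of \<open>f\<close> passing above the origin, is replaced by the
  graph of \<open>g\<close> passing below it. The crossing of the diagonals keeps its marking. The moving strand
  either has virtual crossings with both diagonals (if the diagonals cross virtually, this is the
  virtual third move; if they cross classically, it is the mixed move), or it lies over both
  diagonals, which cross classically. The latter is the classical third move: of the three strands
  involved in it one always lies over the other two, and each of them can play the role of the moving
  strand.
\<close>

definition reidemeister3 :: "diagram \<Rightarrow> diagram \<Rightarrow> bool" where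
  "reidemeister3 D D' \<longleftrightarrow>
    (\<exists>\<phi> s1 s2 s3 f g. plane_diffeo \<phi> \<and> distinct [s1, s2, s3] \<and>
      replaces_strands (\<phi> ` square) {s1, s2, s3} D D' \<and>
      follows D s1 (\<lambda>x. \<phi> (Complex x x)) \<and> follows D' s1 (\<lambda>x. \<phi> (Complex x x)) \<and>
      follows D s2 (\<lambda>x. \<phi> (Complex x (- x))) \<and> follows D' s2 (\<lambda>x. \<phi> (Complex x (- x))) \<and>
      follows D s3 (\<lambda>x. \<phi> (Complex x (f x))) \<and> follows D' s3 (\<lambda>x. \<phi> (Complex x (g x))) \<and>
      f (-1) = g (-1) \<and> f 1 = g 1 \<and>
      f 0 > 0 \<and> g 0 < 0 \<and>
      (\<forall>k\<in>{f, g}. (\<forall>x\<in>{-1..1}. \<bar>k x\<bar> < 1) \<and>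
        (\<exists>!x. x \<in> {-1..1} \<and> k x = x) \<and> (\<exists>!x. x \<in> {-1..1} \<and> k x = - x)) \<and>
      over_at D' s1 0 = over_at D s1 0 \<and> over_at D' s2 0 = over_at D s2 0 \<and>
      ((\<forall>(E, k)\<in>{(D, f), (D', g)}. \<forall>x\<in>{-1..1}.
          (k x = x \<longrightarrow> \<not> over_at E s1 x \<and> \<not> over_at E s3 x) \<and>
          (k x = - x \<longrightarrow> \<not> over_at E s2 x \<and> \<not> over_at E s3 x)) \<or>
       (\<forall>(E, k)\<in>{(D, f), (D', g)}. \<forall>x\<in>{-1..1}.
          k x = x \<or> k x = - x \<longrightarrow> over_at E s3 x) \<and>
       (over_at D s1 0 \<or> over_at D s2 0)))"

text \<open>
  Planar isotopies and generalized Reidemeister moves, in both directions. The relation \<open>T\<close> records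
  which circle of the first diagram becomes which circle of the second one.
\<close>

inductive reidemeister_step :: "diagram \<Rightarrow> (nat \<times> nat) set \<Rightarrow> diagram \<Rightarrow> bool" where
  isotopy: "\<lbrakk>virtual_link_diagram D; virtual_link_diagram D'; planar_isotopic \<pi> D D'\<rbrakk> \<Longrightarrow>
    reidemeister_step D {(c, \<pi> c) | c. c \<in> circles D} D'"
| move: "\<lbrakk>virtual_link_diagram D; virtual_link_diagram D';
    reidemeister1 D D' \<or> reidemeister2 D D' \<or> reidemeister3 D D'\<rbrakk> \<Longrightarrow>
    reidemeister_step D (Id_on (circles D)) D'"
| inverse: "reidemeister_step D T D' \<Longrightarrow> reidemeister_step D' (T\<inverse>) D"

definition equivalent_diagrams :: "(diagram \<times> diagram) set" where
  "equivalent_diagrams =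
    {(D, D'). virtual_link_diagram D \<and> (\<lambda>E E'. \<exists>T. reidemeister_step E T E')\<^sup>*\<^sup>* D D'}"

definition virtual_links :: "diagram set set" where
  "virtual_links = {D. virtual_link_diagram D} // equivalent_diagrams"

definition virtual_knots :: "diagram set set" where
  "virtual_knots = {K \<in> virtual_links. \<forall>D\<in>K. card (circles D) = 1}"

section \<open>Cobordism and concordance\<close>

text \<open>Adding a circle \<open>c\<close> (oriented either way) that bounds a disc disjoint from \<open>D\<close>.\<close>

definition birth :: "nat \<Rightarrow> diagram \<Rightarrow> diagram \<Rightarrow> bool" where
  "birth c D D' \<longleftrightarrow>
    c \<notin> circles D \<and> circles D' = insert c (circles D) \<and>
    (\<forall>d\<in>circles D. \<forall>t. curve D' d t = curve D d t \<and> over D' d t = over D d t) \<and>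
    (\<exists>\<phi>. plane_diffeo \<phi> \<and>
      (\<forall>t. curve D' c t = \<phi> (cis (2 * pi * t))) \<and>
      (\<forall>d\<in>circles D. \<forall>t. curve D d t \<notin> \<phi> ` cball 0 1))"

text \<open>
  An oriented saddle move cutting the circle \<open>a\<close> into the circles \<open>b\<close> and \<open>c\<close>. In a disc \<open>B\<close>, two
  disjoint arcs of \<open>a\<close>, from \<open>a(0)\<close> to \<open>a(1/4)\<close> and from \<open>a(1/2)\<close> to \<open>a(3/4)\<close>, are replaced by two
  disjoint arcs from \<open>a(1/2)\<close> to \<open>a(1/4)\<close> and from \<open>a(0)\<close> to \<open>a(3/4)\<close>. The particular parameters are no
  restriction, since diagrams may be reparametrized.
\<close>

definition saddle_split :: "nat \<Rightarrow> nat \<Rightarrow> nat \<Rightarrow> diagram \<Rightarrow> diagram \<Rightarrow> bool" where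
  "saddle_split a b c D D' \<longleftrightarrow>
    a \<in> circles D \<and> b \<noteq> c \<and> b \<notin> circles D - {a} \<and> c \<notin> circles D - {a} \<and>
    circles D' = (circles D - {a}) \<union> {b, c} \<and>
    (\<forall>d\<in>circles D - {a}. \<forall>t. curve D' d t = curve D d t \<and> over D' d t = over D d t) \<and>
    (\<exists>\<phi> B. plane_diffeo \<phi> \<and> B = \<phi> ` square \<and>
      meets_in_strands D B {(a, 0, 1/4), (a, 1/2, 3/4)} \<and>
      meets_in_strands D' B {(b, 1/2, 1), (c, 1/2, 1)} \<and>
      inj_on (position D) ({a} \<times> ({0..1/4} \<union> {1/2..3/4})) \<and>
      inj_on (position D') ({b, c} \<times> {1/2..1}) \<and>
      (\<forall>t\<in>{0..1/2}.
        curve D' b t = curve D a (1/4 + t/2) \<and> over D' b t = over D a (1/4 + t/2) \<and>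
        curve D' c t = curve D a (3/4 + t/2) \<and> over D' c t = over D a (3/4 + t/2)))"

text \<open>
  The elementary pieces of a cobordism. Again \<open>T\<close> relates the circles before and after the step that
  bound the same component of the corresponding piece of surface.
\<close>

datatype step_kind = Reidemeister | Birth | Death | Saddle

inductive cobordism_step :: "step_kind \<Rightarrow> diagram \<Rightarrow> (nat \<times> nat) set \<Rightarrow> diagram \<Rightarrow> bool" where
  reidemeister: "reidemeister_step D T D' \<Longrightarrow> cobordism_step Reidemeister D T D'"
| birth: "\<lbrakk>virtual_link_diagram D; virtual_link_diagram D'; birth c D D'\<rbrakk> \<Longrightarrow>
    cobordism_step Birth D (Id_on (circles D)) D'"
| death: "\<lbrakk>virtual_link_diagram D; virtual_link_diagram D'; birth c D' D\<rbrakk> \<Longrightarrow>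
    cobordism_step Death D (Id_on (circles D')) D'"
| split: "\<lbrakk>virtual_link_diagram D; virtual_link_diagram D'; saddle_split a b c D D'\<rbrakk> \<Longrightarrow>
    cobordism_step Saddle D (Id_on (circles D - {a}) \<union> {(a, b), (a, c)}) D'"
| merge: "\<lbrakk>virtual_link_diagram D; virtual_link_diagram D'; saddle_split a b c D' D\<rbrakk> \<Longrightarrow>
    cobordism_step Saddle D (Id_on (circles D' - {a}) \<union> {(b, a), (c, a)}) D'"

text \<open>
  The surface swept out by a sequence of \<open>n\<close> steps is glued from the annuli, discs and pairs of pants
  belonging to the steps along the circles of the intermediate diagrams. Hence it is connected iff
  the following graph is: its vertices are the pairs of a time \<open>i\<close> and a circle of the diagram at time
  \<open>i\<close>, and its edges join circles bounding the same piece.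
\<close>

definition surface_vertices :: "nat \<Rightarrow> (nat \<Rightarrow> diagram) \<Rightarrow> (nat \<times> nat) set" where
  "surface_vertices n D = {(i, c). i \<le> n \<and> c \<in> circles (D i)}"

definition surface_edges :: "nat \<Rightarrow> (nat \<Rightarrow> (nat \<times> nat) set) \<Rightarrow> ((nat \<times> nat) \<times> (nat \<times> nat)) set" where
  "surface_edges n T = {((i, c), (Suc i, c')) | i c c'. i < n \<and> (c, c') \<in> T i}"

definition surface_connected ::
    "nat \<Rightarrow> (nat \<Rightarrow> diagram) \<Rightarrow> (nat \<Rightarrow> (nat \<times> nat) set) \<Rightarrow> bool" where
  "surface_connected n D T \<longleftrightarrow>
    (\<forall>v\<in>surface_vertices n D. \<forall>w\<in>surface_vertices n D.
      (v, w) \<in> (surface_edges n T \<union> (surface_edges n T)\<inverse>)\<^sup>*)"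

definition cobordism ::
    "nat \<Rightarrow> (nat \<Rightarrow> step_kind) \<Rightarrow> (nat \<Rightarrow> diagram) \<Rightarrow> (nat \<Rightarrow> (nat \<times> nat) set) \<Rightarrow>
      diagram set \<Rightarrow> diagram set \<Rightarrow> bool" where
  "cobordism n k D T K0 K1 \<longleftrightarrow>
    D 0 \<in> K0 \<and> D n \<in> K1 \<and>
    (\<forall>i<n. cobordism_step (k i) (D i) (T i) (D (Suc i))) \<and>
    surface_connected n D T"

definition num_steps :: "step_kind \<Rightarrow> nat \<Rightarrow> (nat \<Rightarrow> step_kind) \<Rightarrow> nat" where
  "num_steps s n k = card {i. i < n \<and> k i = s}"

definition cobordism_genus :: "nat \<Rightarrow> (nat \<Rightarrow> step_kind) \<Rightarrow> real" where
  "cobordism_genus n k =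
    (real (num_steps Saddle n k) - real (num_steps Birth n k) - real (num_steps Death n k)) / 2"

definition concordant :: "diagram set \<Rightarrow> diagram set \<Rightarrow> bool" where
  "concordant K0 K1 \<longleftrightarrow> (\<exists>n k D T. cobordism n k D T K0 K1 \<and> cobordism_genus n k = 0)"

section \<open>Gauss diagrams and the index invariants\<close>

text \<open>
  The circle of a Gauss diagram is \<open>\<real>/\<int>\<close>, with increasing parameter in \<open>[0,1)\<close> being the
  counterclockwise direction. An arrow points from its tail to its head.
\<close>

record chord =
  tail :: real
  head :: real
  sign :: int

text \<open>
  A crossing is right-handed iff the direction of the over-strand followed by that of the under-strand
  is a positively oriented basis of the plane.
\<close>

definition crossing_sign :: "diagram \<Rightarrow> nat \<times> real \<Rightarrow> nat \<times> real \<Rightarrow> int" where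
  "crossing_sign D p q = (if plane_det (velocity D p) (velocity D q) > 0 then 1 else -1)"

definition gauss_diagram :: "diagram \<Rightarrow> chord set" where
  "gauss_diagram D =
    {\<lparr>tail = s, head = t, sign = crossing_sign D (c, s) (c, t)\<rparr> | c s t.
      ((c, s), (c, t)) \<in> double_points D \<and> over D c s}"

definition gauss_diagrams :: "diagram set \<Rightarrow> chord set set" where
  "gauss_diagrams K = gauss_diagram ` K"

text \<open>The open arc of the circle running counterclockwise from \<open>s\<close> to \<open>t\<close>.\<close>

definition ccw_arc :: "real \<Rightarrow> real \<Rightarrow> real set" where
  "ccw_arc s t = (if s < t then {s<..<t} else {s<..<1} \<union> {0..<t})"

text \<open>
  If \<open>x\<close> points downwards, then the arc running counterclockwise from its tail (at the top) to its
  head (at the bottom) is on the left.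
\<close>

definition left_of :: "chord \<Rightarrow> real set" where
  "left_of x = ccw_arc (tail x) (head x)"

definition right_of :: "chord \<Rightarrow> real set" where
  "right_of x = ccw_arc (head x) (tail x)"

text \<open>For \<open>e = 1\<close> and \<open>e = -1\<close>, these are \<open>r\<^sub>+\<close>, \<open>r\<^sub>-\<close> and \<open>l\<^sub>+\<close>, \<open>l\<^sub>-\<close>, respectively.\<close>

definition left_to_right :: "int \<Rightarrow> chord set \<Rightarrow> chord \<Rightarrow> nat" where
  "left_to_right e G x = card {y \<in> G. sign y = e \<and> tail y \<in> left_of x \<and> head y \<in> right_of x}"

definition right_to_left :: "int \<Rightarrow> chord set \<Rightarrow> chord \<Rightarrow> nat" where
  "right_to_left e G x = card {y \<in> G. sign y = e \<and> tail y \<in> right_of x \<and> head y \<in> left_of x}"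

definition ind :: "chord set \<Rightarrow> chord \<Rightarrow> int" where
  "ind G x = int (left_to_right 1 G x) - int (left_to_right (-1) G x)
           - int (right_to_left 1 G x) + int (right_to_left (-1) G x)"

definition odd_writhe :: "chord set \<Rightarrow> int" where
  "odd_writhe G = (\<Sum>x | x \<in> G \<and> odd (ind G x). sign x)"

text \<open>The index may be negative, so the writhe polynomial is a Laurent polynomial.\<close>

definition writhe_polynomial :: "chord set \<Rightarrow> int fls" where
  "writhe_polynomial G = (\<Sum>x | x \<in> G \<and> ind G x \<noteq> 0. fls_const (sign x) * fls_X_intpow (ind G x))"

definition henrich_turaev_polynomial :: "chord set \<Rightarrow> int poly" where
  "henrich_turaev_polynomial G = (\<Sum>x | x \<in> G \<and> ind G x \<noteq> 0. monom (sign x) (nat \<bar>ind G x\<bar>))"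

end

theory Submission
  imports Defs
begin

text \<open>
  All three invariants are read off from the numbers \<open>S\<^sub>n\<close>, \<open>n \<noteq> 0\<close>, the sum of the signs of the chords
  of index \<open>n\<close>, so it is enough to show that each \<open>S\<^sub>n\<close> is a concordance invariant. The idea is to make
  sense of \<open>S\<^sub>n\<close> for the links that occur in the middle of a concordance.

  Walk along a circle of a link diagram and change an integer by the sign of the local intersection
  number of the circle with the other strand at each classical crossing that is passed. If the total
  change around every circle is zero, the integer is well defined up to a constant for each
  circle: this is an Alexander numbering of the diagram. For a knot it exists, and the
  index of a chord is the number at its head minus the number at its tail. For a numbered link
  \<open>S\<^sub>n\<close> is defined by this difference, using all classical crossings, also those between different
  circles.

  The crossings of a numbered diagram are compared step by step. A first Reidemeister move creates a
  crossing of index zero; the two crossings of a second move have equal index and opposite sign; in a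
  third move the numbers at the two passages of each crossing are shifted by the same amount; births
  and deaths do not concern the crossings, and a saddle is made where there are none.
  This is the notion \<open>transports\<close>, established in \<open>reidemeister_step_transports\<close> and
  \<open>cobordism_step_transports\<close>.

  Two global problems remain: the total change around an intermediate circle has to vanish, and the
  constants have to be chosen such that the numberings of consecutive diagrams agree. Here the
  genus enters. The circles of all diagrams, joined by the pieces of surface between them, form
  a connected graph, and genus zero together with the two ends being knots means that it has
  one vertex more than it has edges, so it is a tree. The total changes form a circulation on this tree, hence
  vanish (\<open>circulation_on_tree\<close>); and the constants that have to be adjusted along the edges are the
  differences of a potential (\<open>potential_on_tree\<close>). Both ends of the concordance are knots, whose
  indices do not depend on the constants; this is \<open>concordance_invariant\<close>.
\<close>

section \<open>Potentials and circulations on trees\<close>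

text \<open>
  A tree is given here by connectedness and the number of its edges. A subtree with prescribed
  differences is grown edge by edge; when it has used up all vertices, it has used up all edges, by
  counting, so that no edge is left whose prescribed value could contradict the others.
\<close>

lemma potential_on_tree:
  fixes g :: "'v \<times> 'v \<Rightarrow> int"
  assumes fin: "finite V" and EV: "E \<subseteq> V \<times> V"
    and conn: "\<forall>v\<in>V. \<forall>w\<in>V. (v, w) \<in> (E \<union> E\<inverse>)\<^sup>*"
    and card: "card V = card E + 1"
  shows "\<exists>h. \<forall>(v, w)\<in>E. h w - h v = g (v, w)"
proof -
  have finE: "finite E" using fin EV finite_subset by fastforce
  have grow: "\<exists>S F h. S \<subseteq> V \<and> card S = Suc k \<and> F \<subseteq> E \<and> F \<subseteq> S \<times> S \<and> card F = k \<and>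
      (\<forall>(v, w)\<in>F. h w - h v = g (v, w))" if "Suc k \<le> card V" for k
    using that
  proof (induction k)
    case 0
    then obtain v where "v \<in> V" by fastforce
    then show ?case by (intro exI[of _ "{v}"] exI[of _ "{}"]) auto
  next
    case (Suc k)
    then obtain S F h where S: "S \<subseteq> V" "card S = Suc k" and F: "F \<subseteq> E" "F \<subseteq> S \<times> S" "card F = k"
      and h: "\<forall>(v, w)\<in>F. h w - h v = g (v, w)" by auto
    have finS: "finite S" and finF: "finite F" using S F fin finE finite_subset by blast+
    \<comment> \<open>By connectedness some edge leaves the subtree. It is new because one of its ends is.\<close>
    obtain v0 where v0: "v0 \<in> S" using S by fastforce
    have "S \<noteq> V" using S Suc.prems by auto
    then obtain w0 where w0: "w0 \<in> V" "w0 \<notin> S" using S by blast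
    have "(v0, w0) \<in> (E \<union> E\<inverse>)\<^sup>*" using conn v0 w0 S by blast
    then have "\<exists>x y. x \<in> S \<and> y \<notin> S \<and> (x, y) \<in> E \<union> E\<inverse>"
      using v0 w0(2) by (induction rule: rtrancl_induct) blast+
    then obtain x y where xy: "x \<in> S" "y \<notin> S" "(x, y) \<in> E \<or> (y, x) \<in> E" by blast
    define e where "e = (if (x, y) \<in> E then (x, y) else (y, x))"
    define h' where "h' = h(y := (if (x, y) \<in> E then h x + g (x, y) else h x - g (y, x)))"
    have eE: "e \<in> E" and eF: "e \<notin> F" and eS: "e \<in> insert y S \<times> insert y S" and yV: "y \<in> V"
      using xy F EV by (auto simp: e_def)
    have "\<forall>(v, w)\<in>insert e F. h' w - h' v = g (v, w)"
      using h F xy by (auto simp: h'_def e_def)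
    then show ?case using eE eF eS yV S F finS finF xy(2)
      by (intro exI[of _ "insert y S"] exI[of _ "insert e F"] exI[of _ h']) auto
  qed
  obtain S F h where F: "F \<subseteq> E" "card F = card E" and h: "\<forall>(v, w)\<in>F. h w - h v = g (v, w)"
    using grow[of "card E"] card by auto
  have "F = E" using F finE card_subset_eq by blast
  then show ?thesis using h by blast
qed

text \<open>
  Being the difference of a potential, \<open>f\<close> is orthogonal to every circulation, in particular to itself.
\<close>

lemma circulation_on_tree:
  fixes f :: "'v \<times> 'v \<Rightarrow> int"
  assumes fin: "finite V" and EV: "E \<subseteq> V \<times> V"
    and conn: "\<forall>v\<in>V. \<forall>w\<in>V. (v, w) \<in> (E \<union> E\<inverse>)\<^sup>*"
    and card: "card V = card E + 1"
    and bal: "\<And>v. v \<in> V \<Longrightarrow> (\<Sum>e | e \<in> E \<and> snd e = v. f e) = (\<Sum>e | e \<in> E \<and> fst e = v. f e)"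
    and e: "e \<in> E"
  shows "f e = 0"
proof -
  have finE: "finite E" using fin EV finite_subset by fastforce
  obtain h where h: "\<forall>(v, w)\<in>E. h w - h v = f (v, w)"
    using potential_on_tree[OF fin EV conn card] by blast
  have group: "(\<Sum>e\<in>E. f e * h (t e)) = (\<Sum>v\<in>V. h v * (\<Sum>e | e \<in> E \<and> t e = v. f e))"
    if "t ` E \<subseteq> V" for t :: "'v \<times> 'v \<Rightarrow> 'v"
  proof -
    have "(\<Sum>v\<in>V. h v * (\<Sum>e | e \<in> E \<and> t e = v. f e)) =
        (\<Sum>v\<in>V. \<Sum>e | e \<in> E \<and> t e = v. f e * h (t e))"
      by (simp add: sum_distrib_left mult.commute)
    also have "\<dots> = (\<Sum>e\<in>E. f e * h (t e))"
      using sum.group[OF finE fin that, of "\<lambda>e. f e * h (t e)"] by simp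
    finally show ?thesis ..
  qed
  \<comment> \<open>Summation by parts.\<close>
  have "(\<Sum>e\<in>E. (f e)\<^sup>2) = (\<Sum>e\<in>E. f e * h (snd e)) - (\<Sum>e\<in>E. f e * h (fst e))"
    unfolding sum_subtractf[symmetric]
    by (rule sum.cong) (use h in \<open>auto simp: power2_eq_square algebra_simps split: prod.splits\<close>)
  also have "\<dots> = 0"
  proof -
    have "snd ` E \<subseteq> V" "fst ` E \<subseteq> V" using EV by auto
    then show ?thesis using group[of snd] group[of fst] bal by simp
  qed
  finally have "(f e)\<^sup>2 = 0" using sum_nonneg_eq_0_iff[OF finE, of "\<lambda>e. (f e)\<^sup>2"] e by simp
  then show ?thesis by simp
qed

section \<open>A step function\<close>

text \<open>
  A jump of height two at every integer, with the mean value at the jump itself. A passage at parameter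
  \<open>u\<close> of a circle \<open>\<real>/\<int>\<close> contributes a multiple of \<open>step (t - u)\<close> to the numbering at \<open>t\<close>. Using
  mean values makes the index of a crossing a plain difference of two numbers, and makes the
  description insensitive to reversing a strand; the price is that all numbers are doubled.
\<close>

definition step :: "real \<Rightarrow> int" where
  "step x = \<lfloor>x\<rfloor> + \<lceil>x\<rceil>"

lemma step_add_int: "step (x + of_int m) = step x + 2 * m" "step (x - of_int m) = step x - 2 * m"
  by (simp_all add: step_def)

lemma step_0 [simp]: "step 0 = 0" by (simp add: step_def)

lemma step_minus: "step (- x) = - step x"
  by (simp add: step_def ceiling_def)

lemma step_swap: "step (x - y) = - step (y - x)"
  using step_minus[of "y - x"] by simp

lemma step_between: "of_int m < x \<Longrightarrow> x < of_int m + 1 \<Longrightarrow> step x = 2 * m + 1"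
proof -
  assume "of_int m < x" "x < of_int m + 1"
  then have "\<lfloor>x\<rfloor> = m" "\<lceil>x\<rceil> = m + 1" by linarith+
  then show ?thesis by (simp add: step_def)
qed

lemma step_small:
  fixes x :: real
  assumes "\<bar>x\<bar> < 1"
  shows "real_of_int (step x) = sgn x"
proof -
  consider "x > 0" | "x < 0" | "x = 0" by linarith
  then show ?thesis
  proof cases
    case 1 then show ?thesis using step_between[of 0 x] assms by simp
  next
    case 2 then show ?thesis using step_between[of "-1" x] assms by simp
  qed simp
qed

lemma step_frac: "step (t - frac u) = step (t - u) + 2 * \<lfloor>u\<rfloor>"
  using step_add_int(1)[of "t - u" "\<lfloor>u\<rfloor>"] by (simp add: frac_def algebra_simps)

text \<open>
  From outside an arc of the circle \<open>\<real>/\<int>\<close>, all its points look alike. What happens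
  inside an arc therefore affects the numbering elsewhere only by the total jump.
\<close>

lemma step_const_on_closed_arc:
  assumes u: "u \<in> closed_segment a b" "v \<in> closed_segment a b" and len: "\<bar>a - b\<bar> \<le> 1"
    and t: "\<And>m::int. t + of_int m \<notin> closed_segment a b"
  shows "step (t - u) = step (t - v)"
proof -
  define l r where "l = min a b" and "r = max a b"
  have seg: "closed_segment a b = {l..r}" and lr: "r - l \<le> 1"
    using len by (auto simp: l_def r_def closed_segment_eq_real_ivl)
  define m where "m = \<lfloor>t - l\<rfloor>"
  have m: "of_int m \<le> t - l" "t - l < of_int m + 1" unfolding m_def by linarith+
  have "t - of_int m > r"
    using t[of "- m"] m unfolding seg by simp
  moreover have "t - of_int m - 1 < l" using m by simp
  ultimately have "step (t - w) = 2 * m + 1" if "w \<in> closed_segment a b" for w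
    using that m lr unfolding seg by (intro step_between) auto
  then show ?thesis using u by simp
qed

section \<open>Points and crossings of a diagram\<close>

text \<open>
  Strands and reparametrizations use parameters on the whole real line, whereas crossings are recorded at
  parameters in \<open>[0,1)\<close>.
\<close>

definition wrap :: "nat \<times> real \<Rightarrow> nat \<times> real" where
  "wrap p = (fst p, frac (snd p))"

lemma fst_wrap [simp]: "fst (wrap p) = fst p" and snd_wrap [simp]: "snd (wrap p) = frac (snd p)"
  by (simp_all add: wrap_def)

lemma wrap_eq_iff: "wrap p = wrap q \<longleftrightarrow> fst p = fst q \<and> snd p - snd q \<in> \<int>"
proof -
  have "frac x = frac y \<longleftrightarrow> x - y \<in> \<int>" for x y :: real
  proof
    assume "frac x = frac y"
    then have "x - y = of_int (\<lfloor>x\<rfloor> - \<lfloor>y\<rfloor>)" by (simp add: frac_def)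
    then show "x - y \<in> \<int>" by (metis Ints_of_int)
  next
    assume "x - y \<in> \<int>"
    then obtain m where "x = y + of_int m" by (metis Ints_cases add.commute diff_add_cancel)
    then show "frac x = frac y" by simp
  qed
  then show ?thesis by (auto simp: wrap_def)
qed

lemma wrap_id: "p \<in> points D \<Longrightarrow> wrap p = p"
  by (auto simp: points_def wrap_def frac_eq)

lemma wrap_in_points: "wrap p \<in> points D \<longleftrightarrow> fst p \<in> circles D"
  by (auto simp: points_def wrap_def frac_lt_1)

lemma wrap_add_int: "wrap (c, t + of_int m) = wrap (c, t)"
  by (simp add: wrap_eq_iff)

lemma periodic_int:
  fixes f :: "real \<Rightarrow> 'a"
  assumes "\<And>t. f (t + 1) = f t"
  shows "f (t + of_int m) = f t"
proof -
  have nat: "f (t + of_nat k) = f t" for k t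
  proof (induction k)
    case (Suc k)
    then show ?case using assms[of "t + of_nat k"] by (simp add: algebra_simps)
  qed simp
  show ?thesis
  proof (cases "m \<ge> 0")
    case True then show ?thesis using nat[of t "nat m"] by simp
  next
    case False then show ?thesis using nat[of "t + of_int m" "nat (- m)"] by simp
  qed
qed

lemma periodic_frac:
  fixes f :: "real \<Rightarrow> 'a"
  assumes "\<And>t. f (t + 1) = f t"
  shows "f (frac t) = f t"
  using periodic_int[of f t "- \<lfloor>t\<rfloor>", OF assms] by (simp add: frac_def)

lemma vector_derivative_shift:
  assumes "\<And>t. f (t + m) = (f t :: complex)"
  shows "vector_derivative f (at (t + m)) = vector_derivative f (at t)"
proof -
  have "(f has_vector_derivative v) (at (t + m)) \<longleftrightarrow> (f has_vector_derivative v) (at t)" for v t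
  proof -
    have *: "(f has_vector_derivative v) (at (t + m)) \<Longrightarrow> (f has_vector_derivative v) (at t)"
      if "\<And>t. f (t + m) = f t" for m t
    proof -
      assume "(f has_vector_derivative v) (at (t + m))"
      then have "(f \<circ> (\<lambda>t. t + m) has_vector_derivative 1 *\<^sub>R v) (at t)"
        by (intro vector_diff_chain_at) (auto intro!: derivative_eq_intros)
      then show ?thesis using that by (simp add: o_def)
    qed
    have "f (t - m) = f t" for t using assms[of "t - m"] by simp
    then have "f (t + (- m)) = f t" for t by simp
    then show ?thesis using *[OF assms, of t] *[of "- m" "t + m"] by auto
  qed
  then show ?thesis by (simp add: vector_derivative_def)
qed

lemma valid_periodic:
  assumes "virtual_link_diagram D" "c \<in> circles D"
  shows "curve D c (t + 1) = curve D c t" "over D c (t + 1) = over D c t"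
  using assms by (auto simp: virtual_link_diagram_def immersed_circle_def)

lemma wrap_invariant:
  assumes "virtual_link_diagram D" "fst p \<in> circles D"
  shows "position D (wrap p) = position D p" "is_over D (wrap p) = is_over D p"
    "velocity D (wrap p) = velocity D p"
proof -
  note per = valid_periodic[OF assms]
  show "position D (wrap p) = position D p"
    using periodic_frac[of "curve D (fst p)", OF per(1)] by (simp add: position_def wrap_def split: prod.splits)
  show "is_over D (wrap p) = is_over D p"
    using periodic_frac[of "over D (fst p)", OF per(2)] by (simp add: is_over_def wrap_def split: prod.splits)
  have "velocity D (wrap p) = vector_derivative (curve D (fst p)) (at (frac (snd p)))"
    by (simp add: velocity_def wrap_def)
  also have "\<dots> = vector_derivative (curve D (fst p)) (at (snd p))"
    by (rule periodic_frac) (rule vector_derivative_shift, rule per(1))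
  finally show "velocity D (wrap p) = velocity D p"
    by (simp add: velocity_def split: prod.splits)
qed

lemma curve_has_derivative:
  assumes "virtual_link_diagram D" "c \<in> circles D"
  shows "(curve D c has_vector_derivative velocity D (c, t)) (at t)"
proof -
  have "curve D c C1_differentiable_on UNIV"
    using assms by (auto simp: virtual_link_diagram_def immersed_circle_def)
  then obtain f where "\<And>x. (curve D c has_vector_derivative f x) (at x)"
    unfolding C1_differentiable_on_def by auto
  then show ?thesis
    by (simp add: velocity_def) (metis vector_derivative_at)
qed

lemma curve_continuous:
  assumes "virtual_link_diagram D" "c \<in> circles D"
  shows "continuous_on A (curve D c)"
  using curve_has_derivative[OF assms] has_vector_derivative_continuous
  by (metis continuous_at_imp_continuous_on)

lemma plane_det_swap: "plane_det w v = - plane_det v w"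
  by (simp add: plane_det_def)

lemma double_points_sym: "(p, q) \<in> double_points D \<Longrightarrow> (q, p) \<in> double_points D"
  by (auto simp: double_points_def)

lemma double_points_in_points:
  "(p, q) \<in> double_points D \<Longrightarrow> p \<in> points D \<and> q \<in> points D"
  by (auto simp: double_points_def)

lemma valid_finite: "virtual_link_diagram D \<Longrightarrow> finite (double_points D)" "virtual_link_diagram D \<Longrightarrow> finite (circles D)"
  by (auto simp: virtual_link_diagram_def)

lemma valid_transverse:
  "virtual_link_diagram D \<Longrightarrow> (p, q) \<in> double_points D \<Longrightarrow> plane_det (velocity D p) (velocity D q) \<noteq> 0"
  by (auto simp: virtual_link_diagram_def)

lemma valid_unique:
  "virtual_link_diagram D \<Longrightarrow> (p, q) \<in> double_points D \<Longrightarrow> (p, r) \<in> double_points D \<Longrightarrow> q = r"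
  unfolding virtual_link_diagram_def by blast

lemma valid_over:
  assumes "virtual_link_diagram D" "p \<in> points D" "is_over D p"
  obtains q where "(p, q) \<in> double_points D" "\<not> is_over D q"
  using assms unfolding virtual_link_diagram_def by blast

lemma valid_not_both_over:
  assumes "virtual_link_diagram D" "(p, q) \<in> double_points D" "is_over D p"
  shows "\<not> is_over D q"
  using valid_over[OF assms(1) _ assms(3)] valid_unique[OF assms(1,2)] assms(2)
  by (metis double_points_in_points)

lemma wrap_double_points:
  assumes "virtual_link_diagram D" "fst p \<in> circles D" "fst q \<in> circles D"
  shows "(wrap p, wrap q) \<in> double_points D \<longleftrightarrow> position D p = position D q \<and> wrap p \<noteq> wrap q"
  using assms by (auto simp: double_points_def wrap_in_points wrap_invariant)

lemma crossing_sign_swap: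
  assumes "virtual_link_diagram D" "(p, q) \<in> double_points D"
  shows "crossing_sign D q p = - crossing_sign D p q"
  using valid_transverse[OF assms]
  by (auto simp: crossing_sign_def plane_det_swap[of "velocity D q"])

section \<open>Numberings\<close>

text \<open>
  Every classical crossing occurs twice, once from the viewpoint of each of the two passages.
\<close>

definition classical :: "diagram \<Rightarrow> ((nat \<times> real) \<times> (nat \<times> real)) set" where
  "classical D = {(p, q) \<in> double_points D. is_over D p \<or> is_over D q}"

text \<open>
  The local intersection number of the strands through the two passages. It is antisymmetric, and it is
  the sign of the crossing if the over-passage comes first.
\<close>

definition weight :: "diagram \<Rightarrow> (nat \<times> real) \<times> (nat \<times> real) \<Rightarrow> int" where
  "weight D = (\<lambda>(p, q). crossing_sign D p q)"

lemma classical_sym: "(p, q) \<in> classical D \<Longrightarrow> (q, p) \<in> classical D"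
  by (auto simp: classical_def double_points_sym)

lemma classical_in_points: "(p, q) \<in> classical D \<Longrightarrow> p \<in> points D \<and> q \<in> points D"
  by (auto simp: classical_def double_points_in_points)

lemma finite_classical: "virtual_link_diagram D \<Longrightarrow> finite (classical D)"
  unfolding classical_def using valid_finite(1) by (auto intro: finite_subset)

lemma weight_swap:
  "virtual_link_diagram D \<Longrightarrow> (p, q) \<in> classical D \<Longrightarrow> weight D (q, p) = - weight D (p, q)"
  by (auto simp: weight_def classical_def crossing_sign_swap)

text \<open>
  Passages of the circle \<open>c\<close> through the crossings in \<open>X\<close>, weighed by a function of the parameter: the
  function \<open>1\<close> gives the total jump of the numbering, \<open>step (t - u)\<close> its value at \<open>t\<close>. A set \<open>X\<close> of
  crossings is admitted since local moves change only some of them.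
\<close>

definition local_weigh :: "((nat \<times> real) \<times> (nat \<times> real)) set \<Rightarrow> diagram \<Rightarrow> (real \<Rightarrow> int) \<Rightarrow> nat \<Rightarrow> int" where
  "local_weigh X D \<kappa> c = (\<Sum>x | x \<in> X \<and> fst (fst x) = c. weight D x * \<kappa> (snd (fst x)))"

abbreviation weigh :: "diagram \<Rightarrow> (real \<Rightarrow> int) \<Rightarrow> nat \<Rightarrow> int" where
  "weigh D \<equiv> local_weigh (classical D) D"

text \<open>
  Half of the change of the numbering along one turn around the circle.
\<close>

definition monodromy :: "diagram \<Rightarrow> nat \<Rightarrow> int" where
  "monodromy D c = weigh D (\<lambda>_. 1) c"

text \<open>
  Twice the Alexander numbering of the circle \<open>fst p\<close>, extended to the universal cover \<open>\<real>\<close> of the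
  circle, with one choice of the constant.
\<close>

definition numbering :: "diagram \<Rightarrow> nat \<times> real \<Rightarrow> int" where
  "numbering D p = weigh D (\<lambda>u. step (snd p - u)) (fst p)"

text \<open>
  The factor in \<open>2 * n\<close> is due to the doubling of the numbering \<open>M\<close>. Requiring \<open>fst x\<close> to be
  the over-passage counts each crossing once.
\<close>

definition local_writhe ::
    "((nat \<times> real) \<times> (nat \<times> real)) set \<Rightarrow> diagram \<Rightarrow> (nat \<times> real \<Rightarrow> int) \<Rightarrow> int \<Rightarrow> int" where
  "local_writhe X D M n =
    (\<Sum>x | x \<in> X \<and> is_over D (fst x) \<and> M (snd x) - M (fst x) = 2 * n. weight D x)"

abbreviation index_writhe :: "diagram \<Rightarrow> (nat \<times> real \<Rightarrow> int) \<Rightarrow> int \<Rightarrow> int" where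
  "index_writhe D \<equiv> local_writhe (classical D) D"

definition shifted :: "diagram \<Rightarrow> (nat \<Rightarrow> int) \<Rightarrow> nat \<times> real \<Rightarrow> int" where
  "shifted D h p = numbering D p + h (fst p)"

text \<open>
  The condition for the numberings of all circles to descend from \<open>\<real>\<close> to \<open>\<real>/\<int>\<close>.
\<close>

definition balanced :: "diagram \<Rightarrow> bool" where
  "balanced D \<longleftrightarrow> (\<forall>c\<in>circles D. monodromy D c = 0)"

lemma numbering_add_int:
  "numbering D (c, t + of_int m) = numbering D (c, t) + 2 * m * monodromy D c"
proof -
  have "step (t + of_int m - u) = step (t - u) + 2 * m" for u
    using step_add_int(1)[of "t - u" m] by (simp add: algebra_simps)
  then show ?thesis
    by (simp add: numbering_def monodromy_def local_weigh_def algebra_simps sum.distrib sum_distrib_left)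
qed

lemma numbering_wrap:
  assumes "monodromy D (fst p) = 0"
  shows "numbering D (wrap p) = numbering D p"
proof -
  have "snd p = frac (snd p) + of_int \<lfloor>snd p\<rfloor>" by (simp add: frac_def)
  then show ?thesis
    using numbering_add_int[of D "fst p" "frac (snd p)" "\<lfloor>snd p\<rfloor>"] assms
    by (simp add: wrap_def)
qed

lemma shifted_wrap:
  assumes "balanced D" "fst p \<in> circles D"
  shows "shifted D h (wrap p) = shifted D h p"
  using assms by (simp add: shifted_def balanced_def numbering_wrap)

lemma local_weigh_Un:
  assumes "finite X" "finite Y" "X \<inter> Y = {}"
  shows "local_weigh (X \<union> Y) D \<kappa> c = local_weigh X D \<kappa> c + local_weigh Y D \<kappa> c"
proof -
  have "{x. x \<in> X \<union> Y \<and> fst (fst x) = c} = {x. x \<in> X \<and> fst (fst x) = c} \<union> {x. x \<in> Y \<and> fst (fst x) = c}"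
    by auto
  then show ?thesis unfolding local_weigh_def using assms by (simp add: sum.union_disjoint disjoint_iff)
qed

lemma local_writhe_Un:
  assumes "finite X" "finite Y" "X \<inter> Y = {}"
  shows "local_writhe (X \<union> Y) D M n = local_writhe X D M n + local_writhe Y D M n"
proof -
  have "{x. x \<in> X \<union> Y \<and> is_over D (fst x) \<and> M (snd x) - M (fst x) = 2 * n} =
    {x. x \<in> X \<and> is_over D (fst x) \<and> M (snd x) - M (fst x) = 2 * n} \<union>
    {x. x \<in> Y \<and> is_over D (fst x) \<and> M (snd x) - M (fst x) = 2 * n}"
    by auto
  then show ?thesis unfolding local_writhe_def using assms by (simp add: sum.union_disjoint disjoint_iff)
qed

text \<open>
  The two viewpoints on a crossing cancel each other. In particular a knot diagram is balanced.
\<close>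

lemma sum_monodromy:
  assumes "virtual_link_diagram D"
  shows "(\<Sum>c\<in>circles D. monodromy D c) = 0"
proof -
  have "(\<Sum>c\<in>circles D. monodromy D c) = (\<Sum>x\<in>classical D. weight D x)"
    unfolding monodromy_def local_weigh_def
    using sum.group[OF finite_classical valid_finite(2), OF assms assms, of "\<lambda>x. fst (fst x)" "weight D"]
      classical_in_points by (fastforce simp: points_def)
  moreover have "(\<Sum>x\<in>classical D. weight D x) = (\<Sum>x\<in>classical D. weight D (prod.swap x))"
    by (rule sum.reindex_bij_witness[of _ prod.swap prod.swap]) (auto simp: classical_sym)
  moreover have "\<dots> = - (\<Sum>x\<in>classical D. weight D x)"
    unfolding sum_negf[symmetric] by (rule sum.cong) (auto simp: weight_swap[OF assms])
  ultimately show ?thesis by linarith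
qed

section \<open>Transport along a step\<close>

text \<open>
  What a step \<open>T\<close> from \<open>D\<close> to \<open>D'\<close> has to satisfy for the global argument. The first condition is
  homological: a flow \<open>f\<close> along the pieces of surface has the monodromies as its boundary values, so that
  over a whole cobordism one obtains a circulation. The second one says that the index writhes agree
  as soon as the constants \<open>h\<close>, \<open>h'\<close> of the numberings are adjusted along each piece of surface. The index
  zero has to be excluded on account of the first Reidemeister move.
\<close>

definition transports :: "diagram \<Rightarrow> (nat \<times> nat) set \<Rightarrow> diagram \<Rightarrow> bool" where
  "transports D T D' \<longleftrightarrow>
    T \<subseteq> circles D \<times> circles D' \<and>
    (\<exists>f :: nat \<times> nat \<Rightarrow> int.
      (\<forall>c\<in>circles D. (\<Sum>e | e \<in> T \<and> fst e = c. f e) = monodromy D c) \<and>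
      (\<forall>c\<in>circles D'. (\<Sum>e | e \<in> T \<and> snd e = c. f e) = monodromy D' c)) \<and>
    (balanced D \<and> balanced D' \<longrightarrow>
      (\<exists>g. \<forall>h h'. (\<forall>(c, c')\<in>T. h' c' - h c = g (c, c')) \<longrightarrow>
        (\<forall>n. n \<noteq> 0 \<longrightarrow> index_writhe D (shifted D h) n = index_writhe D' (shifted D' h') n)))"

lemma transports_converse:
  assumes "transports D T D'"
  shows "transports D' (T\<inverse>) D"
proof -
  obtain f :: "nat \<times> nat \<Rightarrow> int" where T: "T \<subseteq> circles D \<times> circles D'"
    and f: "\<forall>c\<in>circles D. (\<Sum>e | e \<in> T \<and> fst e = c. f e) = monodromy D c"
      "\<forall>c\<in>circles D'. (\<Sum>e | e \<in> T \<and> snd e = c. f e) = monodromy D' c"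
    using assms unfolding transports_def by blast
  have swap: "(\<Sum>e | e \<in> T\<inverse> \<and> P (prod.swap e). f (prod.swap e)) = (\<Sum>e | e \<in> T \<and> P e. f e)" for P
    by (rule sum.reindex_bij_witness[of _ prod.swap prod.swap]) auto
  have "\<forall>c\<in>circles D'. (\<Sum>e | e \<in> T\<inverse> \<and> fst e = c. f (prod.swap e)) = monodromy D' c"
      "\<forall>c\<in>circles D. (\<Sum>e | e \<in> T\<inverse> \<and> snd e = c. f (prod.swap e)) = monodromy D c"
    using f swap[of "\<lambda>e. snd e = _"] swap[of "\<lambda>e. fst e = _"] by simp_all
  moreover have "\<exists>g. \<forall>h h'. (\<forall>(c, c')\<in>T\<inverse>. h' c' - h c = g (c, c')) \<longrightarrow>
        (\<forall>n. n \<noteq> 0 \<longrightarrow> index_writhe D' (shifted D' h) n = index_writhe D (shifted D h') n)"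
    if bal: "balanced D' \<and> balanced D"
  proof -
    obtain g where g: "\<And>h h'. (\<forall>(c, c')\<in>T. h' c' - h c = g (c, c')) \<Longrightarrow>
        (\<forall>n. n \<noteq> 0 \<longrightarrow> index_writhe D (shifted D h) n = index_writhe D' (shifted D' h') n)"
      using assms bal unfolding transports_def by meson
    show ?thesis
    proof (intro exI[of _ "\<lambda>(c, c'). - g (c', c)"] allI impI)
      fix h h' n assume *: "\<forall>(c, c')\<in>T\<inverse>. h' c' - h c = (case (c, c') of (c, c') \<Rightarrow> - g (c', c))" "n \<noteq> (0::int)"
      have "h' c - h c' = - g (c, c')" if "(c, c') \<in> T" for c c'
        using bspec[OF *(1), of "(c', c)"] that by simp
      then have "\<forall>(c, c')\<in>T. h c' - h' c = g (c, c')" by fastforce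
      then show "index_writhe D' (shifted D' h) n = index_writhe D (shifted D h') n"
        using g[of h h'] *(2) by auto
    qed
  qed
  moreover have "T\<inverse> \<subseteq> circles D' \<times> circles D" using T by auto
  moreover have "\<exists>f :: nat \<times> nat \<Rightarrow> int.
      (\<forall>c\<in>circles D'. (\<Sum>e | e \<in> T\<inverse> \<and> fst e = c. f e) = monodromy D' c) \<and>
      (\<forall>c\<in>circles D. (\<Sum>e | e \<in> T\<inverse> \<and> snd e = c. f e) = monodromy D c)"
    using calculation by (intro exI[of _ "\<lambda>e. f (prod.swap e)"]) simp
  ultimately show ?thesis unfolding transports_def by blast
qed

section \<open>Moves inside a disc\<close>

lemma strand_set_iff:
  "p \<in> strand_set (c, a, b) \<longleftrightarrow> fst p = c \<and> (\<exists>m::int. snd p + of_int m \<in> closed_segment a b)"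
  by (cases p) (auto simp: strand_set_def)

lemma fst_in_strand_set: "p \<in> strand_set s \<Longrightarrow> fst p = fst s"
  by (cases s) (simp add: strand_set_iff)

lemma wrap_in_strand_set [simp]: "wrap p \<in> strand_set s \<longleftrightarrow> p \<in> strand_set s"
proof (cases s)
  case (fields c a b)
  have "(\<exists>m::int. frac x + of_int m \<in> A) \<longleftrightarrow> (\<exists>m::int. x + of_int m \<in> A)" for x :: real and A
  proof -
    have "frac x + of_int m = x + of_int (m - \<lfloor>x\<rfloor>)" "x + of_int m = frac x + of_int (m + \<lfloor>x\<rfloor>)" for m
      by (simp_all add: frac_def)
    then show ?thesis by metis
  qed
  then show ?thesis by (simp add: fields strand_set_iff)
qed

text \<open>
  The common setting of the Reidemeister moves. Outside the strands \<open>S\<close> nothing happens, and no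
  crossing joins a point outside to a point inside, because the strands are all of the diagram in the
  disc \<open>B\<close>.
\<close>

locale local_move =
  fixes D D' :: diagram and B :: "complex set" and S :: "strand set"
  assumes valid: "virtual_link_diagram D" "virtual_link_diagram D'"
    and closed_disc: "closed B"
    and finite_strands: "finite S"
    and replaces: "replaces_strands B S D D'"
begin

definition inside :: "(nat \<times> real) set" where "inside = (\<Union>s\<in>S. strand_set s)"

lemma circles_eq: "circles D' = circles D"
  using replaces by (simp add: replaces_strands_def)

lemma in_disc_iff:
  assumes "fst p \<in> circles D"
  shows "position D p \<in> B \<longleftrightarrow> p \<in> inside" "position D' p \<in> B \<longleftrightarrow> p \<in> inside"
proof -
  have "{(c, t). c \<in> circles D \<and> curve D c t \<in> B} = inside"
    "{(c, t). c \<in> circles D' \<and> curve D' c t \<in> B} = inside"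
    using replaces unfolding replaces_strands_def meets_in_strands_def inside_def by blast+
  then show "position D p \<in> B \<longleftrightarrow> p \<in> inside" "position D' p \<in> B \<longleftrightarrow> p \<in> inside"
    using assms by (cases p; auto simp: position_def circles_eq)+
qed

text \<open>
  The setting is symmetric, so facts about \<open>D\<close> also hold for \<open>D'\<close>.
\<close>

lemma swap: "local_move D' D B S"
proof
  have *: "curve D c t = curve D' c t \<and> over D c t = over D' c t"
    if "c \<in> circles D" "curve D' c t \<notin> B" for c t
  proof -
    have "curve D c t \<notin> B" using in_disc_iff[of "(c, t)"] that by (simp add: position_def)
    then show ?thesis using replaces that unfolding replaces_strands_def by metis
  qed
  show "replaces_strands B S D' D"
    unfolding replaces_strands_def
  proof (intro conjI ballI allI impI)
    show "meets_in_strands D' B S" "meets_in_strands D B S"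
      using replaces by (simp_all add: replaces_strands_def)
  qed (use * circles_eq in \<open>simp_all\<close>)
qed (rule valid closed_disc finite_strands)+

lemma strand_props:
  assumes "(c, a, b) \<in> S"
  shows "c \<in> circles D" "a \<noteq> b" "\<bar>a - b\<bar> < 1"
proof -
  have "\<forall>(c, a, b)\<in>S. c \<in> circles D \<and> a \<noteq> b \<and> \<bar>a - b\<bar> < 1 \<and>
      (\<forall>t\<in>open_segment a b. curve D c t \<in> interior B)"
    using replaces by (simp add: replaces_strands_def meets_in_strands_def)
  then show "c \<in> circles D" "a \<noteq> b" "\<bar>a - b\<bar> < 1" using assms by blast+
qed

lemma strands_disjoint: "s \<in> S \<Longrightarrow> r \<in> S \<Longrightarrow> s \<noteq> r \<Longrightarrow> p \<in> strand_set s \<Longrightarrow> p \<notin> strand_set r"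
proof -
  have "pairwise (\<lambda>s s'. disjnt (strand_set s) (strand_set s')) S"
    using replaces by (simp add: replaces_strands_def meets_in_strands_def)
  then show "s \<in> S \<Longrightarrow> r \<in> S \<Longrightarrow> s \<noteq> r \<Longrightarrow> p \<in> strand_set s \<Longrightarrow> p \<notin> strand_set r"
    by (metis pairwiseD disjnt_iff)
qed

text \<open>
  The two diagrams agree in a neighbourhood of each outside parameter, the disc being closed; hence
  even their velocities agree.
\<close>

lemma outside_agree:
  assumes "fst p \<in> circles D" "p \<notin> inside"
  shows "position D' p = position D p" "is_over D' p = is_over D p" "velocity D' p = velocity D p"
proof -
  obtain c t where p: "p = (c, t)" by fastforce
  have c: "c \<in> circles D" using assms p by simp
  have agree: "curve D' c u = curve D c u \<and> over D' c u = over D c u" if "curve D c u \<notin> B" for u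
    using replaces that c by (auto simp: replaces_strands_def)
  have t: "curve D c t \<notin> B" using in_disc_iff[OF assms(1)] assms(2) by (simp add: p position_def)
  show "position D' p = position D p" "is_over D' p = is_over D p"
    using agree[OF t] by (simp_all add: p position_def is_over_def)
  have "open (curve D c -` (- B))"
    using curve_continuous[OF valid(1) c, of UNIV] closed_disc
    by (simp add: continuous_on_open_vimage open_Compl)
  moreover have "t \<in> curve D c -` (- B)" using t by simp
  moreover have "(curve D c has_vector_derivative velocity D (c, t)) (at t)"
    by (rule curve_has_derivative[OF valid(1) c])
  ultimately have "(curve D' c has_vector_derivative velocity D (c, t)) (at t)"
    using agree by (elim has_vector_derivative_transform_within_open) auto
  then show "velocity D' p = velocity D p"
    by (simp add: p velocity_def vector_derivative_at)
qed

lemma same_side: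
  "(p, q) \<in> double_points D \<Longrightarrow> p \<in> inside \<longleftrightarrow> q \<in> inside"
  using in_disc_iff(1)[of p] in_disc_iff(1)[of q] by (auto simp: double_points_def points_def)

lemma outside_double_points:
  assumes "p \<notin> inside" "(p, q) \<in> double_points D"
  shows "(p, q) \<in> double_points D'"
proof -
  have "q \<notin> inside" using assms same_side by blast
  then show ?thesis
    using assms outside_agree(1)[of p] outside_agree(1)[of q]
    by (auto simp: double_points_def points_def circles_eq)
qed

definition outer :: "((nat \<times> real) \<times> (nat \<times> real)) set" where
  "outer = {x \<in> classical D. fst x \<notin> inside}"

definition on_strand :: "diagram \<Rightarrow> strand \<Rightarrow> ((nat \<times> real) \<times> (nat \<times> real)) set" where
  "on_strand E s = {x \<in> classical E. fst x \<in> strand_set s}"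

definition inner :: "diagram \<Rightarrow> ((nat \<times> real) \<times> (nat \<times> real)) set" where
  "inner E = {x \<in> classical E. fst x \<in> inside}"

lemma outer_subset: "outer \<subseteq> classical D'"
proof
  fix x assume "x \<in> outer"
  then obtain p q where x: "x = (p, q)" "(p, q) \<in> classical D" "p \<notin> inside"
    by (cases x) (auto simp: outer_def)
  then have "q \<notin> inside" using same_side[of p q] by (auto simp: classical_def)
  then show "x \<in> classical D'"
    using x outside_double_points outside_agree(2) classical_in_points[OF x(2)]
    by (auto simp: classical_def points_def)
qed

lemma outer_facts:
  assumes "(p, q) \<in> outer"
  shows "p \<notin> inside" "q \<notin> inside" "fst p \<in> circles D" "fst q \<in> circles D"
    "weight D' (p, q) = weight D (p, q)" "is_over D' p = is_over D p"
proof -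
  show pq: "p \<notin> inside" "fst p \<in> circles D" "fst q \<in> circles D"
    using assms classical_in_points[of p q D] by (auto simp: outer_def points_def)
  show "q \<notin> inside" using assms same_side[of p q] by (auto simp: outer_def classical_def)
  then show "weight D' (p, q) = weight D (p, q)" "is_over D' p = is_over D p"
    using pq by (simp_all add: weight_def crossing_sign_def outside_agree)
qed

lemma outer_converse: "{x \<in> classical D'. fst x \<notin> inside} \<subseteq> classical D"
  using local_move.outer_subset[OF swap]
  unfolding local_move.outer_def[OF swap] local_move.inside_def[OF swap] inside_def .

lemma classical_split: "classical D = outer \<union> inner D" "classical D' = outer \<union> inner D'"
  "outer \<inter> inner D = {}" "outer \<inter> inner D' = {}"
  using outer_subset outer_converse by (auto simp: outer_def inner_def)

lemma finite_parts: "finite outer" "finite (inner D)" "finite (inner D')"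
  "finite (on_strand D s)" "finite (on_strand D' s)"
  using finite_classical[OF valid(1)] finite_classical[OF valid(2)]
  by (auto simp: outer_def inner_def on_strand_def)

lemma inner_eq: "inner E = (\<Union>s\<in>S. on_strand E s)"
  by (auto simp: inner_def on_strand_def inside_def)

lemma weigh_inner:
  assumes "E = D \<or> E = D'"
  shows "local_weigh (inner E) E \<kappa> c =
    (\<Sum>s | s \<in> S \<and> fst s = c. local_weigh (on_strand E s) E \<kappa> c)"
proof -
  have "{x. x \<in> inner E \<and> fst (fst x) = c} =
      (\<Union>s\<in>{s. s \<in> S \<and> fst s = c}. {x. x \<in> on_strand E s \<and> fst (fst x) = c})"
  proof (intro set_eqI iffI)
    fix x assume "x \<in> {x. x \<in> inner E \<and> fst (fst x) = c}"
    then obtain s where s: "s \<in> S" "x \<in> on_strand E s" "fst (fst x) = c"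
      by (auto simp: inner_eq)
    then have "fst s = c" using fst_in_strand_set[of "fst x" s] by (simp add: on_strand_def)
    then show "x \<in> (\<Union>s\<in>{s. s \<in> S \<and> fst s = c}. {x. x \<in> on_strand E s \<and> fst (fst x) = c})"
      using s by blast
  qed (auto simp: inner_eq)
  moreover have "sum f \<dots> = (\<Sum>s | s \<in> S \<and> fst s = c. sum f {x. x \<in> on_strand E s \<and> fst (fst x) = c})"
    for f :: "_ \<Rightarrow> int"
  proof (rule sum.UNION_disjoint)
    have "finite (on_strand E s)" for s using finite_parts(4,5) assms by blast
    then show "\<forall>s\<in>{s. s \<in> S \<and> fst s = c}. finite {x. x \<in> on_strand E s \<and> fst (fst x) = c}" by simp
    have "on_strand E s \<inter> on_strand E r = {}" if "s \<in> S" "r \<in> S" "s \<noteq> r" for s r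
      using strands_disjoint[OF that] by (auto simp: on_strand_def)
    then show "\<forall>s\<in>{s. s \<in> S \<and> fst s = c}. \<forall>r\<in>{s. s \<in> S \<and> fst s = c}. s \<noteq> r \<longrightarrow>
      {x. x \<in> on_strand E s \<and> fst (fst x) = c} \<inter> {x. x \<in> on_strand E r \<and> fst (fst x) = c} = {}"
      by blast
  qed (use finite_strands in simp)
  ultimately show ?thesis unfolding local_weigh_def by simp
qed

lemma weigh_split:
  "weigh D \<kappa> c = local_weigh outer D \<kappa> c +
    (\<Sum>s | s \<in> S \<and> fst s = c. local_weigh (on_strand D s) D \<kappa> c)"
  "weigh D' \<kappa> c = local_weigh outer D \<kappa> c +
    (\<Sum>s | s \<in> S \<and> fst s = c. local_weigh (on_strand D' s) D' \<kappa> c)"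
proof -
  show "weigh D \<kappa> c = local_weigh outer D \<kappa> c +
    (\<Sum>s | s \<in> S \<and> fst s = c. local_weigh (on_strand D s) D \<kappa> c)"
    using local_weigh_Un[OF finite_parts(1,2) classical_split(3)]
    by (simp add: classical_split(1) weigh_inner)
  have "local_weigh outer D' \<kappa> c = local_weigh outer D \<kappa> c"
    unfolding local_weigh_def by (rule sum.cong) (auto simp: outer_facts)
  then show "weigh D' \<kappa> c = local_weigh outer D \<kappa> c +
    (\<Sum>s | s \<in> S \<and> fst s = c. local_weigh (on_strand D' s) D' \<kappa> c)"
    using local_weigh_Un[OF finite_parts(1,3) classical_split(4)]
    by (simp add: classical_split(2) weigh_inner)
qed

lemma step_off_strand:
  assumes "(c, a, b) \<in> S" "u \<in> closed_segment a b" "v \<in> closed_segment a b" "(c, t) \<notin> strand_set (c, a, b)"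
  shows "step (t - u) = step (t - v)" "step (u - t) = step (v - t)"
proof -
  show "step (t - u) = step (t - v)"
    using assms strand_props(3)[OF assms(1)] by (intro step_const_on_closed_arc[of _ a b]) (auto simp: strand_set_iff)
  then show "step (u - t) = step (v - t)"
    by (simp add: step_swap[of u] step_swap[of v])
qed

text \<open>
  It suffices to control each strand separately: the total jump along it must be the same before and
  after the move, and seen from outside the strand, the numbering may change by a constant \<open>K\<close> only.
  The sum of these constants over the strands of a circle is the \<open>drift\<close> of its numbering.
\<close>

context
  fixes K :: "strand \<Rightarrow> int"
  assumes deg: "\<And>s. s \<in> S \<Longrightarrow>
      local_weigh (on_strand D s) D (\<lambda>_. 1) (fst s) = local_weigh (on_strand D' s) D' (\<lambda>_. 1) (fst s)"
    and K: "\<And>s t. s \<in> S \<Longrightarrow> (fst s, t) \<notin> strand_set s \<Longrightarrow>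
      local_weigh (on_strand D' s) D' (\<lambda>u. step (t - u)) (fst s) =
      local_weigh (on_strand D s) D (\<lambda>u. step (t - u)) (fst s) + K s"
begin

definition drift :: "nat \<Rightarrow> int" where
  "drift c = (\<Sum>s | s \<in> S \<and> fst s = c. K s)"

lemma monodromy_eq: "monodromy D' c = monodromy D c"
proof -
  have "(\<Sum>s | s \<in> S \<and> fst s = c. local_weigh (on_strand D s) D (\<lambda>_. 1) c) =
    (\<Sum>s | s \<in> S \<and> fst s = c. local_weigh (on_strand D' s) D' (\<lambda>_. 1) c)"
    by (rule sum.cong) (use deg in auto)
  then show ?thesis by (simp add: monodromy_def weigh_split)
qed

lemma numbering_outside:
  assumes "p \<notin> inside"
  shows "numbering D' p = numbering D p + drift (fst p)"
proof -
  have "local_weigh (on_strand D' s) D' (\<lambda>u. step (snd p - u)) (fst p) =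
    local_weigh (on_strand D s) D (\<lambda>u. step (snd p - u)) (fst p) + K s"
    if "s \<in> S" "fst s = fst p" for s
    using K[of s "snd p"] assms that by (auto simp: inside_def)
  then show ?thesis
    by (simp add: numbering_def weigh_split drift_def sum.distrib)
qed

text \<open>
  Points of one strand see everything off the strand alike, so the numberings before and after the move
  differ by the drift and by the events on the strand itself.
\<close>

lemma numbering_on_strand:
  assumes s: "(c, a, b) \<in> S" and u: "u \<in> closed_segment a b" "u' \<in> closed_segment a b"
  shows "numbering D' (c, u') = numbering D (c, u) + drift c - K (c, a, b) +
    local_weigh (on_strand D' (c, a, b)) D' (\<lambda>v. step (u' - v)) c -
    local_weigh (on_strand D (c, a, b)) D (\<lambda>v. step (u - v)) c"
proof -
  let ?s = "(c, a, b)"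
  let ?R = "{r. r \<in> S \<and> fst r = c}"
  have fin: "finite ?R" and mem: "?s \<in> ?R" using finite_strands s by auto
  have in_s: "(c, v) \<in> strand_set ?s" if "v \<in> closed_segment a b" for v
    using that by (auto simp: strand_set_iff intro: exI[of _ 0])
  have shift: "local_weigh X E (\<lambda>v. step (u - v)) c = local_weigh X E (\<lambda>v. step (u' - v)) c"
    if X: "\<And>x. x \<in> X \<Longrightarrow> fst x \<notin> strand_set ?s" for X E
    unfolding local_weigh_def
  proof (rule sum.cong)
    fix x assume "x \<in> {x. x \<in> X \<and> fst (fst x) = c}"
    then have "(c, snd (fst x)) \<notin> strand_set ?s" using X by (cases x) auto
    then show "weight E x * step (u - snd (fst x)) = weight E x * step (u' - snd (fst x))"
      using step_off_strand(2)[OF s u] by simp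
  qed simp
  have out: "local_weigh outer D (\<lambda>v. step (u - v)) c = local_weigh outer D (\<lambda>v. step (u' - v)) c"
    using s by (intro shift) (auto simp: outer_def inside_def)
  \<comment> \<open>Another strand changes the number by its constant, as its points are outside of this strand
    and conversely.\<close>
  have other: "local_weigh (on_strand D' r) D' (\<lambda>v. step (u' - v)) c =
      local_weigh (on_strand D r) D (\<lambda>v. step (u - v)) c + K r" if r: "r \<in> ?R - {?s}" for r
  proof -
    have "(fst r, u) \<notin> strand_set r" using strands_disjoint[of ?s r] in_s[OF u(1)] s r by auto
    then have "local_weigh (on_strand D' r) D' (\<lambda>v. step (u - v)) c =
      local_weigh (on_strand D r) D (\<lambda>v. step (u - v)) c + K r"
      using K[of r u] r by simp
    moreover have "local_weigh (on_strand D' r) D' (\<lambda>v. step (u - v)) c =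
        local_weigh (on_strand D' r) D' (\<lambda>v. step (u' - v)) c"
      using strands_disjoint[of r ?s] r s by (intro shift) (auto simp: on_strand_def)
    ultimately show ?thesis by simp
  qed
  have "numbering D' (c, u') = local_weigh outer D (\<lambda>v. step (u' - v)) c +
      (local_weigh (on_strand D' ?s) D' (\<lambda>v. step (u' - v)) c +
      (\<Sum>r\<in>?R - {?s}. local_weigh (on_strand D' r) D' (\<lambda>v. step (u' - v)) c))"
    using sum.remove[OF fin mem, of "\<lambda>r. local_weigh (on_strand D' r) D' (\<lambda>v. step (u' - v)) c"]
    by (simp add: numbering_def weigh_split)
  moreover have "numbering D (c, u) = local_weigh outer D (\<lambda>v. step (u - v)) c +
      (local_weigh (on_strand D ?s) D (\<lambda>v. step (u - v)) c +
      (\<Sum>r\<in>?R - {?s}. local_weigh (on_strand D r) D (\<lambda>v. step (u - v)) c))"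
    using sum.remove[OF fin mem, of "\<lambda>r. local_weigh (on_strand D r) D (\<lambda>v. step (u - v)) c"]
    by (simp add: numbering_def weigh_split)
  moreover have "drift c = K ?s + (\<Sum>r\<in>?R - {?s}. K r)"
    unfolding drift_def sum.remove[OF fin mem] by simp
  ultimately show ?thesis using out other by (simp add: sum.distrib)
qed

lemma shifted_on_strand:
  assumes s: "(c, a, b) \<in> S" and u: "u \<in> closed_segment a b" "u' \<in> closed_segment a b"
    and h: "h' c - h c = - drift c"
    and bal: "balanced D" "balanced D'"
  shows "shifted D' h' (wrap (c, u')) - shifted D h (wrap (c, u)) =
    local_weigh (on_strand D' (c, a, b)) D' (\<lambda>v. step (u' - v)) c -
    local_weigh (on_strand D (c, a, b)) D (\<lambda>v. step (u - v)) c - K (c, a, b)"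
  using numbering_on_strand[OF s u] h shifted_wrap[OF bal(1), of "(c, u)"] shifted_wrap[OF bal(2), of "(c, u')"]
    strand_props(1)[OF s] circles_eq by (simp add: shifted_def)

text \<open>
  If the constants are chosen such that they undo the drift, nothing changes at the outer crossings, and
  only the crossings inside the disc remain to be compared.
\<close>

lemma transports_local_move:
  assumes inn: "\<And>h h' n. \<lbrakk>balanced D; balanced D'; \<forall>c\<in>circles D. h' c - h c = - drift c; n \<noteq> 0\<rbrakk> \<Longrightarrow>
    local_writhe (inner D) D (shifted D h) n = local_writhe (inner D') D' (shifted D' h') n"
  shows "transports D (Id_on (circles D)) D'"
proof -
  have "\<exists>f :: nat \<times> nat \<Rightarrow> int.
      (\<forall>c\<in>circles D. (\<Sum>e | e \<in> Id_on (circles D) \<and> fst e = c. f e) = monodromy D c) \<and>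
      (\<forall>c\<in>circles D'. (\<Sum>e | e \<in> Id_on (circles D) \<and> snd e = c. f e) = monodromy D' c)"
  proof (intro exI[of _ "\<lambda>e. monodromy D (fst e)"] conjI ballI)
    fix c assume "c \<in> circles D"
    then have "{e. e \<in> Id_on (circles D) \<and> fst e = c} = {(c, c)}" by auto
    then show "(\<Sum>e | e \<in> Id_on (circles D) \<and> fst e = c. monodromy D (fst e)) = monodromy D c" by simp
  next
    fix c assume "c \<in> circles D'"
    then have "{e. e \<in> Id_on (circles D) \<and> snd e = c} = {(c, c)}" using circles_eq by auto
    then show "(\<Sum>e | e \<in> Id_on (circles D) \<and> snd e = c. monodromy D (fst e)) = monodromy D' c"
      by (simp add: monodromy_eq)
  qed
  moreover have "\<exists>g. \<forall>h h'. (\<forall>(c, c')\<in>Id_on (circles D). h' c' - h c = g (c, c')) \<longrightarrow>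
        (\<forall>n. n \<noteq> 0 \<longrightarrow> index_writhe D (shifted D h) n = index_writhe D' (shifted D' h') n)"
    if bal: "balanced D" "balanced D'"
  proof (intro exI[of _ "\<lambda>(c, c'). - drift c"] allI impI)
    fix h h' n assume "\<forall>(c, c')\<in>Id_on (circles D). h' c' - h c = (case (c, c') of (c, c') \<Rightarrow> - drift c)"
      and n: "n \<noteq> (0::int)"
    then have h: "\<forall>c\<in>circles D. h' c - h c = - drift c" by auto
    have same: "shifted D' h' p = shifted D h p" if "fst p \<in> circles D" "p \<notin> inside" for p
      using numbering_outside[OF that(2)] bspec[OF h that(1)] by (simp add: shifted_def)
    have "local_writhe outer D (shifted D h) n = local_writhe outer D' (shifted D' h') n"
    proof -
      have "shifted D' h' (fst x) = shifted D h (fst x)" "shifted D' h' (snd x) = shifted D h (snd x)"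
        "weight D' x = weight D x" "is_over D' (fst x) = is_over D (fst x)" if "x \<in> outer" for x
        using outer_facts[of "fst x" "snd x"] that same by simp_all
      then show ?thesis unfolding local_writhe_def by (intro sum.cong) auto
    qed
    then show "index_writhe D (shifted D h) n = index_writhe D' (shifted D' h') n"
      using inn[OF bal h n] local_writhe_Un[OF finite_parts(1,2) classical_split(3)]
        local_writhe_Un[OF finite_parts(1,3) classical_split(4)]
      by (simp add: classical_split(1,2))
  qed
  ultimately show ?thesis unfolding transports_def using circles_eq by auto
qed

end

end

context local_move begin

text \<open>
  The situation on each strand of a first or second move: two passages with opposite weights, or, if the
  crossings are virtual, none.
\<close>

definition cancelling :: "strand \<Rightarrow> bool" where
  "cancelling = (\<lambda>(c, a, b). on_strand D (c, a, b) = {} \<or>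
    (\<exists>u v p q. u \<in> closed_segment a b \<and> v \<in> closed_segment a b \<and>
      on_strand D (c, a, b) = {(wrap (c, u), p), (wrap (c, v), q)} \<and>
      (wrap (c, u), p) \<noteq> (wrap (c, v), q) \<and>
      weight D (wrap (c, v), q) = - weight D (wrap (c, u), p)))"

lemma weigh_two:
  assumes "X = {(wrap (c, u), p), (wrap (c, v), q)}" "(wrap (c, u), p) \<noteq> (wrap (c, v), q)"
    "weight D (wrap (c, v), q) = - weight D (wrap (c, u), p)"
  shows "local_weigh X D \<kappa> c = weight D (wrap (c, u), p) * (\<kappa> (frac u) - \<kappa> (frac v))"
proof -
  have "{x. x \<in> X \<and> fst (fst x) = c} = {(wrap (c, u), p), (wrap (c, v), q)}"
    using assms(1) by auto
  then show ?thesis unfolding local_weigh_def using assms(2,3) by (simp add: algebra_simps)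
qed

text \<open>
  The number rises at one passage as much as it falls at the other one, so the move is not
  noticed from outside, and by symmetry both passages carry the same mean value.
\<close>

lemma cancelling_weigh:
  assumes s: "(c, a, b) \<in> S" and canc: "cancelling (c, a, b)"
  shows "local_weigh (on_strand D (c, a, b)) D (\<lambda>_. 1) c = 0"
    and "\<exists>k. \<forall>t. (c, t) \<notin> strand_set (c, a, b) \<longrightarrow>
      local_weigh (on_strand D (c, a, b)) D (\<lambda>u. step (t - u)) c = k"
    and "x \<in> on_strand D (c, a, b) \<Longrightarrow> y \<in> on_strand D (c, a, b) \<Longrightarrow>
      \<exists>u v. u \<in> closed_segment a b \<and> v \<in> closed_segment a b \<and> fst x = wrap (c, u) \<and> fst y = wrap (c, v) \<and>
      local_weigh (on_strand D (c, a, b)) D (\<lambda>w. step (u - w)) c =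
      local_weigh (on_strand D (c, a, b)) D (\<lambda>w. step (v - w)) c"
proof -
  let ?X = "on_strand D (c, a, b)"
  obtain u v w where uv: "u \<in> closed_segment a b" "v \<in> closed_segment a b"
    and sub: "fst ` ?X \<subseteq> {wrap (c, u), wrap (c, v)}"
    and W: "\<And>\<kappa>. local_weigh ?X D \<kappa> c = w * (\<kappa> (frac u) - \<kappa> (frac v))"
  proof (cases "?X = {}")
    case True
    \<comment> \<open>Without passages, the weight 0 at an arbitrary point of the strand serves for both of them.\<close>
    show ?thesis by (rule that[of a a 0]) (simp_all add: True local_weigh_def)
  next
    case False
    then obtain u v p q where uv: "u \<in> closed_segment a b" "v \<in> closed_segment a b"
      and X: "?X = {(wrap (c, u), p), (wrap (c, v), q)}" "(wrap (c, u), p) \<noteq> (wrap (c, v), q)"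
      "weight D (wrap (c, v), q) = - weight D (wrap (c, u), p)"
      using canc unfolding cancelling_def split_conv by blast
    show ?thesis by (rule that[OF uv _ weigh_two[OF X]]) (simp add: X(1))
  qed
  show "local_weigh ?X D (\<lambda>_. 1) c = 0" by (simp add: W)
  have "step (t - frac u) - step (t - frac v) = 2 * \<lfloor>u\<rfloor> - 2 * \<lfloor>v\<rfloor>"
    if "(c, t) \<notin> strand_set (c, a, b)" for t
    using step_off_strand(1)[OF s uv that] by (simp add: step_frac)
  then show "\<exists>k. \<forall>t. (c, t) \<notin> strand_set (c, a, b) \<longrightarrow> local_weigh ?X D (\<lambda>u. step (t - u)) c = k"
    by (intro exI[of _ "w * (2 * \<lfloor>u\<rfloor> - 2 * \<lfloor>v\<rfloor>)"]) (simp add: W)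
  have level: "local_weigh ?X D (\<lambda>w. step (u - w)) c = local_weigh ?X D (\<lambda>w. step (v - w)) c"
    by (simp add: W step_frac step_swap[of v u])
  show "\<exists>u v. u \<in> closed_segment a b \<and> v \<in> closed_segment a b \<and> fst x = wrap (c, u) \<and> fst y = wrap (c, v) \<and>
      local_weigh ?X D (\<lambda>w. step (u - w)) c = local_weigh ?X D (\<lambda>w. step (v - w)) c"
    if "x \<in> ?X" "y \<in> ?X"
  proof -
    obtain u' v' where *: "u' \<in> {u, v}" "v' \<in> {u, v}" "fst x = wrap (c, u')" "fst y = wrap (c, v')"
      using sub \<open>x \<in> ?X\<close> \<open>y \<in> ?X\<close> by blast
    show ?thesis by (rule exI[of _ u'], rule exI[of _ v']) (use * uv level in auto)
  qed
qed

lemma transports_cancelling: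
  assumes none: "inner D' = {}" and canc: "\<And>s. s \<in> S \<Longrightarrow> cancelling s"
    and writhe: "\<And>M n. n \<noteq> 0 \<Longrightarrow>
      (\<And>s x y. s \<in> S \<Longrightarrow> x \<in> on_strand D s \<Longrightarrow> y \<in> on_strand D s \<Longrightarrow> M (fst x) = M (fst y)) \<Longrightarrow>
      local_writhe (inner D) D M n = 0"
  shows "transports D (Id_on (circles D)) D'"
proof -
  have none': "on_strand D' s = {}" if "s \<in> S" for s
    using none that unfolding inner_eq by blast
  have zero: "local_weigh {} E \<kappa> c = 0" for E \<kappa> c by (simp add: local_weigh_def)
  have "\<forall>s\<in>S. \<exists>k. \<forall>t. (fst s, t) \<notin> strand_set s \<longrightarrow>
      local_weigh (on_strand D s) D (\<lambda>u. step (t - u)) (fst s) = k"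
  proof
    fix s assume "s \<in> S"
    then show "\<exists>k. \<forall>t. (fst s, t) \<notin> strand_set s \<longrightarrow>
        local_weigh (on_strand D s) D (\<lambda>u. step (t - u)) (fst s) = k"
      using cancelling_weigh(2) canc by (cases s) simp
  qed
  then obtain k where k: "\<And>s t. s \<in> S \<Longrightarrow> (fst s, t) \<notin> strand_set s \<Longrightarrow>
      local_weigh (on_strand D s) D (\<lambda>u. step (t - u)) (fst s) = k s"
    by metis
  define K where "K s = - k s" for s
  have deg: "local_weigh (on_strand D s) D (\<lambda>_. 1) (fst s) = local_weigh (on_strand D' s) D' (\<lambda>_. 1) (fst s)"
    if "s \<in> S" for s
    using cancelling_weigh(1) canc that by (cases s) (simp add: none' zero)
  have K: "local_weigh (on_strand D' s) D' (\<lambda>u. step (t - u)) (fst s) =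
      local_weigh (on_strand D s) D (\<lambda>u. step (t - u)) (fst s) + K s"
    if "s \<in> S" "(fst s, t) \<notin> strand_set s" for s t
    using k[OF that] that by (simp add: none' zero K_def)
  show ?thesis
  proof (rule transports_local_move[OF deg K])
    fix h h' :: "nat \<Rightarrow> int" and n :: int
    assume bal: "balanced D" "balanced D'" and h: "\<forall>c\<in>circles D. h' c - h c = - drift K c" and n: "n \<noteq> 0"
    have "shifted D h (fst x) = shifted D h (fst y)"
      if s: "s \<in> S" and xy: "x \<in> on_strand D s" "y \<in> on_strand D s" for s x y
    proof -
      obtain c a b where abc: "s = (c, a, b)" by (cases s)
      have S: "(c, a, b) \<in> S" using s abc by simp
      obtain u v where uv: "u \<in> closed_segment a b" "v \<in> closed_segment a b"
        and fst: "fst x = wrap (c, u)" "fst y = wrap (c, v)"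
        and level: "local_weigh (on_strand D (c, a, b)) D (\<lambda>w. step (u - w)) c =
          local_weigh (on_strand D (c, a, b)) D (\<lambda>w. step (v - w)) c"
        using cancelling_weigh(3)[OF S canc[OF S]] xy abc by blast
      have "h' c - h c = - drift K c" using h strand_props(1)[OF S] by blast
      from shifted_on_strand[where K = K and h = h and h' = h', OF deg K S uv(1) uv(1) this bal]
        shifted_on_strand[where K = K and h = h and h' = h', OF deg K S uv(2) uv(1) this bal]
      show ?thesis using level fst by simp
    qed
    then have "local_writhe (inner D) D (shifted D h) n = 0" using writhe n by blast
    then show "local_writhe (inner D) D (shifted D h) n = local_writhe (inner D') D' (shifted D' h') n"
      by (simp add: none local_writhe_def)
  qed
qed

text \<open>
  The third move with classical crossings, described by the positions \<open>e s r\<close> and \<open>e' s r\<close> of the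
  crossing with \<open>r\<close> on the strand \<open>s\<close>. The two sums in the last hypothesis are the changes of the
  number at the two passages of the crossing of \<open>s\<close> and \<open>r\<close>; if they agree, the index of the
  crossing does not change.
\<close>

lemma transports_triangle:
  fixes e e' :: "strand \<Rightarrow> strand \<Rightarrow> real" and W :: "strand \<Rightarrow> strand \<Rightarrow> int"
  defines "x \<equiv> \<lambda>s r. (wrap (fst s, e s r), wrap (fst r, e r s))"
    and "x' \<equiv> \<lambda>s r. (wrap (fst s, e' s r), wrap (fst r, e' r s))"
  assumes seg: "\<And>c a b r. (c, a, b) \<in> S \<Longrightarrow> r \<in> S \<Longrightarrow> (c, a, b) \<noteq> r \<Longrightarrow>
      e (c, a, b) r \<in> closed_segment a b \<and> e' (c, a, b) r \<in> closed_segment a b"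
    and inj: "\<And>s. s \<in> S \<Longrightarrow> inj_on (e s) (S - {s}) \<and> inj_on (e' s) (S - {s})"
    and on: "\<And>s. s \<in> S \<Longrightarrow> on_strand D s = x s ` (S - {s}) \<and> on_strand D' s = x' s ` (S - {s})"
    and wt: "\<And>s r. s \<in> S \<Longrightarrow> r \<in> S \<Longrightarrow> s \<noteq> r \<Longrightarrow> weight D (x s r) = W s r \<and> weight D' (x' s r) = W s r"
    and over: "\<And>s r. s \<in> S \<Longrightarrow> r \<in> S \<Longrightarrow> s \<noteq> r \<Longrightarrow> is_over D (fst (x s r)) = is_over D' (fst (x' s r))"
    and shift: "\<And>s r. s \<in> S \<Longrightarrow> r \<in> S \<Longrightarrow> s \<noteq> r \<Longrightarrow>
      (\<Sum>q\<in>S - {s}. W s q * (step (e' s r - e' s q) - step (e s r - e s q))) =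
      (\<Sum>q\<in>S - {r}. W r q * (step (e' r s - e' r q) - step (e r s - e r q)))"
  shows "transports D (Id_on (circles D)) D'"
proof -
  have wrap_inj: "u = v" if "s = (c, a, b)" "s \<in> S" "wrap (c, u) = wrap (c, v)" "u \<in> closed_segment a b" "v \<in> closed_segment a b"
    for s c a b u v
  proof -
    have "u - v \<in> \<int>" using that(3) by (simp add: wrap_eq_iff)
    moreover have "\<bar>u - v\<bar> < 1"
      using that strand_props(3)[of c a b] by (auto simp: closed_segment_eq_real_ivl split: if_splits)
    moreover obtain z where z: "u - v = of_int z" using \<open>u - v \<in> \<int>\<close> by (rule Ints_cases)
    ultimately have "z = 0" by linarith
    then show ?thesis using z by simp
  qed
  have inj_x: "inj_on (x s) (S - {s})" "inj_on (x' s) (S - {s})" if s: "s \<in> S" for s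
  proof -
    obtain c a b where abc: "s = (c, a, b)" by (cases s)
    show "inj_on (x s) (S - {s})"
    proof (rule inj_onI)
      fix q r assume *: "q \<in> S - {s}" "r \<in> S - {s}" "x s q = x s r"
      then have "e s q = e s r" using wrap_inj[OF abc s, of "e s q" "e s r"] seg[of c a b q] seg[of c a b r] s
        by (auto simp: abc x_def)
      then show "q = r" using inj[OF s] * by (meson inj_onD)
    qed
    show "inj_on (x' s) (S - {s})"
    proof (rule inj_onI)
      fix q r assume *: "q \<in> S - {s}" "r \<in> S - {s}" "x' s q = x' s r"
      then have "e' s q = e' s r" using wrap_inj[OF abc s, of "e' s q" "e' s r"] seg[of c a b q] seg[of c a b r] s
        by (auto simp: abc x'_def)
      then show "q = r" using inj[OF s] * by (meson inj_onD)
    qed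
  qed
  have LW: "local_weigh (on_strand D s) D \<kappa> (fst s) = (\<Sum>r\<in>S - {s}. W s r * \<kappa> (frac (e s r)))"
    "local_weigh (on_strand D' s) D' \<kappa> (fst s) = (\<Sum>r\<in>S - {s}. W s r * \<kappa> (frac (e' s r)))"
    if s: "s \<in> S" for s \<kappa>
  proof -
    have "{y. y \<in> on_strand D s \<and> fst (fst y) = fst s} = x s ` (S - {s})"
      "{y. y \<in> on_strand D' s \<and> fst (fst y) = fst s} = x' s ` (S - {s})"
      using on[OF s] by (auto simp: x_def x'_def)
    then show "local_weigh (on_strand D s) D \<kappa> (fst s) = (\<Sum>r\<in>S - {s}. W s r * \<kappa> (frac (e s r)))"
      "local_weigh (on_strand D' s) D' \<kappa> (fst s) = (\<Sum>r\<in>S - {s}. W s r * \<kappa> (frac (e' s r)))"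
      unfolding local_weigh_def using inj_x[OF s] wt[OF s]
      by (auto simp: sum.reindex x_def x'_def intro!: sum.cong)
  qed
  define K where "K s = (\<Sum>r\<in>S - {s}. W s r * (2 * \<lfloor>e' s r\<rfloor> - 2 * \<lfloor>e s r\<rfloor>))" for s
  have deg: "local_weigh (on_strand D s) D (\<lambda>_. 1) (fst s) = local_weigh (on_strand D' s) D' (\<lambda>_. 1) (fst s)"
    if "s \<in> S" for s
    using LW[OF that] by simp
  have K: "local_weigh (on_strand D' s) D' (\<lambda>u. step (t - u)) (fst s) =
      local_weigh (on_strand D s) D (\<lambda>u. step (t - u)) (fst s) + K s"
    if s: "s \<in> S" and t: "(fst s, t) \<notin> strand_set s" for s t
  proof -
    have "step (t - e s r) = step (t - e' s r)" if "r \<in> S - {s}" for r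
      using step_off_strand(1)[of "fst s" "fst (snd s)" "snd (snd s)"] seg[of "fst s" "fst (snd s)" "snd (snd s)" r] s t that
      by auto
    then show ?thesis
      unfolding LW[OF s] K_def sum.distrib[symmetric]
      by (intro sum.cong) (auto simp: step_frac algebra_simps)
  qed
  show ?thesis
  proof (rule transports_local_move[OF deg K])
    fix h h' :: "nat \<Rightarrow> int" and n :: int
    assume bal: "balanced D" "balanced D'" and h: "\<forall>c\<in>circles D. h' c - h c = - drift K c" and n: "n \<noteq> 0"
    have diff: "shifted D' h' (fst (x' s r)) - shifted D h (fst (x s r)) =
        (\<Sum>q\<in>S - {s}. W s q * (step (e' s r - e' s q) - step (e s r - e s q)))"
      if s: "s \<in> S" and r: "r \<in> S" "s \<noteq> r" for s r
    proof -
      obtain c a b where abc: "s = (c, a, b)" by (cases s)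
      have S: "(c, a, b) \<in> S" using s abc by simp
      have "h' c - h c = - drift K c" using h strand_props(1)[OF S] by blast
      from shifted_on_strand[where K = K and h = h and h' = h', OF deg K S _ _ this bal, of "e s r" "e' s r"] seg[OF S r(1)] r(2)
      have "shifted D' h' (fst (x' s r)) - shifted D h (fst (x s r)) =
          local_weigh (on_strand D' s) D' (\<lambda>v. step (e' s r - v)) c -
          local_weigh (on_strand D s) D (\<lambda>v. step (e s r - v)) c - K s"
        unfolding x_def x'_def abc by simp
      also have "\<dots> = (\<Sum>q\<in>S - {s}. W s q * (step (e' s r - e' s q) - step (e s r - e s q)))"
        using LW[OF s, of "\<lambda>v. step (e' s r - v)"] LW[OF s, of "\<lambda>v. step (e s r - v)"]
        by (simp add: abc K_def sum_subtractf[symmetric] step_frac algebra_simps)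
      finally show ?thesis .
    qed
    let ?Off = "{(s, r). s \<in> S \<and> r \<in> S \<and> s \<noteq> r}"
    have inner: "inner D = case_prod x ` ?Off" "inner D' = case_prod x' ` ?Off"
      using on unfolding inner_eq by fastforce+
    have onx: "fst (x s r) \<in> strand_set s" "fst (x' s r) \<in> strand_set s" if "s \<in> S" "r \<in> S" "s \<noteq> r" for s r
      using on[OF that(1)] that by (auto simp: on_strand_def)
    have inj_Off: "inj_on (case_prod x) ?Off" "inj_on (case_prod x') ?Off"
    proof -
      have same: "s = s'" if "fst y \<in> strand_set s" "fst y \<in> strand_set s'" "s \<in> S" "s' \<in> S"
        for s s' and y :: "(nat \<times> real) \<times> nat \<times> real"
        using strands_disjoint that by blast
      show "inj_on (case_prod x) ?Off"
      proof (rule inj_onI)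
        fix y z assume yz: "y \<in> ?Off" "z \<in> ?Off" "case_prod x y = case_prod x z"
        obtain s r s' r' where eq: "y = (s, r)" "z = (s', r')" by (cases y, cases z)
        have *: "x s r = x s' r'" "s \<in> S" "r \<in> S" "s \<noteq> r" "s' \<in> S" "r' \<in> S" "s' \<noteq> r'"
          using yz by (simp_all add: eq)
        have "s = s'" using same[of "x s r" s s'] onx(1)[of s r] onx(1)[of s' r'] * by simp
        moreover have "r = r'"
          using inj_onD[OF inj_x(1)[OF *(2)], of r r'] * \<open>s = s'\<close> by simp
        ultimately show "y = z" by (simp add: eq)
      qed
      show "inj_on (case_prod x') ?Off"
      proof (rule inj_onI)
        fix y z assume yz: "y \<in> ?Off" "z \<in> ?Off" "case_prod x' y = case_prod x' z"
        obtain s r s' r' where eq: "y = (s, r)" "z = (s', r')" by (cases y, cases z)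
        have *: "x' s r = x' s' r'" "s \<in> S" "r \<in> S" "s \<noteq> r" "s' \<in> S" "r' \<in> S" "s' \<noteq> r'"
          using yz by (simp_all add: eq)
        have "s = s'" using same[of "x' s r" s s'] onx(2)[of s r] onx(2)[of s' r'] * by simp
        moreover have "r = r'"
          using inj_onD[OF inj_x(2)[OF *(2)], of r r'] * \<open>s = s'\<close> by simp
        ultimately show "y = z" by (simp add: eq)
      qed
    qed
    have writhe: "local_writhe X E M n =
      (\<Sum>y\<in>X. if is_over E (fst y) \<and> M (snd y) - M (fst y) = 2 * n then weight E y else 0)"
      if "finite X" for X E M
      unfolding local_writhe_def using sum.inter_filter[OF that] by simp
    have snd_x: "snd (x s r) = fst (x r s)" "snd (x' s r) = fst (x' r s)" for s r
      by (simp_all add: x_def x'_def)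
    have "shifted D' h' (snd (x' s r)) - shifted D' h' (fst (x' s r)) =
        shifted D h (snd (x s r)) - shifted D h (fst (x s r))" if "s \<in> S" "r \<in> S" "s \<noteq> r" for s r
      using diff[of s r] diff[of r s] shift[of s r] that by (simp add: snd_x)
    note level = this
    have writhe_D: "local_writhe (inner D) D M n = (\<Sum>z\<in>?Off. let y = case_prod x z in
        if is_over D (fst y) \<and> M (snd y) - M (fst y) = 2 * n then weight D y else 0)" for M
      unfolding writhe[OF finite_parts(2)] unfolding inner(1) sum.reindex[OF inj_Off(1)] by (simp add: o_def Let_def)
    have writhe_D': "local_writhe (inner D') D' M n = (\<Sum>z\<in>?Off. let y = case_prod x' z in
        if is_over D' (fst y) \<and> M (snd y) - M (fst y) = 2 * n then weight D' y else 0)" for M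
      unfolding writhe[OF finite_parts(3)] unfolding inner(2) sum.reindex[OF inj_Off(2)] by (simp add: o_def Let_def)
    show "local_writhe (inner D) D (shifted D h) n = local_writhe (inner D') D' (shifted D' h') n"
      unfolding writhe_D writhe_D'
    proof (rule sum.cong[OF refl])
      fix z assume z: "z \<in> ?Off"
      obtain s r where sr: "z = (s, r)" by (cases z)
      have "s \<in> S" "r \<in> S" "s \<noteq> r" using z by (simp_all add: sr)
      then show "(let y = case_prod x z in
          if is_over D (fst y) \<and> shifted D h (snd y) - shifted D h (fst y) = 2 * n then weight D y else 0) =
        (let y = case_prod x' z in
          if is_over D' (fst y) \<and> shifted D' h' (snd y) - shifted D' h' (fst y) = 2 * n then weight D' y else 0)"
        using level[of s r] wt[of s r] over[of s r] by (simp add: sr Let_def)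
    qed
  qed
qed

end

section \<open>Orientations of the plane\<close>

lemma plane_det_linear:
  assumes "bounded_linear A"
  shows "plane_det (A v) (A w) = plane_det (A 1) (A \<i>) * plane_det v w"
proof -
  interpret bounded_linear A by fact
  have A: "A z = Re z *\<^sub>R A 1 + Im z *\<^sub>R A \<i>" for z
  proof -
    have "z = Re z *\<^sub>R 1 + Im z *\<^sub>R \<i>" by (simp add: complex_eq_iff)
    then show ?thesis by (metis add scaleR)
  qed
  show ?thesis
    by (subst A[of v], subst A[of w]) (simp add: plane_det_def algebra_simps)
qed

lemma plane_det_bij_nonzero:
  assumes "bounded_linear A" "bij A"
  shows "plane_det (A 1) (A \<i>) \<noteq> 0"
proof -
  obtain v w where "A v = 1" "A w = \<i>" using assms(2) by (metis bij_pointE)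
  then have "plane_det (A 1) (A \<i>) * plane_det v w = 1"
    using plane_det_linear[OF assms(1), of v w] by (simp add: plane_det_def)
  then show ?thesis by auto
qed

lemma sgn_constant_on_connected:
  fixes f :: "'a::topological_space \<Rightarrow> real"
  assumes "connected A" "continuous_on A f" "\<And>x. x \<in> A \<Longrightarrow> f x \<noteq> 0" "x \<in> A" "y \<in> A"
  shows "sgn (f x) = sgn (f y)"
proof (rule ccontr)
  assume "sgn (f x) \<noteq> sgn (f y)"
  then have "f x < 0 \<and> 0 < f y \<or> f y < 0 \<and> 0 < f x"
    using assms(3-5) by (auto simp: sgn_real_def split: if_splits) (metis linorder_neqE_linordered_idom)+
  moreover have "connected (f ` A)" using assms connected_continuous_image by blast
  moreover have "f x \<in> f ` A" "f y \<in> f ` A" using assms(4,5) by auto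
  ultimately have "0 \<in> f ` A"
    using connectedD_interval[of "f ` A" "f x" "f y" 0] connectedD_interval[of "f ` A" "f y" "f x" 0] by auto
  then show False using assms(3) by auto
qed

text \<open>
  \<open>\<sigma>\<close> is \<open>1\<close> if \<open>\<phi>\<close> preserves the orientation of the plane and \<open>-1\<close> if it reverses it.
\<close>

definition orientation_sign :: "(complex \<Rightarrow> complex) \<Rightarrow> real \<Rightarrow> bool" where
  "orientation_sign \<phi> \<sigma> \<longleftrightarrow> \<sigma> \<in> {1, -1} \<and>
    (\<exists>\<phi>'. \<forall>z. (\<phi> has_derivative \<phi>' z) (at z) \<and>
      (\<forall>v w. sgn (plane_det (\<phi>' z v) (\<phi>' z w)) = \<sigma> * sgn (plane_det v w)))"

text \<open>
  The Jacobian determinant is continuous and has no zero, so it has constant sign on the connected plane.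
\<close>

lemma plane_diffeo_orientation:
  assumes "plane_diffeo \<phi>"
  shows "\<exists>\<sigma>. orientation_sign \<phi> \<sigma>"
proof -
  obtain \<phi>' :: "complex \<Rightarrow> complex \<Rightarrow>\<^sub>L complex" where
    der: "\<And>z. (\<phi> has_derivative blinfun_apply (\<phi>' z)) (at z)" and
    bij: "\<And>z. bij (blinfun_apply (\<phi>' z))" and cont: "continuous_on UNIV \<phi>'"
    using assms unfolding plane_diffeo_def by blast
  define J where "J z = plane_det (\<phi>' z 1) (\<phi>' z \<i>)" for z
  have J: "J z \<noteq> 0" for z
    unfolding J_def by (rule plane_det_bij_nonzero[OF blinfun.bounded_linear_right bij])
  have "continuous_on UNIV J"
    unfolding J_def plane_det_def by (intro continuous_intros cont)
  then have "sgn (J z) = sgn (J 0)" for z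
    using sgn_constant_on_connected[of UNIV J z 0] J connected_UNIV by simp
  moreover have "sgn (plane_det (\<phi>' z v) (\<phi>' z w)) = sgn (J z) * sgn (plane_det v w)" for z v w
    using plane_det_linear[OF blinfun.bounded_linear_right[of "\<phi>' z"], of v w] by (simp add: J_def sgn_mult)
  moreover have "sgn (J 0) \<in> {1, -1}" using J[of 0] by (simp add: sgn_real_def)
  ultimately show ?thesis
    unfolding orientation_sign_def using der by (intro exI[of _ "sgn (J 0)"] conjI exI[of _ "\<lambda>z. blinfun_apply (\<phi>' z)"]) auto
qed

lemma plane_diffeo_continuous: "plane_diffeo \<phi> \<Longrightarrow> continuous_on A \<phi>"
  unfolding plane_diffeo_def by (metis continuous_at_imp_continuous_on has_derivative_continuous)

lemma plane_diffeo_inj: "plane_diffeo \<phi> \<Longrightarrow> \<phi> z = \<phi> w \<longleftrightarrow> z = w"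
  unfolding plane_diffeo_def by (metis bij_is_inj injD)

lemma disc_closed:
  assumes "plane_diffeo \<phi>"
  shows "closed (\<phi> ` square)"
proof -
  have "square = cbox (Complex (-1) (-1)) (Complex 1 1)"
    by (auto simp: square_def in_cbox_complex_iff abs_le_iff)
  then have "compact square" by (metis compact_cbox)
  then show ?thesis
    using plane_diffeo_continuous[OF assms] compact_continuous_image compact_imp_closed by blast
qed

lemma local_moveI:
  assumes "virtual_link_diagram D" "virtual_link_diagram D'" "plane_diffeo \<phi>"
    "replaces_strands (\<phi> ` square) S D D'" "finite S"
  shows "local_move D D' (\<phi> ` square) S"
  using assms disc_closed by unfold_locales auto

lemma in_strand_obtain:
  assumes "p \<in> points D" "p \<in> strand_set (c, a, b)"
  obtains u where "u \<in> closed_segment a b" "p = wrap (c, u)"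
proof -
  obtain m :: int where m: "fst p = c" "snd p + of_int m \<in> closed_segment a b"
    using assms(2) by (auto simp: strand_set_iff)
  have "wrap (c, snd p + of_int m) = p" using wrap_add_int m(1) wrap_id[OF assms(1)] by (metis prod.collapse)
  then show ?thesis using that m(2) by metis
qed

lemma in_strand_set_I: "u \<in> closed_segment a b \<Longrightarrow> wrap (c, u) \<in> strand_set (c, a, b)"
  unfolding wrap_in_strand_set unfolding strand_set_iff by (auto intro: exI[of _ 0])

lemma (in local_move) same_side': "(p, q) \<in> double_points D' \<Longrightarrow> p \<in> inside \<longleftrightarrow> q \<in> inside"
  using local_move.same_side[OF swap, of p q] by (simp add: local_move.inside_def[OF swap] inside_def)

section \<open>The first Reidemeister move\<close>

text \<open>
  Both passages of the crossing lie on the same strand with nothing in between, so its weights cancel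
  and its index is zero.
\<close>

lemma transports_reidemeister1:
  assumes valid: "virtual_link_diagram D" "virtual_link_diagram D'" and R1: "reidemeister1 D D'"
  shows "transports D (Id_on (circles D)) D'"
proof -
  obtain \<phi> c a b u v where \<phi>: "plane_diffeo \<phi>"
    and rep: "replaces_strands (\<phi> ` square) {(c, a, b)} D D'"
    and ord: "a < u" "u < v" "v < b"
    and loop: "\<forall>s\<in>{a..b}. \<forall>t\<in>{a..b}. s < t \<longrightarrow> (curve D c s = curve D c t \<longleftrightarrow> s = u \<and> t = v)"
    and inj: "inj_on (curve D' c) {a..b}"
    using R1 unfolding reidemeister1_def by blast
  interpret local_move D D' "\<phi> ` square" "{(c, a, b)}"
    by (rule local_moveI[OF valid \<phi> rep]) simp
  have c: "c \<in> circles D" using strand_props(1) by blast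
  have seg: "closed_segment a b = {a..b}" using ord by (simp add: closed_segment_eq_real_ivl)
  have arc: "\<exists>s t. s \<in> {a..b} \<and> t \<in> {a..b} \<and> p = wrap (c, s) \<and> q = wrap (c, t) \<and> s \<noteq> t \<and> curve E c s = curve E c t"
    if E: "E = D \<or> E = D'" and pq: "(p, q) \<in> inner E" for p q E
  proof -
    have dp: "(p, q) \<in> double_points E" "p \<in> inside" and vE: "virtual_link_diagram E" and cE: "c \<in> circles E"
      using pq E valid c circles_eq by (auto simp: inner_def classical_def)
    have "q \<in> inside"
      using same_side[of p q] same_side'[of p q] dp E by blast
    have "p \<in> strand_set (c, a, b)" "q \<in> strand_set (c, a, b)"
      using dp(2) \<open>q \<in> inside\<close> by (simp_all add: inside_def)
    moreover have "p \<in> points E" "q \<in> points E" using double_points_in_points[OF dp(1)] by auto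
    ultimately obtain s t where st: "s \<in> {a..b}" "t \<in> {a..b}" "p = wrap (c, s)" "q = wrap (c, t)"
      unfolding seg[symmetric] by (elim in_strand_obtain)
    then show ?thesis
      using dp(1) wrap_double_points[OF vE, of "(c, s)" "(c, t)"] cE
      by (auto simp: position_def)
  qed
  have none: "inner D' = {}"
  proof (rule ccontr)
    assume "inner D' \<noteq> {}"
    then obtain p q where "(p, q) \<in> inner D'" by auto
    then show False using arc[of D' p q] inj by (auto dest: inj_onD)
  qed
  have sub: "inner D \<subseteq> {(wrap (c, u), wrap (c, v)), (wrap (c, v), wrap (c, u))}"
  proof
    fix x assume x: "x \<in> inner D"
    obtain p q where pq: "x = (p, q)" by (cases x)
    obtain s t where st: "s \<in> {a..b}" "t \<in> {a..b}" "p = wrap (c, s)" "q = wrap (c, t)" "s \<noteq> t" "curve D c s = curve D c t"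
      using arc[of D p q] x pq by auto
    consider "s < t" | "t < s" using st(5) by linarith
    then have "s = u \<and> t = v \<or> s = v \<and> t = u"
    proof cases
      case 1 then show ?thesis using loop st by blast
    next
      case 2 then show ?thesis using loop st by (metis)
    qed
    then show "x \<in> {(wrap (c, u), wrap (c, v)), (wrap (c, v), wrap (c, u))}" using pq st by auto
  qed
  have swap: "(q, p) \<in> inner D" if "(p, q) \<in> inner D" for p q
    using that classical_sym[of p q D] same_side[of p q] unfolding inner_def classical_def by simp
  have on: "on_strand D (c, a, b) = inner D" by (simp add: inner_eq)
  show ?thesis
  proof (rule transports_cancelling[OF none])
    fix s assume "s \<in> {(c, a, b)}"
    then have s: "s = (c, a, b)" by simp
    show "cancelling s"
    proof (cases "inner D = {}")
      case True
      then show ?thesis by (simp add: s cancelling_def on)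
    next
      case False
      then have both: "inner D = {(wrap (c, u), wrap (c, v)), (wrap (c, v), wrap (c, u))}"
        using sub swap by blast
      then have cl: "(wrap (c, u), wrap (c, v)) \<in> classical D" by (auto simp: inner_def)
      then have "wrap (c, u) \<noteq> wrap (c, v)" by (auto simp: classical_def double_points_def)
      then have ne: "(wrap (c, u), wrap (c, v)) \<noteq> (wrap (c, v), wrap (c, u))" by simp
      have uv: "u \<in> closed_segment a b" "v \<in> closed_segment a b" using ord by (simp_all add: seg)
      show ?thesis unfolding s cancelling_def split_conv on
        by (intro disjI2 exI conjI) (rule uv both ne weight_swap[OF valid(1) cl])+
    qed
  next
    fix M :: "nat \<times> real \<Rightarrow> int" and n :: int
    assume n: "n \<noteq> 0" and level: "\<And>s x y. s \<in> {(c, a, b)} \<Longrightarrow> x \<in> on_strand D s \<Longrightarrow> y \<in> on_strand D s \<Longrightarrow> M (fst x) = M (fst y)"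
    have "M (snd x) = M (fst x)" if "x \<in> inner D" for x
    proof -
      have "(snd x, fst x) \<in> inner D" using swap that by simp
      then show ?thesis using level[of "(c, a, b)" "(snd x, fst x)" x] that by (simp add: on)
    qed
    then show "local_writhe (inner D) D M n = 0"
      unfolding local_writhe_def using n by (intro sum.neutral) auto
  qed
qed

section \<open>Strands that are graphs\<close>

definition lift_param :: "strand \<Rightarrow> real \<Rightarrow> real" where
  "lift_param s x = snd (strand_param s x)"

definition direction :: "strand \<Rightarrow> real" where
  "direction = (\<lambda>(c, a, b). sgn (b - a))"

lemma strand_param_eq: "strand_param s x = (fst s, lift_param s x)"
  by (simp add: lift_param_def strand_param_def split: prod.splits)

lemma lift_param_diff: "lift_param (c, a, b) x - lift_param (c, a, b) y = (x - y) * ((b - a) / 2)"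
  by (simp add: lift_param_def strand_param_def field_simps)

lemma lift_param_in_segment:
  assumes "x \<in> {-1..1}"
  shows "lift_param (c, a, b) x \<in> closed_segment a b"
proof -
  have "lift_param (c, a, b) x = (1 - (1 + x) / 2) * a + ((1 + x) / 2) * b"
    by (simp add: lift_param_def strand_param_def field_simps)
  then show ?thesis using assms unfolding closed_segment_def
    by (auto intro!: exI[of _ "(1 + x) / 2"])
qed

lemma segment_lift_param:
  assumes "u \<in> closed_segment a b"
  obtains x where "x \<in> {-1..1}" "u = lift_param (c, a, b) x"
proof -
  obtain y where "0 \<le> y" "y \<le> 1" "u = (1 - y) * a + y * b"
    using assms by (auto simp: closed_segment_def)
  then have "2 * y - 1 \<in> {-1..1}" "u = lift_param (c, a, b) (2 * y - 1)"
    by (auto simp: lift_param_def strand_param_def field_simps)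
  then show ?thesis by (rule that)
qed

text \<open>
  The second and the third move are both described by strands that are graphs in the
  coordinates given by \<open>\<phi>\<close>; such strands cross exactly where the functions \<open>k s\<close> agree.
\<close>

locale graph_strands =
  fixes D :: diagram and \<phi> :: "complex \<Rightarrow> complex" and S :: "strand set" and k :: "strand \<Rightarrow> real \<Rightarrow> real"
  assumes valid: "virtual_link_diagram D" and diffeo: "plane_diffeo \<phi>"
    and meets: "meets_in_strands D (\<phi> ` square) S"
    and graph: "\<And>s. s \<in> S \<Longrightarrow> follows D s (\<lambda>x. \<phi> (Complex x (k s x)))"
begin

text \<open>
  The point of the diagram on the strand \<open>s\<close> above the abscissa \<open>x\<close>.
\<close>

definition pt :: "strand \<Rightarrow> real \<Rightarrow> nat \<times> real" where
  "pt s x = wrap (strand_param s x)"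

lemma props:
  assumes "(c, a, b) \<in> S"
  shows "c \<in> circles D" "a \<noteq> b" "\<bar>a - b\<bar> < 1"
proof -
  have "\<forall>(c, a, b)\<in>S. c \<in> circles D \<and> a \<noteq> b \<and> \<bar>a - b\<bar> < 1 \<and>
      (\<forall>t\<in>open_segment a b. curve D c t \<in> interior (\<phi> ` square))"
    using meets by (simp add: meets_in_strands_def)
  then show "c \<in> circles D" "a \<noteq> b" "\<bar>a - b\<bar> < 1" using assms by blast+
qed

lemma circle: "s \<in> S \<Longrightarrow> fst s \<in> circles D"
  using props(1) by (cases s) auto

lemma pt_props:
  assumes "s \<in> S" "x \<in> {-1..1}"
  shows "pt s x \<in> points D" "pt s x \<in> strand_set s" "position D (pt s x) = \<phi> (Complex x (k s x))"
    "is_over D (pt s x) = over_at D s x" "pt s x = wrap (fst s, lift_param s x)"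
proof -
  obtain c a b where s: "s = (c, a, b)" by (cases s)
  show "pt s x = wrap (fst s, lift_param s x)" by (simp add: pt_def strand_param_eq)
  have c: "fst (strand_param s x) \<in> circles D" using circle[OF assms(1)] by (simp add: strand_param_eq)
  then show "pt s x \<in> points D" by (simp add: pt_def wrap_in_points)
  show "pt s x \<in> strand_set s"
    using in_strand_set_I[OF lift_param_in_segment[OF assms(2)]] by (simp add: pt_def strand_param_eq s)
  show "position D (pt s x) = \<phi> (Complex x (k s x))" "is_over D (pt s x) = over_at D s x"
    using graph[OF assms(1)] assms(2) wrap_invariant[OF valid c] by (simp_all add: pt_def follows_def)
qed

lemma strand_obtain:
  assumes "s \<in> S" "p \<in> points D" "p \<in> strand_set s"
  obtains x where "x \<in> {-1..1}" "p = pt s x"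
proof -
  obtain c a b where s: "s = (c, a, b)" by (cases s)
  obtain u where u: "u \<in> closed_segment a b" "p = wrap (c, u)"
    using in_strand_obtain assms(2,3) s by blast
  obtain x where x: "x \<in> {-1..1}" "u = lift_param (c, a, b) x" using segment_lift_param[OF u(1)] by blast
  show ?thesis using that[OF x(1)] u(2) x(2) by (simp add: pt_def strand_param_eq s)
qed

lemma pt_double_points:
  assumes "s \<in> S" "r \<in> S" "x \<in> {-1..1}" "y \<in> {-1..1}"
  shows "(pt s x, pt r y) \<in> double_points D \<longleftrightarrow> s \<noteq> r \<and> x = y \<and> k s x = k r x"
proof -
  have "pt s x \<noteq> pt r y" if "s \<noteq> r"
  proof -
    have "pairwise (\<lambda>s s'. disjnt (strand_set s) (strand_set s')) S"
      using meets by (simp add: meets_in_strands_def)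
    then have "disjnt (strand_set s) (strand_set r)" using assms that by (meson pairwiseD)
    then show ?thesis using pt_props(2)[OF assms(1,3)] pt_props(2)[OF assms(2,4)] by (metis disjnt_iff)
  qed
  then show ?thesis
    using pt_props[OF assms(1,3)] pt_props[OF assms(2,4)]
    by (auto simp: double_points_def plane_diffeo_inj[OF diffeo])
qed

lemma crossing_obtain:
  assumes "(p, q) \<in> double_points D" "p \<in> strand_set s" "s \<in> S"
  obtains r x where "r \<in> S" "r \<noteq> s" "x \<in> {-1..1}" "k s x = k r x" "p = pt s x" "q = pt r x"
proof -
  have pq: "p \<in> points D" "q \<in> points D" "position D p = position D q"
    using assms(1) by (auto simp: double_points_def)
  obtain x where x: "x \<in> {-1..1}" "p = pt s x" using strand_obtain[OF assms(3) pq(1) assms(2)] by blast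
  have U: "{(c, t). c \<in> circles D \<and> curve D c t \<in> \<phi> ` square} = (\<Union>s\<in>S. strand_set s)"
    using meets by (simp add: meets_in_strands_def)
  have "position D p \<in> \<phi> ` square"
    using U assms(2,3) by (cases p) (fastforce simp: position_def)
  then have "q \<in> (\<Union>s\<in>S. strand_set s)"
    using U pq(2,3) by (cases q) (fastforce simp: position_def points_def)
  then obtain r where r: "r \<in> S" "q \<in> strand_set r" by blast
  obtain y where y: "y \<in> {-1..1}" "q = pt r y" using strand_obtain[OF r(1) pq(2) r(2)] by blast
  have "s \<noteq> r \<and> x = y \<and> k s x = k r x"
    using pt_double_points[OF assms(3) r(1) x(1) y(1)] assms(1) unfolding x(2) y(2) by (rule iffD1)
  then show ?thesis using that[of r x] r(1) x y by auto
qed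

lemma classical_on_strand:
  assumes s: "s \<in> S"
    and X: "\<And>r. r \<in> S \<Longrightarrow> r \<noteq> s \<Longrightarrow> X r \<in> {-1..1}"
    and meet: "\<And>r x. r \<in> S \<Longrightarrow> r \<noteq> s \<Longrightarrow> x \<in> {-1..1} \<Longrightarrow> k s x = k r x \<longleftrightarrow> x = X r"
  shows "u \<in> {x \<in> classical D. fst x \<in> strand_set s} \<longleftrightarrow>
    (\<exists>r\<in>S - {s}. u = (pt s (X r), pt r (X r)) \<and> (is_over D (pt s (X r)) \<or> is_over D (pt r (X r))))"
proof
  assume u: "u \<in> {x \<in> classical D. fst x \<in> strand_set s}"
  obtain p q where pq: "u = (p, q)" by (cases u)
  have "(p, q) \<in> double_points D" "p \<in> strand_set s" using u pq by (simp_all add: classical_def)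
  then obtain r x where rx: "r \<in> S" "r \<noteq> s" "x \<in> {-1..1}" "k s x = k r x" "p = pt s x" "q = pt r x"
    using crossing_obtain s by metis
  then have "x = X r" using meet[OF rx(1-3)] by blast
  then show "\<exists>r\<in>S - {s}. u = (pt s (X r), pt r (X r)) \<and> (is_over D (pt s (X r)) \<or> is_over D (pt r (X r)))"
    using rx u pq by (intro bexI[of _ r]) (auto simp: classical_def)
next
  assume "\<exists>r\<in>S - {s}. u = (pt s (X r), pt r (X r)) \<and> (is_over D (pt s (X r)) \<or> is_over D (pt r (X r)))"
  then obtain r where r: "r \<in> S" "r \<noteq> s" "u = (pt s (X r), pt r (X r))"
    "is_over D (pt s (X r)) \<or> is_over D (pt r (X r))" by blast
  have "k s (X r) = k r (X r)" using meet[OF r(1,2) X[OF r(1,2)]] by blast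
  then have "(pt s (X r), pt r (X r)) \<in> double_points D"
    using pt_double_points[OF s r(1) X[OF r(1,2)] X[OF r(1,2)]] r(2) by simp
  then show "u \<in> {x \<in> classical D. fst x \<in> strand_set s}"
    using r(3,4) pt_props(2)[OF s X[OF r(1,2)]] by (simp add: classical_def)
qed

text \<open>
  Differentiability of \<open>k s\<close> is a consequence: the strand is differentiable, and so is the inverse of
  \<open>\<phi>\<close>.
\<close>

lemma graph_derivative:
  assumes s: "(c, a, b) \<in> S" and x: "-1 < x" "x < 1"
    and der: "(\<phi> has_derivative \<phi>') (at (Complex x (k (c, a, b) x)))"
  shows "\<exists>m. (k (c, a, b) has_real_derivative m) (at x) \<and>
    ((b - a) / 2) *\<^sub>R velocity D (pt (c, a, b) x) = \<phi>' (Complex 1 m)"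
proof -
  let ?s = "(c, a, b)"
  let ?z = "Complex x (k ?s x)"
  let ?t = "lift_param ?s x"
  define g where "g y = inv \<phi> (curve D c (lift_param ?s y))" for y
  have c: "c \<in> circles D" using props(1)[OF s] .
  have bij\<phi>: "bij \<phi>" using diffeo by (simp add: plane_diffeo_def)
  \<comment> \<open>The curve is pulled back to the coordinates by the inverse of \<open>\<phi>\<close>, whose derivative exists
    because that of \<open>\<phi>\<close> is bijective.\<close>
  obtain \<psi>' where der\<psi>: "(inv \<phi> has_derivative \<psi>') (at (\<phi> ?z))" and inv: "\<phi>' \<circ> \<psi>' = id"
  proof -
    obtain L :: "complex \<Rightarrow>\<^sub>L complex" where L: "(\<phi> has_derivative blinfun_apply L) (at ?z)" "bij (blinfun_apply L)"
      using diffeo unfolding plane_diffeo_def by blast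
    have L\<phi>: "blinfun_apply L = \<phi>'" using L(1) der has_derivative_unique by blast
    have comp: "\<phi>' \<circ> inv \<phi>' = id" using L(2) by (simp add: L\<phi> bij_is_surj surj_iff[symmetric])
    have "(inv \<phi> has_derivative inv \<phi>') (at (\<phi> ?z))"
      by (rule has_derivative_inverse_strong[of UNIV])
        (use der comp plane_diffeo_continuous[OF diffeo] bij\<phi> in \<open>auto simp: bij_is_inj\<close>)
    then show ?thesis using comp that by blast
  qed
  have pos: "curve D c (lift_param ?s y) = \<phi> (Complex y (k ?s y))" if "y \<in> {-1..1}" for y
    using graph[OF s] that by (simp add: follows_def strand_param_eq position_def)
  have g: "g y = Complex y (k ?s y)" if "y \<in> {-1..1}" for y
    using bij\<phi> by (simp add: g_def pos[OF that] bij_is_inj)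
  have vel: "velocity D (pt ?s x) = velocity D (c, ?t)"
    using wrap_invariant(3)[OF valid, of "(c, ?t)"] c by (simp add: pt_def strand_param_eq)
  have "(lift_param ?s has_vector_derivative (b - a) / 2) (at x)"
    unfolding lift_param_def strand_param_def has_real_derivative_iff_has_vector_derivative[symmetric]
    by (auto intro!: derivative_eq_intros simp: field_simps)
  then have "((curve D c \<circ> lift_param ?s) has_vector_derivative ((b - a) / 2) *\<^sub>R velocity D (c, ?t)) (at x)"
    using curve_has_derivative[OF valid c] by (rule vector_diff_chain_at)
  moreover have "(inv \<phi> has_derivative \<psi>') (at ((curve D c \<circ> lift_param ?s) x) within A)" for A
    using der\<psi> pos[of x] x by (simp add: has_derivative_at_withinI)
  ultimately have "((inv \<phi> \<circ> (curve D c \<circ> lift_param ?s)) has_vector_derivative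
      \<psi>' (((b - a) / 2) *\<^sub>R velocity D (c, ?t))) (at x)"
    by (rule vector_derivative_diff_chain_within)
  then have dg: "(g has_vector_derivative \<psi>' (((b - a) / 2) *\<^sub>R velocity D (c, ?t))) (at x)"
    by (simp add: o_def g_def[abs_def])
  define w where "w = \<psi>' (((b - a) / 2) *\<^sub>R velocity D (c, ?t))"
  have near: "((\<lambda>y. Complex y (k ?s y)) has_vector_derivative w) (at x)"
    using dg unfolding w_def
    by (rule has_vector_derivative_transform_within_open[of _ _ _ "{-1<..<1}"]) (use x g in auto)
  have "((\<lambda>y. y) has_vector_derivative Re w) (at x)"
    using bounded_linear.has_vector_derivative[OF bounded_linear_Re near] by simp
  then have "Re w = 1"
    using vector_derivative_unique_at has_vector_derivative_id by (metis id_def)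
  moreover have "(k ?s has_vector_derivative Im w) (at x)"
    using bounded_linear.has_vector_derivative[OF bounded_linear_Im near] by simp
  moreover have "\<phi>' w = ((b - a) / 2) *\<^sub>R velocity D (c, ?t)"
    using inv by (simp add: w_def fun_eq_iff)
  ultimately show ?thesis
    unfolding has_real_derivative_iff_has_vector_derivative vel
    by (intro exI[of _ "Im w"]) (metis complex_surj)
qed

end

lemma plane_diffeo_inv_continuous:
  assumes "plane_diffeo \<phi>"
  shows "continuous_on A (inv \<phi>)"
proof (rule continuous_at_imp_continuous_on, rule ballI)
  fix w
  obtain \<phi>' :: "complex \<Rightarrow> complex \<Rightarrow>\<^sub>L complex" where bij: "bij \<phi>"
    and der: "\<And>z. (\<phi> has_derivative blinfun_apply (\<phi>' z)) (at z)" "\<And>z. bij (blinfun_apply (\<phi>' z))"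
    using assms unfolding plane_diffeo_def by blast
  have "(inv \<phi> has_derivative inv (blinfun_apply (\<phi>' (inv \<phi> w)))) (at (\<phi> (inv \<phi> w)))"
    by (rule has_derivative_inverse_strong[of UNIV])
      (use der plane_diffeo_continuous[OF assms] bij in
        \<open>auto simp: bij_is_inj surj_iff[symmetric] bij_is_surj\<close>)
  then show "isCont (inv \<phi>) w"
    using bij has_derivative_continuous by (metis bij_is_surj surj_f_inv_f)
qed

context graph_strands begin

lemma graph_continuous:
  assumes "s \<in> S"
  shows "continuous_on {-1..1} (k s)"
proof -
  let ?c = "fst s"
  have "continuous_on {-1..1} (\<lambda>y. curve D ?c (lift_param s y))"
  proof (rule continuous_on_compose2[OF curve_continuous[OF valid circle[OF assms], of UNIV]])
    show "continuous_on {-1..1} (lift_param s)"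
      unfolding lift_param_def strand_param_def by (cases s) (auto intro!: continuous_intros)
  qed simp
  then have "continuous_on {-1..1} (\<lambda>y. inv \<phi> (curve D ?c (lift_param s y)))"
    by (intro continuous_on_compose2[OF plane_diffeo_inv_continuous[OF diffeo, of UNIV]]) auto
  then have "continuous_on {-1..1} (\<lambda>y. Im (inv \<phi> (curve D ?c (lift_param s y))))"
    by (rule continuous_on_Im)
  moreover have "Im (inv \<phi> (curve D ?c (lift_param s y))) = k s y" if "y \<in> {-1..1}" for y
  proof -
    have "curve D ?c (lift_param s y) = \<phi> (Complex y (k s y))"
      using graph[OF assms] that by (simp add: follows_def strand_param_eq position_def)
    then show ?thesis using diffeo by (simp add: plane_diffeo_def bij_is_inj)
  qed
  ultimately show ?thesis by (rule continuous_on_eq)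
qed

lemma direction_square:
  assumes "s \<in> S"
  shows "direction s * direction s = 1"
proof -
  obtain c a b where s: "s = (c, a, b)" by (cases s)
  then show ?thesis using props(2)[of c a b] assms by (simp add: direction_def sgn_real_def)
qed

text \<open>
  In coordinates the velocities are positive or negative multiples of \<open>(1, m)\<close> and \<open>(1, n)\<close>, whose
  determinant is \<open>n - m\<close>. Transversality makes the slopes different.
\<close>

lemma crossing_sign_slopes:
  assumes \<sigma>: "orientation_sign \<phi> \<sigma>" and sr: "s \<in> S" "r \<in> S" "s \<noteq> r"
    and x: "-1 < x" "x < 1" "k s x = k r x"
  shows "\<exists>m n. (k s has_real_derivative m) (at x) \<and> (k r has_real_derivative n) (at x) \<and> m \<noteq> n \<and>
    real_of_int (crossing_sign D (pt s x) (pt r x)) = \<sigma> * direction s * direction r * sgn (n - m)"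
proof -
  obtain \<phi>' where der: "\<And>z. (\<phi> has_derivative \<phi>' z) (at z)"
    and orient: "\<And>z v w. sgn (plane_det (\<phi>' z v) (\<phi>' z w)) = \<sigma> * sgn (plane_det v w)"
    using \<sigma> unfolding orientation_sign_def by blast
  obtain c a b where s: "s = (c, a, b)" by (cases s)
  obtain c' a' b' where r: "r = (c', a', b')" by (cases r)
  let ?z = "Complex x (k s x)"
  obtain m where m: "(k s has_real_derivative m) (at x)"
    "((b - a) / 2) *\<^sub>R velocity D (pt s x) = \<phi>' ?z (Complex 1 m)"
    using graph_derivative[of c a b x "\<phi>' ?z"] sr(1) x der[of ?z] unfolding s by blast
  obtain n where n: "(k r has_real_derivative n) (at x)"
    "((b' - a') / 2) *\<^sub>R velocity D (pt r x) = \<phi>' ?z (Complex 1 n)"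
    using graph_derivative[of c' a' b' x "\<phi>' ?z"] sr(2) x der[of ?z] unfolding r by auto
  let ?d = "plane_det (velocity D (pt s x)) (velocity D (pt r x))"
  have "(pt s x, pt r x) \<in> double_points D"
    using pt_double_points[OF sr(1,2), of x x] sr(3) x by simp
  then have d: "?d \<noteq> 0" by (rule valid_transverse[OF valid])
  have "((b - a) / 2) * ((b' - a') / 2) * ?d =
      plane_det (((b - a) / 2) *\<^sub>R velocity D (pt s x)) (((b' - a') / 2) *\<^sub>R velocity D (pt r x))"
    by (simp add: plane_det_def field_simps)
  also have "sgn \<dots> = \<sigma> * sgn (plane_det (Complex 1 m) (Complex 1 n))"
    unfolding m(2) n(2) by (rule orient)
  finally have "sgn (((b - a) / 2) * ((b' - a') / 2) * ?d) = \<sigma> * sgn (n - m)"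
    by (simp add: plane_det_def)
  then have "direction s * direction r * sgn ?d = \<sigma> * sgn (n - m)"
    by (simp add: direction_def s r sgn_mult)
  then have "direction s * direction r * (direction s * direction r * sgn ?d) =
      direction s * direction r * (\<sigma> * sgn (n - m))" by (simp only:)
  then have "direction s * direction s * (direction r * direction r) * sgn ?d =
      \<sigma> * direction s * direction r * sgn (n - m)" by (simp only: ac_simps)
  then have e: "sgn ?d = \<sigma> * direction s * direction r * sgn (n - m)"
    using direction_square sr by simp
  moreover have "m \<noteq> n" using e d by (auto simp: sgn_zero_iff)
  moreover have "real_of_int (crossing_sign D (pt s x) (pt r x)) = sgn ?d"
    using d by (simp add: crossing_sign_def sgn_real_def)
  ultimately show ?thesis using m(1) n(1) by auto
qed

text \<open>
  A graph that comes from above crosses with smaller slope; the slopes being different,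
  knowing which graph is above on one side of the crossing determines its sign.
\<close>

lemma crossing_sign_left:
  assumes \<sigma>: "orientation_sign \<phi> \<sigma>" and sr: "s \<in> S" "r \<in> S" "s \<noteq> r"
    and x: "-1 < x" "x < 1" "k s x = k r x"
    and below: "\<And>y. -1 \<le> y \<Longrightarrow> y < x \<Longrightarrow> k s y < k r y"
  shows "real_of_int (crossing_sign D (pt s x) (pt r x)) = - \<sigma> * direction s * direction r"
proof -
  obtain m n where mn: "(k s has_real_derivative m) (at x)" "(k r has_real_derivative n) (at x)" "m \<noteq> n"
    "real_of_int (crossing_sign D (pt s x) (pt r x)) = \<sigma> * direction s * direction r * sgn (n - m)"
    using crossing_sign_slopes[OF \<sigma> sr x] by blast
  have der: "((\<lambda>y. k r y - k s y) has_real_derivative n - m) (at x)"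
    by (intro derivative_intros mn)
  have "\<not> n - m > 0"
  proof
    assume "n - m > 0"
    from DERIV_pos_inc_left[OF der this] obtain d where d: "d > 0"
      "\<And>h. h > 0 \<Longrightarrow> h < d \<Longrightarrow> k r (x - h) - k s (x - h) < k r x - k s x" by blast
    define h where "h = min (d / 2) (x + 1)"
    have "h > 0" "h < d" "-1 \<le> x - h" using d x by (auto simp: h_def)
    then show False using d(2)[of h] below[of "x - h"] x(3) by simp
  qed
  then show ?thesis using mn(3,4) by (simp add: sgn_real_def)
qed

lemma crossing_sign_right:
  assumes \<sigma>: "orientation_sign \<phi> \<sigma>" and sr: "s \<in> S" "r \<in> S" "s \<noteq> r"
    and x: "-1 < x" "x < 1" "k s x = k r x"
    and below: "\<And>y. x < y \<Longrightarrow> y \<le> 1 \<Longrightarrow> k s y < k r y"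
  shows "real_of_int (crossing_sign D (pt s x) (pt r x)) = \<sigma> * direction s * direction r"
proof -
  obtain m n where mn: "(k s has_real_derivative m) (at x)" "(k r has_real_derivative n) (at x)" "m \<noteq> n"
    "real_of_int (crossing_sign D (pt s x) (pt r x)) = \<sigma> * direction s * direction r * sgn (n - m)"
    using crossing_sign_slopes[OF \<sigma> sr x] by blast
  have der: "((\<lambda>y. k r y - k s y) has_real_derivative n - m) (at x)"
    by (intro derivative_intros mn)
  have "\<not> n - m < 0"
  proof
    assume "n - m < 0"
    from DERIV_neg_dec_right[OF der this] obtain d where d: "d > 0"
      "\<And>h. h > 0 \<Longrightarrow> h < d \<Longrightarrow> k r x - k s x > k r (x + h) - k s (x + h)" by blast
    define h where "h = min (d / 2) (1 - x)"
    have "h > 0" "h < d" "x + h \<le> 1" using d x by (auto simp: h_def)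
    then show False using d(2)[of h] below[of "x + h"] x(3) by simp
  qed
  then show ?thesis using mn(3,4) by (simp add: sgn_real_def)
qed

lemma weight_pt: "weight D (pt s x, pt r x) = crossing_sign D (pt s x) (pt r x)"
  by (simp add: weight_def)

end

lemma no_zero_sgn:
  fixes d :: "real \<Rightarrow> real"
  assumes "continuous_on {-1..1} d" "-1 \<le> x" "x \<le> y" "y \<le> 1" "\<And>z. x \<le> z \<Longrightarrow> z \<le> y \<Longrightarrow> d z \<noteq> 0"
  shows "sgn (d x) = sgn (d y)"
  by (rule sgn_constant_on_connected[of "{x..y}"])
    (use assms in \<open>auto intro: continuous_on_subset\<close>)

section \<open>The second Reidemeister move\<close>

text \<open>
  The moving strand starts and ends above the fixed one, so it crosses downwards at the first crossing
  and upwards at the second one. Hence the two crossings have opposite signs, and the weights cancel on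
  each of the two strands.
\<close>

lemma transports_reidemeister2:
  assumes valid: "virtual_link_diagram D" "virtual_link_diagram D'" and R2: "reidemeister2 D D'"
  shows "transports D (Id_on (circles D)) D'"
proof -
  obtain \<phi> s1 s2 f g where \<phi>: "plane_diffeo \<phi>" and ne: "s1 \<noteq> s2"
    and rep: "replaces_strands (\<phi> ` square) {s1, s2} D D'"
    and fol: "follows D s1 (\<lambda>x. \<phi> (Complex x 0))" "follows D' s1 (\<lambda>x. \<phi> (Complex x 0))"
      "follows D s2 (\<lambda>x. \<phi> (Complex x (f x)))" "follows D' s2 (\<lambda>x. \<phi> (Complex x (g x)))"
    and ends: "f (-1) = g (-1)" "f 1 = g 1" and card: "card {x \<in> {-1..1}. f x = 0} = 2"
    and gpos: "\<forall>x\<in>{-1..1}. g x > 0"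
    and ov: "\<forall>x\<in>{-1..1}. \<forall>y\<in>{-1..1}. f x = 0 \<and> f y = 0 \<longrightarrow>
        over_at D s1 x = over_at D s1 y \<and> over_at D s2 x = over_at D s2 y"
    using R2 unfolding reidemeister2_def by (elim exE conjE) (rule that)
  interpret local_move D D' "\<phi> ` square" "{s1, s2}"
    by (rule local_moveI[OF valid \<phi> rep]) simp
  interpret G: graph_strands D \<phi> "{s1, s2}" "\<lambda>s x. if s = s1 then 0 else f x"
    using valid \<phi> rep fol ne by unfold_locales (auto simp: replaces_strands_def)
  interpret G': graph_strands D' \<phi> "{s1, s2}" "\<lambda>s x. if s = s1 then 0 else g x"
    using valid \<phi> rep fol ne by unfold_locales (auto simp: replaces_strands_def)
  obtain \<sigma> where \<sigma>: "orientation_sign \<phi> \<sigma>" using plane_diffeo_orientation[OF \<phi>] by blast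
  obtain x y where xy: "{x \<in> {-1..1}. f x = 0} = {x, y}" "x < y"
  proof -
    obtain u v where uv: "{x \<in> {-1..1}. f x = 0} = {u, v}" "u \<noteq> v" using card card_2_iff[of "{x \<in> {-1..1}. f x = 0}"] by auto
    show ?thesis
    proof (cases "u < v")
      case True then show ?thesis using that uv by blast
    next
      case False then show ?thesis using that[of v u] uv by (simp add: insert_commute)
    qed
  qed
  have zero: "f z = 0 \<longleftrightarrow> z = x \<or> z = y" if "z \<in> {-1..1}" for z using xy(1) that by blast
  have in1: "x \<in> {-1..1}" "y \<in> {-1..1}" and fxy: "f x = 0" "f y = 0" using xy(1) by blast+
  have fends: "f (-1) > 0" "f 1 > 0" using gpos ends by simp_all
  have x: "-1 < x" "x < 1" and y: "-1 < y" "y < 1"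
    using in1 fxy fends xy(2) by (auto simp: less_le)
  have cont: "continuous_on {-1..1} f" using G.graph_continuous[of s2] ne by simp
  \<comment> \<open>Outside of the interval between its two zeros, \<open>f\<close> keeps the sign that it has at the edges.\<close>
  have left: "f z > 0" if "-1 \<le> z" "z < x" for z
  proof -
    have "sgn (f (-1)) = sgn (f z)"
      by (rule no_zero_sgn[OF cont]) (use that x zero xy(2) in auto)
    then show ?thesis using fends by (simp add: sgn_real_def split: if_splits)
  qed
  have right: "f z > 0" if "y < z" "z \<le> 1" for z
  proof -
    have "sgn (f z) = sgn (f 1)"
      by (rule no_zero_sgn[OF cont]) (use that y zero xy(2) in auto)
    then show ?thesis using fends by (simp add: sgn_real_def split: if_splits)
  qed
  let ?A = "\<lambda>z. G.pt s1 z" and ?B = "\<lambda>z. G.pt s2 z"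
  have "real_of_int (crossing_sign D (?A x) (?B x)) = - \<sigma> * direction s1 * direction s2"
    by (rule G.crossing_sign_left[OF \<sigma>]) (use ne x fxy left in auto)
  moreover have "real_of_int (crossing_sign D (?A y) (?B y)) = \<sigma> * direction s1 * direction s2"
    by (rule G.crossing_sign_right[OF \<sigma>]) (use ne y fxy right in auto)
  ultimately have "real_of_int (crossing_sign D (?A y) (?B y)) = real_of_int (- crossing_sign D (?A x) (?B x))"
    by simp
  then have opp: "weight D (?A y, ?B y) = - weight D (?A x, ?B x)"
    unfolding G.weight_pt by linarith
  have dpA: "(?A x, ?B x) \<in> double_points D" "(?A y, ?B y) \<in> double_points D"
    using G.pt_double_points[of s1 s2 x x] G.pt_double_points[of s1 s2 y y] in1 ne fxy by auto
  have opp': "weight D (?B y, ?A y) = - weight D (?B x, ?A x)"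
    using opp crossing_sign_swap[OF valid(1) dpA(1)] crossing_sign_swap[OF valid(1) dpA(2)] by (simp add: weight_def)
  have none: "inner D' = {}"
  proof (rule ccontr)
    assume "inner D' \<noteq> {}"
    then obtain u where "u \<in> inner D'" by blast
    then obtain s where s: "s \<in> {s1, s2}" "u \<in> classical D'" "fst u \<in> strand_set s"
      unfolding inner_def inside_def by blast
    obtain p q where "u = (p, q)" by (cases u)
    with s have pq: "(p, q) \<in> classical D'" "s \<in> {s1, s2}" "p \<in> strand_set s" by simp_all
    obtain r z where rz: "r \<in> {s1, s2}" "r \<noteq> s" "z \<in> {-1..1}" "(if s = s1 then 0 else g z) = (if r = s1 then 0 else g z)"
    proof (rule G'.crossing_obtain)
      show "(p, q) \<in> double_points D'" using pq(1) by (simp add: classical_def)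
    qed (use pq in blast)+
    have "g z = 0" using pq(2) rz ne by (auto split: if_splits)
    moreover have "g z > 0" using gpos rz(3) by blast
    ultimately show False by simp
  qed
  define cl where "cl \<longleftrightarrow> over_at D s1 x \<or> over_at D s2 x"
  have ov': "over_at D s1 y = over_at D s1 x" "over_at D s2 y = over_at D s2 x"
    using ov in1 fxy by blast+
  have isov: "is_over D (?A z) = over_at D s1 z" "is_over D (?B z) = over_at D s2 z" if "z \<in> {-1..1}" for z
    using G.pt_props(4) that by simp_all
  have cross: "\<exists>z\<in>{x, y}. u = (G.pt s z, G.pt r z)"
    if u: "u \<in> on_strand D s" and sr: "{s, r} = {s1, s2}" for u s r
  proof -
    obtain p q where pq: "u = (p, q)" by (cases u)
    have s: "s \<in> {s1, s2}" and r: "\<And>t. t \<in> {s1, s2} \<Longrightarrow> t \<noteq> s \<Longrightarrow> t = r" using sr by auto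
    obtain t z where t: "t \<in> {s1, s2}" "t \<noteq> s" "z \<in> {-1..1}"
      "(if s = s1 then 0 else f z) = (if t = s1 then 0 else f z)" "p = G.pt s z" "q = G.pt t z"
    proof (rule G.crossing_obtain)
      show "(p, q) \<in> double_points D" "p \<in> strand_set s"
        using u pq by (simp_all add: on_strand_def classical_def)
    qed (use s in blast)+
    have "f z = 0" using t s ne by (auto split: if_splits)
    then have "z \<in> {x, y}" using zero t(3) by simp
    then show ?thesis using t r pq by blast
  qed
  have over_cl: "is_over D (G.pt s z) \<or> is_over D (G.pt r z) \<longleftrightarrow> cl" if "z \<in> {x, y}" "{s, r} = {s1, s2}" for s r z
  proof -
    have "s = s1 \<and> r = s2 \<or> s = s2 \<and> r = s1" using that(2) ne by (auto simp: doubleton_eq_iff)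
    then show ?thesis using isov[of z] in1 ov' that(1) by (auto simp: cl_def)
  qed
  have onA: "on_strand D s = (if cl then {(G.pt s x, G.pt r x), (G.pt s y, G.pt r y)} else {})"
    if sr: "{s, r} = {s1, s2}" for s r
  proof -
    have s: "s = s1 \<and> r = s2 \<or> s = s2 \<and> r = s1" using sr ne by (auto simp: doubleton_eq_iff)
    then have mem: "(G.pt s z, G.pt r z) \<in> on_strand D s \<longleftrightarrow> cl" if z: "z \<in> {x, y}" for z
    proof -
      have "(G.pt s z, G.pt r z) \<in> double_points D" using s z dpA double_points_sym by blast
      moreover have "G.pt s z \<in> strand_set s" using G.pt_props(2)[of s z] s z in1 by auto
      ultimately show ?thesis using over_cl[OF z sr] by (simp add: on_strand_def classical_def)
    qed
    have sub: "on_strand D s \<subseteq> {(G.pt s x, G.pt r x), (G.pt s y, G.pt r y)}"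
      using cross[OF _ sr] by blast
    show ?thesis
    proof (cases cl)
      case True
      then show ?thesis using sub mem[of x] mem[of y] by auto
    next
      case False
      have "u \<notin> on_strand D s" for u
      proof
        assume u: "u \<in> on_strand D s"
        then obtain z where "z \<in> {x, y}" "u = (G.pt s z, G.pt r z)" using cross[OF u sr] by blast
        then show False using mem False u by simp
      qed
      then show ?thesis using False by auto
    qed
  qed
  have ptne: "G.pt s x \<noteq> G.pt s y" if "s \<in> {s1, s2}" for s
  proof
    assume "G.pt s x = G.pt s y"
    then have "\<phi> (Complex x (if s = s1 then 0 else f x)) = \<phi> (Complex y (if s = s1 then 0 else f y))"
      using G.pt_props(3)[OF that in1(1)] G.pt_props(3)[OF that in1(2)] by simp
    then show False using xy(2) by (simp add: plane_diffeo_inj[OF \<phi>])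
  qed
  have ABne: "?A x \<noteq> ?B x" "?A y \<noteq> ?B y" "?A x \<noteq> ?B y" "?A y \<noteq> ?B x"
  proof -
    have "?A u \<noteq> ?B v" if "u \<in> {-1..1}" "v \<in> {-1..1}" for u v
      using strands_disjoint[of s1 s2 "?A u"] G.pt_props(2)[of s1 u] G.pt_props(2)[of s2 v] that ne by auto
    then show "?A x \<noteq> ?B x" "?A y \<noteq> ?B y" "?A x \<noteq> ?B y" "?A y \<noteq> ?B x" using in1 by auto
  qed
  have canc: "cancelling s" if sr: "{s, r} = {s1, s2}" and w: "weight D (G.pt s y, G.pt r y) = - weight D (G.pt s x, G.pt r x)"
    for s r
  proof (cases cl)
    case False
    then show ?thesis using onA[OF sr] by (cases s) (simp add: cancelling_def)
  next
    case True
    obtain c a b where s: "s = (c, a, b)" by (cases s)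
    have sS: "s \<in> {s1, s2}" using sr by auto
    have pt: "G.pt s z = wrap (c, lift_param s z)" for z
      by (simp add: G.pt_def strand_param_eq s)
    have 1: "on_strand D s = {(wrap (c, lift_param s x), G.pt r x), (wrap (c, lift_param s y), G.pt r y)}"
      using onA[OF sr] True by (simp add: pt)
    have 2: "(wrap (c, lift_param s x), G.pt r x) \<noteq> (wrap (c, lift_param s y), G.pt r y)"
      using ptne[OF sS] by (simp add: pt)
    have 3: "lift_param s x \<in> closed_segment a b" "lift_param s y \<in> closed_segment a b"
      using lift_param_in_segment in1 s by simp_all
    have 4: "weight D (wrap (c, lift_param s y), G.pt r y) = - weight D (wrap (c, lift_param s x), G.pt r x)"
      using w unfolding pt .
    show ?thesis using 1 2 3 4 unfolding s cancelling_def split_conv by (intro disjI2 exI conjI) assumption+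
  qed
  show ?thesis
  proof (rule transports_cancelling[OF none])
    show "cancelling s" if "s \<in> {s1, s2}" for s
      using canc[of s1 s2] canc[of s2 s1] opp opp' that by (auto simp: insert_commute)
  next
    fix M :: "nat \<times> real \<Rightarrow> int" and n :: int
    assume level: "\<And>s u v. s \<in> {s1, s2} \<Longrightarrow> u \<in> on_strand D s \<Longrightarrow> v \<in> on_strand D s \<Longrightarrow> M (fst u) = M (fst v)"
    show "local_writhe (inner D) D M n = 0"
    proof (cases cl)
      case False
      then have "inner D = {}" using onA[of s1 s2] onA[of s2 s1] by (auto simp: inner_eq insert_commute)
      then show ?thesis by (simp add: local_writhe_def)
    next
      case True
      have inner: "inner D = {(?A x, ?B x), (?A y, ?B y), (?B x, ?A x), (?B y, ?A y)}"
        using onA[of s1 s2] onA[of s2 s1] True by (auto simp: inner_eq insert_commute)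
      have MA: "M (?A y) = M (?A x)"
        using level[of s1 "(?A y, ?B y)" "(?A x, ?B x)"] onA[of s1 s2] True by simp
      have MB: "M (?B y) = M (?B x)"
        using level[of s2 "(?B y, ?A y)" "(?B x, ?A x)"] onA[of s2 s1] True by (simp add: insert_commute)
      have "local_writhe (inner D) D M n =
        (\<Sum>u\<in>inner D. if is_over D (fst u) \<and> M (snd u) - M (fst u) = 2 * n then weight D u else 0)"
        unfolding local_writhe_def using sum.inter_filter[OF finite_parts(2)] by simp
      then show ?thesis
        unfolding inner using ABne ptne[of s1] ptne[of s2] MA MB isov in1 ov' opp opp' by simp
    qed
  qed
qed

section \<open>The third Reidemeister move\<close>

text \<open>
  This serves the virtual third move and the mixed move, where only the crossing of the two diagonals can
  be classical, and this crossing stays where it is.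
\<close>

lemma (in local_move) transports_same_inner:
  assumes same: "inner D' = inner D"
    and wt: "\<And>x. x \<in> inner D \<Longrightarrow> weight D' x = weight D x"
    and over: "\<And>x. x \<in> inner D \<Longrightarrow> is_over D' (fst x) = is_over D (fst x)"
  shows "transports D (Id_on (circles D)) D'"
proof -
  have on: "on_strand D' s = on_strand D s" if "s \<in> S" for s
  proof -
    have "on_strand E s = {x \<in> inner E. fst x \<in> strand_set s}" for E
      using that unfolding on_strand_def inner_def inside_def by blast
    then show ?thesis using same by simp
  qed
  have LW: "local_weigh (on_strand D' s) D' \<kappa> c = local_weigh (on_strand D s) D \<kappa> c" if "s \<in> S" for s \<kappa> c
  proof -
    have "x \<in> inner D" if "x \<in> on_strand D s" for x using that \<open>s \<in> S\<close> unfolding inner_eq by blast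
    then show ?thesis unfolding local_weigh_def on[OF that] by (intro sum.cong) (auto simp: wt)
  qed
  have deg: "local_weigh (on_strand D s) D (\<lambda>_. 1) (fst s) = local_weigh (on_strand D' s) D' (\<lambda>_. 1) (fst s)"
    if "s \<in> S" for s using LW[OF that] by simp
  have K: "local_weigh (on_strand D' s) D' (\<lambda>u. step (t - u)) (fst s) =
      local_weigh (on_strand D s) D (\<lambda>u. step (t - u)) (fst s) + (\<lambda>_. 0) s"
    if "s \<in> S" "(fst s, t) \<notin> strand_set s" for s t
    using LW[OF that(1)] by simp
  show ?thesis
  proof (rule transports_local_move[OF deg K])
    fix h h' :: "nat \<Rightarrow> int" and n :: int
    assume bal: "balanced D" "balanced D'" and h: "\<forall>c\<in>circles D. h' c - h c = - drift (\<lambda>_. 0) c" and n: "n \<noteq> 0"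
    have level: "shifted D' h' p = shifted D h p" if p: "p \<in> points D" "p \<in> inside" for p
    proof -
      obtain s where s: "s \<in> S" "p \<in> strand_set s" using p(2) by (auto simp: inside_def)
      obtain c a b where abc: "s = (c, a, b)" by (cases s)
      have S: "(c, a, b) \<in> S" using s abc by simp
      obtain u where u: "u \<in> closed_segment a b" "p = wrap (c, u)"
        using in_strand_obtain p(1) s(2) abc by blast
      have "h' c - h c = - drift (\<lambda>_. 0) c" using h strand_props(1)[OF S] by blast
      from shifted_on_strand[where K = "\<lambda>_. 0" and h = h and h' = h', OF deg K S u(1) u(1) this bal]
      show ?thesis using LW[OF S] u(2) by simp
    qed
    have "shifted D' h' (fst x) = shifted D h (fst x)" "shifted D' h' (snd x) = shifted D h (snd x)"
      if x: "x \<in> inner D" for x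
    proof -
      obtain p q where pq: "x = (p, q)" by (cases x)
      have "(p, q) \<in> classical D" "p \<in> inside" using x pq by (simp_all add: inner_def)
      moreover have "q \<in> inside" using same_side[of p q] calculation by (simp add: classical_def)
      ultimately show "shifted D' h' (fst x) = shifted D h (fst x)" "shifted D' h' (snd x) = shifted D h (snd x)"
        using level classical_in_points[of p q D] by (simp_all add: pq)
    qed
    then show "local_writhe (inner D) D (shifted D h) n = local_writhe (inner D') D' (shifted D' h') n"
      unfolding local_writhe_def same using wt over by (intro sum.cong) auto
  qed
qed

lemma step_lift_param:
  assumes "\<bar>a - b\<bar> < 1" "x \<in> {-1..1}" "y \<in> {-1..1}"
  shows "real_of_int (step (lift_param (c, a, b) x - lift_param (c, a, b) y)) = sgn (x - y) * direction (c, a, b)"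
proof -
  have "\<bar>(x - y) / 2\<bar> \<le> 1" using assms by auto
  then have "\<bar>(x - y) / 2\<bar> * \<bar>b - a\<bar> \<le> 1 * \<bar>b - a\<bar>" by (intro mult_right_mono) auto
  then have "\<bar>(x - y) * ((b - a) / 2)\<bar> < 1" using assms(1) abs_minus_commute[of a b] by (simp add: abs_mult)
  then have "real_of_int (step ((x - y) * ((b - a) / 2))) = sgn ((x - y) * ((b - a) / 2))"
    by (rule step_small)
  then show ?thesis by (simp add: lift_param_diff direction_def sgn_mult)
qed

text \<open>
  The abscissa of the crossing of \<open>s\<close> and \<open>r\<close>: the diagonals \<open>s1\<close>, \<open>s2\<close> meet at \<open>0\<close>, and they are met
  by the third strand at \<open>a\<close> and \<open>b\<close>.
\<close>

definition meeting :: "strand \<Rightarrow> strand \<Rightarrow> real \<Rightarrow> real \<Rightarrow> strand \<Rightarrow> strand \<Rightarrow> real" where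
  "meeting s1 s2 a b s r =
    (if {s, r} = {s1, s2} then 0 else if s1 \<in> {s, r} then a else b)"

text \<open>
  On the left edge of the square the strands are in the order \<open>s1\<close>, \<open>s3\<close>, \<open>s2\<close> from below, both before
  and after the move. The value is \<open>-1\<close> if \<open>s\<close> starts below \<open>r\<close>.
\<close>

definition left_order :: "strand \<Rightarrow> strand \<Rightarrow> strand \<Rightarrow> strand \<Rightarrow> strand \<Rightarrow> real" where
  "left_order s1 s2 s3 s r = (if (s, r) \<in> {(s1, s2), (s1, s3), (s3, s2)} then -1 else 1)"

text \<open>
  The signs of the three crossings depend only on the order of the strands on the left edge. If the third
  strand passes above the origin, it meets the falling diagonal first and the rising one
  afterwards; below the origin it is the other way round.
\<close>

lemma (in graph_strands) triangle:
  fixes s1 s2 s3 :: strand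
  assumes \<sigma>: "orientation_sign \<phi> \<sigma>" and S: "S = {s1, s2, s3}" and ne: "s1 \<noteq> s2" "s1 \<noteq> s3" "s2 \<noteq> s3"
    and k: "k s1 = (\<lambda>x. x)" "k s2 = (\<lambda>x. - x)" "k s3 = f"
    and bound: "\<And>x. -1 \<le> x \<Longrightarrow> x \<le> 1 \<Longrightarrow> \<bar>f x\<bar> < 1"
    and ua: "\<exists>!x. x \<in> {-1..1} \<and> f x = x" and ub: "\<exists>!x. x \<in> {-1..1} \<and> f x = - x"
    and f0: "f 0 \<noteq> 0"
  obtains a b where "-1 < a" "a < 1" "-1 < b" "b < 1" "sgn a = sgn (f 0)" "sgn b = - sgn (f 0)"
    and "\<And>s r x. s \<in> S \<Longrightarrow> r \<in> S \<Longrightarrow> x \<in> {-1..1} \<Longrightarrow> s \<noteq> r \<Longrightarrow>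
      k s x = k r x \<longleftrightarrow> x = meeting s1 s2 a b s r"
    and "\<And>s r. s \<in> S \<Longrightarrow> r \<in> S \<Longrightarrow> s \<noteq> r \<Longrightarrow>
      real_of_int (weight D (pt s (meeting s1 s2 a b s r), pt r (meeting s1 s2 a b s r))) =
      left_order s1 s2 s3 s r * \<sigma> * direction s * direction r"
proof -
  obtain a where a: "a \<in> {-1..1}" "f a = a" "\<And>x. x \<in> {-1..1} \<Longrightarrow> f x = x \<Longrightarrow> x = a" using ua by blast
  obtain b where b: "b \<in> {-1..1}" "f b = - b" "\<And>x. x \<in> {-1..1} \<Longrightarrow> f x = - x \<Longrightarrow> x = b" using ub by blast
  have ab: "-1 < a" "a < 1" "-1 < b" "b < 1"
    using bound[of a] bound[of b] a(1,2) b(1,2) by auto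
  have cont: "continuous_on {-1..1} f" using graph_continuous[of s3] S k by simp
  have cd: "continuous_on {-1..1} (\<lambda>x. f x - x)" "continuous_on {-1..1} (\<lambda>x. f x + x)"
    by (intro continuous_intros cont)+
  have ends: "f (-1) > -1" "f (-1) < 1" "f 1 < 1" "f 1 > -1" using bound[of 1] bound[of "-1"] by auto
  have a0: "a \<noteq> 0" "b \<noteq> 0" using f0 a(2) b(2) by auto
  have na: "f x - x \<noteq> 0" if "-1 \<le> x" "x \<le> 1" "x \<noteq> a" for x using a(3)[of x] that by auto
  have nb: "f x + x \<noteq> 0" if "-1 \<le> x" "x \<le> 1" "x \<noteq> b" for x
    using b(3)[of x] that by (auto simp: eq_neg_iff_add_eq_0)
  \<comment> \<open>By the intermediate value theorem, the only zero of \<open>f x - x\<close> is on the side of \<open>0\<close> where \<open>f x - x\<close>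
    has opposite signs at the ends; likewise for \<open>f x + x\<close>.\<close>
  have sa: "sgn a = sgn (f 0)"
  proof (cases "a > 0")
    case True
    have "sgn (f (-1) - (-1)) = sgn (f 0 - 0)"
      by (rule no_zero_sgn[OF cd(1)]) (use na True in auto)
    then show ?thesis using ends True by (simp add: sgn_real_def split: if_splits)
  next
    case False
    have "sgn (f 0 - 0) = sgn (f 1 - 1)"
      by (rule no_zero_sgn[OF cd(1)]) (use na False a0 in auto)
    then show ?thesis using ends False a0 by (simp add: sgn_real_def split: if_splits)
  qed
  have sb: "sgn b = - sgn (f 0)"
  proof (cases "b > 0")
    case True
    have "sgn (f (-1) + (-1)) = sgn (f 0 + 0)"
      by (rule no_zero_sgn[OF cd(2)]) (use nb True in auto)
    then show ?thesis using ends True by (simp add: sgn_real_def split: if_splits)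
  next
    case False
    have "sgn (f 0 + 0) = sgn (f 1 + 1)"
      by (rule no_zero_sgn[OF cd(2)]) (use nb False a0 in auto)
    then show ?thesis using ends False a0 by (simp add: sgn_real_def split: if_splits)
  qed
  have la: "x < f x" if "-1 \<le> x" "x < a" for x
  proof -
    have "sgn (f (-1) - (-1)) = sgn (f x - x)"
      by (rule no_zero_sgn[OF cd(1)]) (use a(1) na that in auto)
    then show ?thesis using ends by (simp add: sgn_real_def split: if_splits)
  qed
  have lb: "f x < - x" if "-1 \<le> x" "x < b" for x
  proof -
    have "sgn (f (-1) + (-1)) = sgn (f x + x)"
      by (rule no_zero_sgn[OF cd(2)]) (use b(1) nb that in auto)
    then show ?thesis using ends by (simp add: sgn_real_def split: if_splits)
  qed
  let ?X = "meeting s1 s2 a b"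
  have X: "?X s1 s2 = 0" "?X s2 s1 = 0" "?X s1 s3 = a" "?X s3 s1 = a" "?X s2 s3 = b" "?X s3 s2 = b"
    using ne by (auto simp: meeting_def doubleton_eq_iff)
  have meet: "k s x = k r x \<longleftrightarrow> x = ?X s r" if "s \<in> S" "r \<in> S" "x \<in> {-1..1}" "s \<noteq> r" for s r x
  proof -
    have eqs: "f x = x \<longleftrightarrow> x = a" "f x = - x \<longleftrightarrow> x = b" using a(2,3) b(2,3) that(3) by blast+
    then have eqs': "x = f x \<longleftrightarrow> x = a" "- x = f x \<longleftrightarrow> x = b" by auto
    show ?thesis using that(1,2,4) unfolding S
      by (elim insertE emptyE) (simp_all add: k X eqs eqs')
  qed
  have w12: "real_of_int (crossing_sign D (pt s1 0) (pt s2 0)) = - \<sigma> * direction s1 * direction s2"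
    by (rule crossing_sign_left[OF \<sigma>]) (use ne S in \<open>auto simp: k\<close>)
  have w13: "real_of_int (crossing_sign D (pt s1 a) (pt s3 a)) = - \<sigma> * direction s1 * direction s3"
    by (rule crossing_sign_left[OF \<sigma>]) (use ne S ab a(2) la in \<open>auto simp: k\<close>)
  have w32: "real_of_int (crossing_sign D (pt s3 b) (pt s2 b)) = - \<sigma> * direction s3 * direction s2"
    by (rule crossing_sign_left[OF \<sigma>]) (use ne S ab b(2) lb in \<open>auto simp: k\<close>)
  have swap: "crossing_sign D (pt r x) (pt s x) = - crossing_sign D (pt s x) (pt r x)"
    if "s \<in> S" "r \<in> S" "s \<noteq> r" "x \<in> {-1..1}" "x = ?X s r" for s r x
    using crossing_sign_swap[OF valid] pt_double_points[OF that(1,2,4,4)] meet[OF that(1,2,4,3)] that by simp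
  have w21: "real_of_int (crossing_sign D (pt s2 0) (pt s1 0)) = \<sigma> * direction s2 * direction s1"
    using swap[of s1 s2 0] w12 ne S by (simp add: X(1))
  have w31: "real_of_int (crossing_sign D (pt s3 a) (pt s1 a)) = \<sigma> * direction s3 * direction s1"
    using swap[of s1 s3 a] w13 ne S a(1) by (simp add: X)
  have w23: "real_of_int (crossing_sign D (pt s2 b) (pt s3 b)) = \<sigma> * direction s2 * direction s3"
    using swap[of s3 s2 b] w32 ne S b(1) by (simp add: X)
  have "real_of_int (weight D (pt s (?X s r), pt r (?X s r))) = left_order s1 s2 s3 s r * \<sigma> * direction s * direction r"
    if "s \<in> S" "r \<in> S" "s \<noteq> r" for s r
    using that unfolding S
    by (elim insertE emptyE)
      (simp_all add: X left_order_def weight_def w12 w13 w32 w21 w31 w23 ne ne[symmetric])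
  with meet show ?thesis using ab sa sb by (rule that[rotated 6])
qed

lemma three_set_sum:
  assumes "{s, r, t} = S" "s \<noteq> r" "s \<noteq> t" "r \<noteq> t"
  shows "(\<Sum>q\<in>S - {s}. f q) = f r + (f t :: int)"
proof -
  have "S - {s} = {r, t}" using assms by auto
  then show ?thesis using assms by simp
qed

text \<open>
  In the classical case each strand meets the other two in opposite orders before and after the move.
  So at its crossing with \<open>r\<close>, the number on \<open>s\<close> changes by twice the weight of the
  crossing with the third strand \<open>t\<close>, up to a sign given by the order of the crossings on \<open>s\<close>. Both the
  weight and the order involve the direction in which \<open>s\<close> is traversed, so this direction drops out,
  and the same value results for the passage on \<open>r\<close>.
\<close>

lemma transports_reidemeister3:
  assumes valid: "virtual_link_diagram D" "virtual_link_diagram D'" and R3: "reidemeister3 D D'"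
  shows "transports D (Id_on (circles D)) D'"
proof -
  obtain \<phi> s1 s2 s3 f g where \<phi>: "plane_diffeo \<phi>" and dist: "distinct [s1, s2, s3]"
    and rep: "replaces_strands (\<phi> ` square) {s1, s2, s3} D D'"
    and fol: "follows D s1 (\<lambda>x. \<phi> (Complex x x))" "follows D' s1 (\<lambda>x. \<phi> (Complex x x))"
      "follows D s2 (\<lambda>x. \<phi> (Complex x (- x)))" "follows D' s2 (\<lambda>x. \<phi> (Complex x (- x)))"
      "follows D s3 (\<lambda>x. \<phi> (Complex x (f x)))" "follows D' s3 (\<lambda>x. \<phi> (Complex x (g x)))"
    and fg0: "f 0 > 0" "g 0 < 0"
    and fg: "\<forall>k\<in>{f, g}. (\<forall>x\<in>{-1..1}. \<bar>k x\<bar> < 1) \<and>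
        (\<exists>!x. x \<in> {-1..1} \<and> k x = x) \<and> (\<exists>!x. x \<in> {-1..1} \<and> k x = - x)"
    and ov0: "over_at D' s1 0 = over_at D s1 0" "over_at D' s2 0 = over_at D s2 0"
    and kind: "(\<forall>(E, k)\<in>{(D, f), (D', g)}. \<forall>x\<in>{-1..1}.
          (k x = x \<longrightarrow> \<not> over_at E s1 x \<and> \<not> over_at E s3 x) \<and>
          (k x = - x \<longrightarrow> \<not> over_at E s2 x \<and> \<not> over_at E s3 x)) \<or>
       (\<forall>(E, k)\<in>{(D, f), (D', g)}. \<forall>x\<in>{-1..1}.
          k x = x \<or> k x = - x \<longrightarrow> over_at E s3 x) \<and>
       (over_at D s1 0 \<or> over_at D s2 0)"
    using R3 unfolding reidemeister3_def by (elim exE conjE) (rule that)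
  let ?S = "{s1, s2, s3}"
  define k where "k f s x = (if s = s1 then x else if s = s2 then - x else f x)" for f :: "real \<Rightarrow> real" and s x
  have ne: "s1 \<noteq> s2" "s1 \<noteq> s3" "s2 \<noteq> s3" using dist by auto
  have kk: "k h s1 = (\<lambda>x. x)" "k h s2 = (\<lambda>x. - x)" "k h s3 = h" for h
    using ne by (simp_all add: k_def fun_eq_iff)
  interpret local_move D D' "\<phi> ` square" ?S
    by (rule local_moveI[OF valid \<phi> rep]) simp
  interpret G: graph_strands D \<phi> ?S "k f"
  proof
    show "meets_in_strands D (\<phi> ` square) ?S" using rep by (simp add: replaces_strands_def)
    fix s assume "s \<in> ?S"
    then consider "s = s1" | "s = s2" | "s = s3" by blast
    then show "follows D s (\<lambda>x. \<phi> (Complex x (k f s x)))"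
      by cases (simp_all add: kk fol)
  qed (rule valid \<phi>)+
  interpret G': graph_strands D' \<phi> ?S "k g"
  proof
    show "meets_in_strands D' (\<phi> ` square) ?S" using rep by (simp add: replaces_strands_def)
    fix s assume "s \<in> ?S"
    then consider "s = s1" | "s = s2" | "s = s3" by blast
    then show "follows D' s (\<lambda>x. \<phi> (Complex x (k g s x)))"
      by cases (simp_all add: kk fol)
  qed (rule valid \<phi>)+
  obtain \<sigma> where \<sigma>: "orientation_sign \<phi> \<sigma>" using plane_diffeo_orientation[OF \<phi>] by blast
  let ?\<tau> = "left_order s1 s2 s3"
  have props_f: "\<And>x. -1 \<le> x \<Longrightarrow> x \<le> 1 \<Longrightarrow> \<bar>f x\<bar> < 1"
    "\<exists>!x. x \<in> {-1..1} \<and> f x = x" "\<exists>!x. x \<in> {-1..1} \<and> f x = - x" "f 0 \<noteq> 0"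
    using fg fg0 by auto
  have props_g: "\<And>x. -1 \<le> x \<Longrightarrow> x \<le> 1 \<Longrightarrow> \<bar>g x\<bar> < 1"
    "\<exists>!x. x \<in> {-1..1} \<and> g x = x" "\<exists>!x. x \<in> {-1..1} \<and> g x = - x" "g 0 \<noteq> 0"
    using fg fg0 by auto
  obtain a b where ab: "-1 < a" "a < 1" "-1 < b" "b < 1" "sgn a = sgn (f 0)" "sgn b = - sgn (f 0)"
    and meet: "\<And>s r x. s \<in> ?S \<Longrightarrow> r \<in> ?S \<Longrightarrow> x \<in> {-1..1} \<Longrightarrow> s \<noteq> r \<Longrightarrow> k f s x = k f r x \<longleftrightarrow> x = meeting s1 s2 a b s r"
    and wD: "\<And>s r. s \<in> ?S \<Longrightarrow> r \<in> ?S \<Longrightarrow> s \<noteq> r \<Longrightarrow>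
      real_of_int (weight D (G.pt s (meeting s1 s2 a b s r), G.pt r (meeting s1 s2 a b s r))) =
      ?\<tau> s r * \<sigma> * direction s * direction r"
  proof (rule G.triangle[OF \<sigma> refl ne kk], goal_cases)
    case (5 a b)
    show ?case by (rule 5(1)[OF 5(2-)])
  qed (rule props_f; assumption)+
  obtain a' b' where ab': "-1 < a'" "a' < 1" "-1 < b'" "b' < 1" "sgn a' = sgn (g 0)" "sgn b' = - sgn (g 0)"
    and meet': "\<And>s r x. s \<in> ?S \<Longrightarrow> r \<in> ?S \<Longrightarrow> x \<in> {-1..1} \<Longrightarrow> s \<noteq> r \<Longrightarrow> k g s x = k g r x \<longleftrightarrow> x = meeting s1 s2 a' b' s r"
    and wD': "\<And>s r. s \<in> ?S \<Longrightarrow> r \<in> ?S \<Longrightarrow> s \<noteq> r \<Longrightarrow>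
      real_of_int (weight D' (G.pt s (meeting s1 s2 a' b' s r), G.pt r (meeting s1 s2 a' b' s r))) =
      ?\<tau> s r * \<sigma> * direction s * direction r"
  proof (rule G'.triangle[OF \<sigma> refl ne kk], goal_cases)
    case (5 a' b')
    show ?case by (rule 5(1)[OF 5(2-)])
  qed (rule props_g; assumption)+
  let ?X = "meeting s1 s2 a b" and ?X' = "meeting s1 s2 a' b'"
  have signs: "a > 0" "b < 0" "a' < 0" "b' > 0"
    using ab(5,6) ab'(5,6) fg0 by (auto simp: sgn_real_def split: if_splits)
  have Xin: "?X s r \<in> {-1..1}" "?X' s r \<in> {-1..1}" for s r using ab ab' by (auto simp: meeting_def)
  have Xsym: "?X s r = ?X r s" "?X' s r = ?X' r s" for s r by (simp_all add: meeting_def insert_commute)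
  have X: "?X s1 s2 = 0" "?X s2 s1 = 0" "?X s1 s3 = a" "?X s3 s1 = a" "?X s2 s3 = b" "?X s3 s2 = b"
    "?X' s1 s2 = 0" "?X' s2 s1 = 0" "?X' s1 s3 = a'" "?X' s3 s1 = a'" "?X' s2 s3 = b'" "?X' s3 s2 = b'"
    using ne by (auto simp: meeting_def doubleton_eq_iff)
  have dp: "(G.pt s (?X s r), G.pt r (?X s r)) \<in> double_points D"
    "(G.pt s (?X' s r), G.pt r (?X' s r)) \<in> double_points D'" if "s \<in> ?S" "r \<in> ?S" "s \<noteq> r" for s r
    using G.pt_double_points[OF that(1,2) Xin(1) Xin(1)] G'.pt_double_points[OF that(1,2) Xin(2) Xin(2)]
      meet[OF that(1,2) Xin(1) that(3)] meet'[OF that(1,2) Xin(2) that(3)] that(3) by auto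
  have on: "u \<in> on_strand D s \<longleftrightarrow> (\<exists>r\<in>?S - {s}. u = (G.pt s (?X s r), G.pt r (?X s r)) \<and>
      (is_over D (G.pt s (?X s r)) \<or> is_over D (G.pt r (?X s r))))" if s: "s \<in> ?S" for s u
    unfolding on_strand_def
  proof (rule G.classical_on_strand[OF s])
    fix r assume r: "r \<in> ?S" "r \<noteq> s"
    show "?X s r \<in> {-1..1}" by (rule Xin(1))
    show "k f s x = k f r x \<longleftrightarrow> x = ?X s r" if "x \<in> {-1..1}" for x
      using meet[OF s r(1) that] r(2) by blast
  qed
  have on': "u \<in> on_strand D' s \<longleftrightarrow> (\<exists>r\<in>?S - {s}. u = (G.pt s (?X' s r), G.pt r (?X' s r)) \<and>
      (is_over D' (G.pt s (?X' s r)) \<or> is_over D' (G.pt r (?X' s r))))" if s: "s \<in> ?S" for s u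
    unfolding on_strand_def
  proof (rule G'.classical_on_strand[OF s])
    fix r assume r: "r \<in> ?S" "r \<noteq> s"
    show "?X' s r \<in> {-1..1}" by (rule Xin(2))
    show "k g s x = k g r x \<longleftrightarrow> x = ?X' s r" if "x \<in> {-1..1}" for x
      using meet'[OF s r(1) that] r(2) by blast
  qed
  have isov: "is_over D (G.pt s x) = over_at D s x" "is_over D' (G.pt s x) = over_at D' s x"
    if "s \<in> ?S" "x \<in> {-1..1}" for s x
    using G.pt_props(4)[OF that] G'.pt_props(4)[OF that] by auto
  have fval: "f a = a" "f b = - b" "g a' = a'" "g b' = - b'"
    using meet[of s1 s3 a] meet[of s2 s3 b] meet'[of s1 s3 a'] meet'[of s2 s3 b'] ne ab ab' by (auto simp: X kk)
  have in1: "a \<in> {-1..1}" "b \<in> {-1..1}" "a' \<in> {-1..1}" "b' \<in> {-1..1}" "(0::real) \<in> {-1..1}" using ab ab' by auto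
  have minus: "?S - {s1} = {s2, s3}" "?S - {s2} = {s1, s3}" "?S - {s3} = {s1, s2}"
    using ne by blast+
  from kind show ?thesis
  proof
    assume virt: "\<forall>(E, k)\<in>{(D, f), (D', g)}. \<forall>x\<in>{-1..1}.
          (k x = x \<longrightarrow> \<not> over_at E s1 x \<and> \<not> over_at E s3 x) \<and>
          (k x = - x \<longrightarrow> \<not> over_at E s2 x \<and> \<not> over_at E s3 x)"
    have v: "\<not> is_over D (G.pt s1 a)" "\<not> is_over D (G.pt s3 a)" "\<not> is_over D (G.pt s2 b)" "\<not> is_over D (G.pt s3 b)"
      "\<not> is_over D' (G.pt s1 a')" "\<not> is_over D' (G.pt s3 a')" "\<not> is_over D' (G.pt s2 b')" "\<not> is_over D' (G.pt s3 b')"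
      using virt in1 fval isov by auto
    have o: "is_over D' (G.pt s1 0) = is_over D (G.pt s1 0)" "is_over D' (G.pt s2 0) = is_over D (G.pt s2 0)"
      using ov0 isov in1 by auto
    let ?cl = "is_over D (G.pt s1 0) \<or> is_over D (G.pt s2 0)"
    have on1: "u \<in> on_strand D s1 \<longleftrightarrow> u = (G.pt s1 0, G.pt s2 0) \<and> ?cl"
      "u \<in> on_strand D' s1 \<longleftrightarrow> u = (G.pt s1 0, G.pt s2 0) \<and> ?cl" for u
      by (simp_all only: on[of s1] on'[of s1] insert_iff simp_thms minus bex_simps X v o)
    have on2: "u \<in> on_strand D s2 \<longleftrightarrow> u = (G.pt s2 0, G.pt s1 0) \<and> ?cl"
      "u \<in> on_strand D' s2 \<longleftrightarrow> u = (G.pt s2 0, G.pt s1 0) \<and> ?cl" for u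
      by (simp_all only: on[of s2] on'[of s2] insert_iff simp_thms minus bex_simps X v o disj_commute)
    have on3: "u \<notin> on_strand D s3" "u \<notin> on_strand D' s3" for u
      by (simp_all only: on[of s3] on'[of s3] insert_iff simp_thms minus bex_simps X v o)
    have inner: "u \<in> inner D \<longleftrightarrow> (u = (G.pt s1 0, G.pt s2 0) \<or> u = (G.pt s2 0, G.pt s1 0)) \<and> ?cl"
      "u \<in> inner D' \<longleftrightarrow> (u = (G.pt s1 0, G.pt s2 0) \<or> u = (G.pt s2 0, G.pt s1 0)) \<and> ?cl" for u
      unfolding inner_eq UN_iff bex_simps using on1 on2 on3 by auto
    have "real_of_int (weight D' (G.pt s1 0, G.pt s2 0)) = real_of_int (weight D (G.pt s1 0, G.pt s2 0))"
      "real_of_int (weight D' (G.pt s2 0, G.pt s1 0)) = real_of_int (weight D (G.pt s2 0, G.pt s1 0))"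
      using wD[of s1 s2] wD'[of s1 s2] wD[of s2 s1] wD'[of s2 s1] ne by (simp_all add: X)
    then have w: "weight D' (G.pt s1 0, G.pt s2 0) = weight D (G.pt s1 0, G.pt s2 0)"
      "weight D' (G.pt s2 0, G.pt s1 0) = weight D (G.pt s2 0, G.pt s1 0)"
      by simp_all
    show ?thesis
    proof (rule transports_same_inner)
      show "inner D' = inner D" using inner by blast
      show "weight D' x = weight D x" "is_over D' (fst x) = is_over D (fst x)" if "x \<in> inner D" for x
        using that w o unfolding inner by auto
    qed
  next
    assume cla: "(\<forall>(E, k)\<in>{(D, f), (D', g)}. \<forall>x\<in>{-1..1}.
          k x = x \<or> k x = - x \<longrightarrow> over_at E s3 x) \<and> (over_at D s1 0 \<or> over_at D s2 0)"
    have o3: "is_over D (G.pt s3 a)" "is_over D (G.pt s3 b)" "is_over D' (G.pt s3 a')" "is_over D' (G.pt s3 b')"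
      using cla in1 fval isov by auto
    have n3: "\<not> is_over D (G.pt s1 a)" "\<not> is_over D (G.pt s2 b)" "\<not> is_over D' (G.pt s1 a')" "\<not> is_over D' (G.pt s2 b')"
      using valid_not_both_over[OF valid(1)] valid_not_both_over[OF valid(2)] o3 dp[of s3 s1] dp[of s3 s2] ne
      by (auto simp: X)
    have o: "is_over D' (G.pt s1 0) = is_over D (G.pt s1 0)" "is_over D' (G.pt s2 0) = is_over D (G.pt s2 0)"
      "is_over D (G.pt s1 0) \<or> is_over D (G.pt s2 0)"
      using ov0 isov in1 cla by auto
    have all_over: "is_over D (G.pt s (?X s r)) \<or> is_over D (G.pt r (?X s r))"
      "is_over D' (G.pt s (?X' s r)) \<or> is_over D' (G.pt r (?X' s r))"
      "is_over D (G.pt s (?X s r)) = is_over D' (G.pt s (?X' s r))"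
      if "s \<in> ?S" "r \<in> ?S" "s \<noteq> r" for s r
      using that o o3 n3 by (auto simp: X)
    define e where "e s r = lift_param s (?X s r)" for s r
    define e' where "e' s r = lift_param s (?X' s r)" for s r
    have pt: "G.pt s x = wrap (fst s, lift_param s x)" for s x
      by (simp add: G.pt_def strand_param_eq)
    define W where "W s r = weight D (G.pt s (?X s r), G.pt r (?X s r))" for s r
    have W: "real_of_int (W s r) = ?\<tau> s r * \<sigma> * direction s * direction r" if "s \<in> ?S" "r \<in> ?S" "s \<noteq> r" for s r
      using wD[OF that] by (simp add: W_def)
    have dir: "direction s * direction s = 1" if "s \<in> ?S" for s using G.direction_square[OF that] .
    have stepe: "real_of_int (step (e s r - e s t)) = sgn (?X s r - ?X s t) * direction s"
      "real_of_int (step (e' s r - e' s t)) = sgn (?X' s r - ?X' s t) * direction s" if "s \<in> ?S" for s r t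
    proof -
      obtain c p q where s: "s = (c, p, q)" by (cases s)
      have "\<bar>p - q\<bar> < 1" using G.props(3)[of c p q] that s by simp
      then show "real_of_int (step (e s r - e s t)) = sgn (?X s r - ?X s t) * direction s"
        "real_of_int (step (e' s r - e' s t)) = sgn (?X' s r - ?X' s t) * direction s"
        using step_lift_param[OF _ Xin(1)[of s r] Xin(1)[of s t]] step_lift_param[OF _ Xin(2)[of s r] Xin(2)[of s t]]
        by (simp_all add: e_def e'_def s)
    qed
    define sh where "sh s r = (\<Sum>q\<in>?S - {s}. W s q * (step (e' s r - e' s q) - step (e s r - e s q)))" for s r
    \<comment> \<open>The direction of \<open>s\<close> occurs squared, once from the weight and once from the order.\<close>
    have sh: "real_of_int (sh s r) = ?\<tau> s t * \<sigma> * direction t * (sgn (?X' s r - ?X' s t) - sgn (?X s r - ?X s t))"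
      if "{s, r, t} = ?S" "s \<noteq> r" "s \<noteq> t" "r \<noteq> t" for s r t
    proof -
      have st: "s \<in> ?S" "t \<in> ?S" using that(1) by blast+
      have "sh s r = W s t * (step (e' s r - e' s t) - step (e s r - e s t))"
        unfolding sh_def three_set_sum[OF that] by simp
      then have "real_of_int (sh s r) = ?\<tau> s t * \<sigma> * direction s * direction t *
          (sgn (?X' s r - ?X' s t) * direction s - sgn (?X s r - ?X s t) * direction s)"
        using W[OF st that(3)] stepe[OF st(1)] by simp
      also have "\<dots> = ?\<tau> s t * \<sigma> * direction t * (sgn (?X' s r - ?X' s t) - sgn (?X s r - ?X s t)) * (direction s * direction s)"
        by (simp add: algebra_simps)
      finally show ?thesis using dir[OF st(1)] by simp
    qed
    have \<tau>: "?\<tau> s1 s2 = -1" "?\<tau> s2 s1 = 1" "?\<tau> s1 s3 = -1" "?\<tau> s3 s1 = 1" "?\<tau> s3 s2 = -1" "?\<tau> s2 s3 = 1"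
      using ne by (auto simp: left_order_def)
    have sg: "sgn a = 1" "sgn b = -1" "sgn a' = -1" "sgn b' = 1" "sgn (a - b) = 1" "sgn (b - a) = -1"
      "sgn (a' - b') = -1" "sgn (b' - a') = 1"
      using signs by (auto simp: sgn_real_def)
    have "real_of_int (sh s1 s2) = real_of_int (sh s2 s1)"
      using sh[of s1 s2 s3] sh[of s2 s1 s3] ne by (simp add: insert_commute X \<tau> sg sgn_minus)
    moreover have "real_of_int (sh s1 s3) = real_of_int (sh s3 s1)"
      using sh[of s1 s3 s2] sh[of s3 s1 s2] ne by (simp add: insert_commute X \<tau> sg sgn_minus)
    moreover have "real_of_int (sh s2 s3) = real_of_int (sh s3 s2)"
      using sh[of s2 s3 s1] sh[of s3 s2 s1] ne by (simp add: insert_commute X \<tau> sg sgn_minus)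
    ultimately have shs: "sh s r = sh r s" if "s \<in> ?S" "r \<in> ?S" "s \<noteq> r" for s r
      using that by auto
    have xeq: "(wrap (fst s, e s r), wrap (fst r, e r s)) = (G.pt s (?X s r), G.pt r (?X s r))"
      "(wrap (fst s, e' s r), wrap (fst r, e' r s)) = (G.pt s (?X' s r), G.pt r (?X' s r))" for s r
      by (simp_all add: pt e_def e'_def Xsym[of r s])
    show ?thesis
    proof (rule transports_triangle[of e e' W, unfolded xeq])
      fix c p q r assume "(c, p, q) \<in> ?S"
      then show "e (c, p, q) r \<in> closed_segment p q \<and> e' (c, p, q) r \<in> closed_segment p q"
        unfolding e_def e'_def using lift_param_in_segment Xin by blast
    next
      fix s assume s: "s \<in> ?S"
      have inj: "lift_param r x = lift_param r y \<longleftrightarrow> x = y" if r: "r \<in> ?S" for r x y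
      proof -
        obtain c p q where abc: "r = (c, p, q)" by (cases r)
        show ?thesis using lift_param_diff[of c p q x y] G.props(2)[of c p q] r by (auto simp: abc)
      qed
      show "inj_on (e s) (?S - {s}) \<and> inj_on (e' s) (?S - {s})"
      proof -
        have neq: "a \<noteq> 0" "b \<noteq> 0" "a' \<noteq> 0" "b' \<noteq> 0" "a \<noteq> b" "a' \<noteq> b'" using signs by auto
        consider "s = s1" | "s = s2" | "s = s3" using s by blast
        then show ?thesis
          by cases (simp_all only: minus, simp_all add: e_def e'_def inj X neq neq[symmetric] image_iff)
      qed
      show "on_strand D s = (\<lambda>r. (G.pt s (?X s r), G.pt r (?X s r))) ` (?S - {s}) \<and>
          on_strand D' s = (\<lambda>r. (G.pt s (?X' s r), G.pt r (?X' s r))) ` (?S - {s})"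
      proof (intro conjI set_eqI)
        fix u
        show "u \<in> on_strand D s \<longleftrightarrow> u \<in> (\<lambda>r. (G.pt s (?X s r), G.pt r (?X s r))) ` (?S - {s})"
          unfolding on[OF s] image_iff
        proof (rule bex_cong[OF refl])
          fix r assume "r \<in> ?S - {s}"
          then have "r \<in> ?S" "s \<noteq> r" by blast+
          then show "(u = (G.pt s (?X s r), G.pt r (?X s r)) \<and> (is_over D (G.pt s (?X s r)) \<or> is_over D (G.pt r (?X s r)))) =
              (u = (G.pt s (?X s r), G.pt r (?X s r)))"
            using all_over(1)[OF s] by simp
        qed
        show "u \<in> on_strand D' s \<longleftrightarrow> u \<in> (\<lambda>r. (G.pt s (?X' s r), G.pt r (?X' s r))) ` (?S - {s})"
          unfolding on'[OF s] image_iff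
        proof (rule bex_cong[OF refl])
          fix r assume "r \<in> ?S - {s}"
          then have "r \<in> ?S" "s \<noteq> r" by blast+
          then show "(u = (G.pt s (?X' s r), G.pt r (?X' s r)) \<and> (is_over D' (G.pt s (?X' s r)) \<or> is_over D' (G.pt r (?X' s r)))) =
              (u = (G.pt s (?X' s r), G.pt r (?X' s r)))"
            using all_over(2)[OF s] by simp
        qed
      qed
    next
      fix s r assume sr: "s \<in> ?S" "r \<in> ?S" "s \<noteq> r"
      have "real_of_int (weight D' (G.pt s (?X' s r), G.pt r (?X' s r))) = real_of_int (W s r)"
        using wD'[OF sr] W[OF sr] by simp
      then show "weight D (G.pt s (?X s r), G.pt r (?X s r)) = W s r \<and>
          weight D' (G.pt s (?X' s r), G.pt r (?X' s r)) = W s r"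
        by (simp add: W_def)
      show "is_over D (fst (G.pt s (?X s r), G.pt r (?X s r))) = is_over D' (fst (G.pt s (?X' s r), G.pt r (?X' s r)))"
        using all_over(3)[OF sr] by simp
      show "(\<Sum>q\<in>?S - {s}. W s q * (step (e' s r - e' s q) - step (e s r - e s q))) =
          (\<Sum>q\<in>?S - {r}. W r q * (step (e' r s - e' r q) - step (e r s - e r q)))"
        using shs[OF sr] unfolding sh_def .
    qed
  qed
qed

section \<open>Steps that keep the crossings\<close>

text \<open>
  Isotopies, births and saddle moves match the crossings of the two diagrams. The map \<open>\<beta>\<close> takes
  points of \<open>D'\<close> to points of \<open>D\<close>, on regions \<open>A'\<close> and \<open>A\<close> that contain all crossings; \<open>\<gamma>\<close> is its effect on
  the circles, of which only those in \<open>C\<close> have a counterpart. The last assumption says that \<open>\<beta>\<close> preserves the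
  order of points of the same circle, and that points that come to lie on the same circle of \<open>D\<close> from
  different circles of \<open>D'\<close> are in a position which depends on the circle of the observer only; \<open>lift\<close>
  provides parameters on the real line.
\<close>

locale crossing_correspondence =
  fixes D D' :: diagram and \<beta> :: "nat \<times> real \<Rightarrow> nat \<times> real" and \<gamma> :: "nat \<Rightarrow> nat"
    and A A' :: "(nat \<times> real) set" and C :: "nat set"
    and lift :: "nat \<times> real \<Rightarrow> real" and \<rho> :: "nat \<Rightarrow> nat \<times> real \<Rightarrow> int"
  assumes valid: "virtual_link_diagram D" "virtual_link_diagram D'"
    and bij: "bij_betw \<beta> A' A"
    and sub: "double_points D \<subseteq> A \<times> A" "double_points D' \<subseteq> A' \<times> A'"
    and double: "\<And>p q. p \<in> A' \<Longrightarrow> q \<in> A' \<Longrightarrow> (\<beta> p, \<beta> q) \<in> double_points D \<longleftrightarrow> (p, q) \<in> double_points D'"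
    and over: "\<And>p. p \<in> A' \<Longrightarrow> is_over D (\<beta> p) = is_over D' p"
    and sign: "\<And>p q. (p, q) \<in> double_points D' \<Longrightarrow> crossing_sign D (\<beta> p) (\<beta> q) = crossing_sign D' p q"
    and circles: "C \<subseteq> circles D'" "\<gamma> ` C \<subseteq> circles D" "\<And>p. p \<in> A' \<Longrightarrow> fst p \<in> C"
    and \<beta>: "\<And>p. p \<in> A' \<Longrightarrow> \<beta> p = wrap (\<gamma> (fst p), lift p)"
    and order: "\<And>p q. p \<in> A' \<Longrightarrow> q \<in> A' \<Longrightarrow> \<gamma> (fst p) = \<gamma> (fst q) \<Longrightarrow>
      step (lift p - snd (\<beta> q)) = (if fst p = fst q then step (snd p - snd q) else 0) + \<rho> (fst p) q"
begin

lemma inj: "inj_on (map_prod \<beta> \<beta>) (classical D')"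
proof (rule inj_onI)
  fix x y assume xy: "x \<in> classical D'" "y \<in> classical D'" "map_prod \<beta> \<beta> x = map_prod \<beta> \<beta> y"
  then have "x \<in> A' \<times> A'" "y \<in> A' \<times> A'" using sub(2) by (auto simp: classical_def)
  then show "x = y" using xy(3) bij_betw_imp_inj_on[OF bij] by (auto simp: inj_on_def map_prod_def split: prod.splits)
qed

lemma image: "classical D = map_prod \<beta> \<beta> ` classical D'"
proof (intro set_eqI iffI)
  fix x assume x: "x \<in> classical D"
  obtain p q where pq: "x = (p, q)" by (cases x)
  have "p \<in> A" "q \<in> A" using x pq sub(1) by (auto simp: classical_def)
  then obtain p' q' where p': "p' \<in> A'" "p = \<beta> p'" "q' \<in> A'" "q = \<beta> q'"
    using bij unfolding bij_betw_def by blast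
  have "(p', q') \<in> classical D'"
    using x double[OF p'(1,3)] over p' by (simp add: classical_def pq)
  then show "x \<in> map_prod \<beta> \<beta> ` classical D'" using pq p' by force
next
  fix x assume "x \<in> map_prod \<beta> \<beta> ` classical D'"
  then obtain p q where pq: "(p, q) \<in> classical D'" "x = (\<beta> p, \<beta> q)" by auto
  have "p \<in> A'" "q \<in> A'" using pq(1) sub(2) by (auto simp: classical_def)
  then show "x \<in> classical D" using pq double over by (simp add: classical_def)
qed

lemma in_domain: "x \<in> classical D' \<Longrightarrow> fst x \<in> A' \<and> snd x \<in> A'"
  using sub(2) by (auto simp: classical_def)

lemma in_C: "((d, t), q) \<in> classical D' \<Longrightarrow> d \<in> C"
  using in_domain[of "((d, t), q)"] circles(3)[of "(d, t)"] by simp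

lemma weight_image: "x \<in> classical D' \<Longrightarrow> weight D (map_prod \<beta> \<beta> x) = weight D' x"
  using sign by (auto simp: weight_def classical_def)

lemma sum_classical:
  "(\<Sum>x | x \<in> classical D \<and> P x. F x) = (\<Sum>x | x \<in> classical D' \<and> P (map_prod \<beta> \<beta> x). F (map_prod \<beta> \<beta> x))"
proof -
  have "{x. x \<in> classical D \<and> P x} = map_prod \<beta> \<beta> ` {x. x \<in> classical D' \<and> P (map_prod \<beta> \<beta> x)}"
  proof -
    have "{x. x \<in> f ` X \<and> P x} = f ` {x. x \<in> X \<and> P (f x)}" for f and X :: "((nat \<times> real) \<times> (nat \<times> real)) set"
      by blast
    then show ?thesis unfolding image .
  qed
  moreover have "inj_on (map_prod \<beta> \<beta>) {x. x \<in> classical D' \<and> P (map_prod \<beta> \<beta> x)}"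
    using inj by (rule inj_on_subset) auto
  ultimately show ?thesis by (simp add: sum.reindex)
qed

lemma weigh_image:
  "weigh D \<kappa> c = (\<Sum>x | x \<in> classical D' \<and> \<gamma> (fst (fst x)) = c. weight D' x * \<kappa> (snd (\<beta> (fst x))))"
proof -
  have "fst (\<beta> (fst x)) = \<gamma> (fst (fst x))" if "x \<in> classical D'" for x
    using \<beta> in_domain[OF that] by simp
  then have "{x. x \<in> classical D' \<and> fst (fst (map_prod \<beta> \<beta> x)) = c} = {x. x \<in> classical D' \<and> \<gamma> (fst (fst x)) = c}"
    by auto
  then show ?thesis
    unfolding local_weigh_def sum_classical using weight_image by (auto intro!: sum.cong)
qed

lemma finite_C: "finite C"
  using circles(1) valid_finite(2)[OF valid(2)] finite_subset by blast

lemma monodromy_sum: "monodromy D c = (\<Sum>c' | c' \<in> C \<and> \<gamma> c' = c. monodromy D' c')"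
proof -
  have "monodromy D c = (\<Sum>x | x \<in> classical D' \<and> \<gamma> (fst (fst x)) = c. weight D' x)"
    unfolding monodromy_def weigh_image by simp
  also have "\<dots> = (\<Sum>c' | c' \<in> C \<and> \<gamma> c' = c. \<Sum>x | x \<in> {x. x \<in> classical D' \<and> \<gamma> (fst (fst x)) = c} \<and> fst (fst x) = c'. weight D' x)"
    by (rule sum.group[symmetric]) (use finite_C finite_classical[OF valid(2)] in_C in auto)
  also have "\<dots> = (\<Sum>c' | c' \<in> C \<and> \<gamma> c' = c. monodromy D' c')"
    unfolding monodromy_def local_weigh_def by (intro sum.cong) auto
  finally show ?thesis .
qed

lemma monodromy_outside: "c' \<notin> C \<Longrightarrow> monodromy D' c' = 0"
  unfolding monodromy_def local_weigh_def using in_C by (intro sum.neutral) auto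

text \<open>
  A circle of \<open>D\<close> sees the passages of all circles of \<open>D'\<close> that are merged into it, which gives the flow.
  Corresponding points have the same number up to a constant \<open>K\<close> for each circle of \<open>D'\<close>.
\<close>

lemma transports_correspondence: "transports D {(\<gamma> c, c) | c. c \<in> C} D'"
proof -
  let ?T = "{(\<gamma> c, c) | c. c \<in> C}"
  have "\<exists>f :: nat \<times> nat \<Rightarrow> int.
      (\<forall>c\<in>circles D. (\<Sum>e | e \<in> ?T \<and> fst e = c. f e) = monodromy D c) \<and>
      (\<forall>c\<in>circles D'. (\<Sum>e | e \<in> ?T \<and> snd e = c. f e) = monodromy D' c)"
  proof (intro exI[of _ "\<lambda>e. monodromy D' (snd e)"] conjI ballI)
    fix c
    have eq: "{e. e \<in> ?T \<and> fst e = c} = (\<lambda>c'. (\<gamma> c', c')) ` {c'. c' \<in> C \<and> \<gamma> c' = c}" by auto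
    have inj: "inj_on (\<lambda>c'. (\<gamma> c', c')) {c'. c' \<in> C \<and> \<gamma> c' = c}" by (rule inj_onI) simp
    show "(\<Sum>e | e \<in> ?T \<and> fst e = c. monodromy D' (snd e)) = monodromy D c"
      unfolding eq sum.reindex[OF inj] monodromy_sum by simp
  next
    fix c assume "c \<in> circles D'"
    have "{e. e \<in> ?T \<and> snd e = c} = (if c \<in> C then {(\<gamma> c, c)} else {})" by auto
    then show "(\<Sum>e | e \<in> ?T \<and> snd e = c. monodromy D' (snd e)) = monodromy D' c"
      using monodromy_outside[of c] by simp
  qed
  moreover have "\<exists>g. \<forall>h h'. (\<forall>(c, c')\<in>?T. h' c' - h c = g (c, c')) \<longrightarrow>
        (\<forall>n. n \<noteq> 0 \<longrightarrow> index_writhe D (shifted D h) n = index_writhe D' (shifted D' h') n)"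
    if bal: "balanced D" "balanced D'"
  proof -
    define K where "K c' = (\<Sum>x | x \<in> classical D' \<and> \<gamma> (fst (fst x)) = \<gamma> c'. weight D' x * \<rho> c' (fst x))" for c'
    have num: "numbering D (\<beta> p) = numbering D' p + K (fst p)" if p: "p \<in> A'" for p
    proof -
      let ?Y = "{x. x \<in> classical D' \<and> \<gamma> (fst (fst x)) = \<gamma> (fst p)}"
      have fin: "finite ?Y" using finite_classical[OF valid(2)] by simp
      have "fst p \<in> C" using circles(3) p by blast
      then have "\<gamma> (fst p) \<in> circles D" using circles(2) by blast
      then have "numbering D (\<beta> p) = numbering D (\<gamma> (fst p), lift p)"
        using bal(1) numbering_wrap[of D "(\<gamma> (fst p), lift p)"] \<beta>[OF p] by (simp add: balanced_def)
      also have "\<dots> = (\<Sum>x\<in>?Y. weight D' x * step (lift p - snd (\<beta> (fst x))))"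
        unfolding numbering_def weigh_image by simp
      also have "\<dots> = (\<Sum>x\<in>?Y. (if fst (fst x) = fst p then weight D' x * step (snd p - snd (fst x)) else 0) +
          weight D' x * \<rho> (fst p) (fst x))"
      proof (rule sum.cong[OF refl])
        fix x assume x: "x \<in> ?Y"
        then have "step (lift p - snd (\<beta> (fst x))) =
          (if fst p = fst (fst x) then step (snd p - snd (fst x)) else 0) + \<rho> (fst p) (fst x)"
          using order[OF p, of "fst x"] in_domain by simp
        then show "weight D' x * step (lift p - snd (\<beta> (fst x))) =
          (if fst (fst x) = fst p then weight D' x * step (snd p - snd (fst x)) else 0) + weight D' x * \<rho> (fst p) (fst x)"
          by (simp add: algebra_simps)
      qed
      also have "\<dots> = (\<Sum>x\<in>?Y. if fst (fst x) = fst p then weight D' x * step (snd p - snd (fst x)) else 0) + K (fst p)"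
        unfolding K_def by (rule sum.distrib)
      also have "(\<Sum>x\<in>?Y. if fst (fst x) = fst p then weight D' x * step (snd p - snd (fst x)) else 0) =
          (\<Sum>x | x \<in> ?Y \<and> fst (fst x) = fst p. weight D' x * step (snd p - snd (fst x)))"
        by (rule sum.inter_filter[OF fin, symmetric])
      also have "{x. x \<in> ?Y \<and> fst (fst x) = fst p} = {x. x \<in> classical D' \<and> fst (fst x) = fst p}" by auto
      finally show ?thesis by (simp add: numbering_def local_weigh_def)
    qed
    show ?thesis
    proof (intro exI[of _ "\<lambda>(c, c'). K c'"] allI impI)
      fix h h' n assume h: "\<forall>(c, c')\<in>?T. h' c' - h c = (case (c, c') of (c, c') \<Rightarrow> K c')" and "n \<noteq> (0::int)"
      have same: "shifted D h (\<beta> p) = shifted D' h' p" if p: "p \<in> A'" for p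
      proof -
        have "h' (fst p) - h (\<gamma> (fst p)) = K (fst p)" using h circles(3)[OF p] by auto
        then show ?thesis using num[OF p] \<beta>[OF p] by (simp add: shifted_def)
      qed
      have "{x. x \<in> classical D' \<and> is_over D (fst (map_prod \<beta> \<beta> x)) \<and>
          shifted D h (snd (map_prod \<beta> \<beta> x)) - shifted D h (fst (map_prod \<beta> \<beta> x)) = 2 * n} =
        {x. x \<in> classical D' \<and> is_over D' (fst x) \<and> shifted D' h' (snd x) - shifted D' h' (fst x) = 2 * n}"
        using same over in_domain by auto
      then show "index_writhe D (shifted D h) n = index_writhe D' (shifted D' h') n"
        unfolding local_writhe_def sum_classical using weight_image by (auto intro!: sum.cong)
    qed
  qed
  moreover have "?T \<subseteq> circles D \<times> circles D'" using circles(1,2) by auto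
  ultimately show ?thesis unfolding transports_def by blast
qed

end

section \<open>Births\<close>

text \<open>
  The new circle bounds a disc that the old ones avoid, so it has no crossings.
\<close>

lemma transports_birth:
  assumes valid: "virtual_link_diagram D" "virtual_link_diagram D'" and birth: "birth c D D'"
  shows "transports D (Id_on (circles D)) D'"
proof -
  obtain \<phi> where c: "c \<notin> circles D" "circles D' = insert c (circles D)"
    and old: "\<And>d t. d \<in> circles D \<Longrightarrow> curve D' d t = curve D d t \<and> over D' d t = over D d t"
    and \<phi>: "plane_diffeo \<phi>" "\<And>t. curve D' c t = \<phi> (cis (2 * pi * t))"
    and disjoint: "\<And>d t. d \<in> circles D \<Longrightarrow> curve D d t \<notin> \<phi> ` cball 0 1"
    using birth unfolding birth_def by blast
  have same: "position D' p = position D p" "is_over D' p = is_over D p" "velocity D' p = velocity D p"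
    if p: "fst p \<in> circles D" for p
  proof -
    obtain d t where dt: "p = (d, t)" by (cases p)
    have d: "d \<in> circles D" using p dt by simp
    then show "position D' p = position D p" "is_over D' p = is_over D p"
      using old by (simp_all add: position_def is_over_def dt)
    have "curve D' d = curve D d" using old[OF d] by auto
    then show "velocity D' p = velocity D p" by (simp add: velocity_def dt)
  qed
  have new: "fst p \<in> circles D" if "(p, q) \<in> double_points D'" for p q
  proof (rule ccontr)
    assume *: "fst p \<notin> circles D"
    have pq: "p \<in> points D'" "q \<in> points D'" "p \<noteq> q" "position D' p = position D' q"
      using that unfolding double_points_def by simp_all
    have "fst p = c" using pq(1) * c(2) by (cases p) (simp add: points_def)
    then obtain t where p: "p = (c, t)" "t \<in> {0..<1}" using pq(1) by (cases p) (simp add: points_def)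
    have pos: "position D' p = \<phi> (cis (2 * pi * t))" using \<phi>(2) by (simp add: p position_def)
    show False
    proof (cases "fst q = c")
      case True
      then obtain u where q: "q = (c, u)" "u \<in> {0..<1}"
        using pq(2) by (cases q) (simp add: points_def)
      have "\<phi> (cis (2 * pi * t)) = \<phi> (cis (2 * pi * u))"
        using pq(4) \<phi>(2) by (simp add: p q position_def)
      then have "cis (2 * pi * t) = cis (2 * pi * u)" by (simp add: plane_diffeo_inj[OF \<phi>(1)])
      then have "exp (\<i> * complex_of_real (2 * pi * t)) = exp (\<i> * complex_of_real (2 * pi * u))"
        by (simp add: cis_conv_exp)
      then obtain n :: int where "\<i> * complex_of_real (2 * pi * t) = \<i> * complex_of_real (2 * pi * u) + (of_int (2 * n) * pi) * \<i>"
        by (auto simp: exp_eq)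
      then have "Im (\<i> * complex_of_real (2 * pi * t)) =
          Im (\<i> * complex_of_real (2 * pi * u) + (of_int (2 * n) * pi) * \<i>)" by (rule arg_cong)
      then have "2 * pi * t = 2 * pi * u + of_int (2 * n) * pi" by simp
      then have "2 * pi * t = 2 * pi * (u + of_int n)" by (simp add: algebra_simps)
      then have "t = u + of_int n" by simp
      then have "t = u" using p(2) q(2) by (cases "n = 0") auto
      then show False using pq(3) p q by simp
    next
      case False
      then have q: "fst q \<in> circles D" using pq(2) c(2) by (cases q) (simp add: points_def)
      have "position D q = \<phi> (cis (2 * pi * t))" using pq(4) same(1)[OF q] pos by simp
      then have "curve D (fst q) (snd q) = \<phi> (cis (2 * pi * t))" by (simp add: position_def split: prod.splits)
      moreover have "cis (2 * pi * t) \<in> cball 0 1" by simp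
      ultimately have "curve D (fst q) (snd q) \<in> \<phi> ` cball 0 1" by blast
      then show False using disjoint[OF q] by blast
    qed
  qed
  interpret crossing_correspondence D D' id id "points D" "points D" "circles D" snd "\<lambda>_ _. 0"
  proof
    show "double_points D \<subseteq> points D \<times> points D" by (auto simp: double_points_def)
    show "double_points D' \<subseteq> points D \<times> points D"
    proof
      fix x assume x: "x \<in> double_points D'"
      obtain p q where pq: "x = (p, q)" by (cases x)
      have "fst p \<in> circles D" "fst q \<in> circles D"
        using new x double_points_sym pq by blast+
      then show "x \<in> points D \<times> points D"
        using x pq by (auto simp: double_points_def points_def)
    qed
    show "(id p, id q) \<in> double_points D \<longleftrightarrow> (p, q) \<in> double_points D'" if "p \<in> points D" "q \<in> points D" for p q
      using that same(1)[of p] same(1)[of q] c(2) by (auto simp: double_points_def points_def)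
    show "is_over D (id p) = is_over D' p" if "p \<in> points D" for p
      using that same(2)[of p] by (auto simp: points_def)
    show "crossing_sign D (id p) (id q) = crossing_sign D' p q" if "(p, q) \<in> double_points D'" for p q
      using same(3)[OF new[OF that]] same(3)[OF new[OF double_points_sym[OF that]]] by (simp add: crossing_sign_def)
    show "id p = wrap (id (fst p), snd p)" if "p \<in> points D" for p
      using wrap_id[OF that] by simp
  qed (use valid c(2) in \<open>auto simp: points_def\<close>)
  have "{(id d, d) | d. d \<in> circles D} = Id_on (circles D)" by auto
  then show ?thesis using transports_correspondence by simp
qed

section \<open>Saddles\<close>

lemma crossing_sign_scaled:
  assumes "velocity D' p = m *\<^sub>R velocity D p'" "velocity D' q = n *\<^sub>R velocity D q'" "m > 0" "n > 0"
  shows "crossing_sign D p' q' = crossing_sign D' p q"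
proof -
  have "plane_det (velocity D' p) (velocity D' q) = m * n * plane_det (velocity D p') (velocity D q')"
    by (simp add: assms plane_det_def algebra_simps)
  moreover have "0 < m * n" "\<not> m * n < 0" using mult_pos_pos[OF assms(3,4)] by simp_all
  ultimately show ?thesis by (simp add: crossing_sign_def zero_less_mult_iff[of "m * n"])
qed

text \<open>
  The arcs involved in the saddle have no crossings. All passages of the circle \<open>a\<close> are therefore on
  its quarters \<open>(1/4, 1/2)\<close> and \<open>(3/4, 1)\<close>, which become the halves \<open>(0, 1/2)\<close> of \<open>b\<close> and \<open>c\<close>.
\<close>

lemma transports_saddle_split:
  assumes valid: "virtual_link_diagram D" "virtual_link_diagram D'" and split: "saddle_split a b c D D'"
  shows "transports D (Id_on (circles D - {a}) \<union> {(a, b), (a, c)}) D'"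
proof -
  let ?R = "circles D - {a}"
  obtain B where a: "a \<in> circles D" and bc: "b \<noteq> c" "b \<notin> ?R" "c \<notin> ?R"
    and circ: "circles D' = ?R \<union> {b, c}"
    and old: "\<And>d t. d \<in> ?R \<Longrightarrow> curve D' d t = curve D d t \<and> over D' d t = over D d t"
    and meets: "meets_in_strands D B {(a, 0, 1/4), (a, 1/2, 3/4)}"
    and meets': "meets_in_strands D' B {(b, 1/2, 1), (c, 1/2, 1)}"
    and inj: "inj_on (position D) ({a} \<times> ({0..1/4} \<union> {1/2..3/4}))"
    and inj': "inj_on (position D') ({b, c} \<times> {1/2..1})"
    and cut: "\<And>t. t \<in> {0..1/2} \<Longrightarrow> curve D' b t = curve D a (1/4 + t/2) \<and> over D' b t = over D a (1/4 + t/2) \<and>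
        curve D' c t = curve D a (3/4 + t/2) \<and> over D' c t = over D a (3/4 + t/2)"
    using split unfolding saddle_split_def by blast
  define A where "A = ?R \<times> {0..<1} \<union> {a} \<times> ({1/4<..<1/2} \<union> {3/4<..<1::real})"
  define A' where "A' = ?R \<times> {0..<1} \<union> {b, c} \<times> {0<..<1/2::real}"
  define \<gamma> where "\<gamma> d = (if d = b \<or> d = c then a else d)" for d
  define \<beta> where "\<beta> p = (if fst p = b then (a, 1/4 + snd p / 2) else if fst p = c then (a, 3/4 + snd p / 2) else p)"
    for p :: "nat \<times> real"
  \<comment> \<open>On \<open>a\<close>, the quarter that becomes \<open>b\<close> precedes the one that becomes \<open>c\<close>.\<close>
  define \<rho> where "\<rho> d p = (if d = b \<and> fst p = c then -1 else if d = c \<and> fst p = b then 1 else 0 :: int)"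
    for d and p :: "nat \<times> real"
  have U: "{(d, t). d \<in> circles D \<and> curve D d t \<in> B} = strand_set (a, 0, 1/4) \<union> strand_set (a, 1/2, 3/4)"
    using meets by (simp add: meets_in_strands_def)
  have U': "{(d, t). d \<in> circles D' \<and> curve D' d t \<in> B} = strand_set (b, 1/2, 1) \<union> strand_set (c, 1/2, 1)"
    using meets' by (simp add: meets_in_strands_def)
  have in_arc: "p \<in> {a} \<times> ({0..1/4} \<union> {1/2..3/4})"
    if "p \<in> points D" "position D p \<in> B" for p
  proof -
    have "p \<in> strand_set (a, 0, 1/4) \<union> strand_set (a, 1/2, 3/4)"
      using U that by (cases p) (auto simp: points_def position_def)
    then obtain m :: int where m: "fst p = a" "snd p + of_int m \<in> {0..1/4} \<or> snd p + of_int m \<in> {1/2..3/4}"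
      by (auto simp: strand_set_iff closed_segment_eq_real_ivl)
    have "0 \<le> snd p" "snd p < 1" using that(1) by (auto simp: points_def)
    then have "m = 0" using m(2) by auto
    then show ?thesis using m by (cases p) auto
  qed
  have arc_in: "position D p \<in> B" if "p \<in> points D" "p \<notin> A" for p
  proof -
    have "p \<in> strand_set (a, 0, 1/4) \<union> strand_set (a, 1/2, 3/4)"
    proof -
      have "fst p = a" "snd p \<in> {0..1/4} \<or> snd p \<in> {1/2..3/4}"
        using that by (auto simp: A_def points_def)
      moreover have "snd p + of_int 0 \<in> closed_segment x y" if "snd p \<in> {x..y}" for x y
        using that by (simp add: closed_segment_eq_real_ivl)
      ultimately show ?thesis unfolding Un_iff strand_set_iff by blast
    qed
    then show ?thesis using U by (cases p) (auto simp: position_def)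
  qed
  have in_arc': "\<exists>p'. p' \<in> {b, c} \<times> {1/2..1} \<and> position D' p' = position D' p \<and> wrap p' = p"
    if "p \<in> points D'" "position D' p \<in> B" for p
  proof -
    have "p \<in> strand_set (b, 1/2, 1) \<union> strand_set (c, 1/2, 1)"
      using U' that by (cases p) (auto simp: points_def position_def)
    then obtain m :: int where m: "fst p \<in> {b, c}" "snd p + of_int m \<in> {1/2..1}"
      by (auto simp: strand_set_iff closed_segment_eq_real_ivl)
    let ?p = "(fst p, snd p + of_int m)"
    have "wrap ?p = p" using wrap_id[OF that(1)] by (simp add: wrap_add_int)
    moreover have "position D' ?p = position D' (wrap ?p)"
      using wrap_invariant(1)[OF valid(2), of ?p] m(1) circ by auto
    ultimately show ?thesis using m by (intro exI[of _ ?p]) auto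
  qed
  have arc_in': "position D' p \<in> B" if "p \<in> points D'" "p \<notin> A'" for p
  proof -
    have d: "fst p \<in> {b, c}" "snd p = 0 \<or> 1/2 \<le> snd p" "0 \<le> snd p" "snd p < 1"
      using that by (auto simp: A'_def points_def circ)
    have "snd p + of_int (if snd p = 0 then 1 else 0) \<in> closed_segment (1/2) 1"
      using d by (auto simp: closed_segment_eq_real_ivl)
    then have "p \<in> strand_set (b, 1/2, 1) \<union> strand_set (c, 1/2, 1)"
      using d(1) unfolding Un_iff strand_set_iff by blast
    then show ?thesis using U' by (cases p) (auto simp: position_def)
  qed
  have sub: "double_points D \<subseteq> A \<times> A"
  proof -
    have mem: "p \<in> A" if pq: "(p, q) \<in> double_points D" for p q
    proof (rule ccontr)
      assume "p \<notin> A"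
      then have "position D p \<in> B" "position D q \<in> B"
        using arc_in[of p] pq by (auto simp: double_points_def)
      then have "p \<in> {a} \<times> ({0..1/4} \<union> {1/2..3/4})" "q \<in> {a} \<times> ({0..1/4} \<union> {1/2..3/4})"
        using in_arc pq by (auto simp: double_points_def)
      then show False using inj_onD[OF inj, of p q] pq by (simp add: double_points_def)
    qed
    have "x \<in> A \<times> A" if x: "x \<in> double_points D" for x
      using mem[of "fst x" "snd x"] mem[of "snd x" "fst x"] double_points_sym[of "fst x" "snd x" D] x
      by (simp add: mem_Times_iff)
    then show ?thesis by blast
  qed
  have sub': "double_points D' \<subseteq> A' \<times> A'"
  proof -
    have mem: "p \<in> A'" if pq: "(p, q) \<in> double_points D'" for p q
    proof (rule ccontr)
      assume "p \<notin> A'"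
      then have B: "position D' p \<in> B" "position D' q \<in> B"
        using arc_in'[of p] pq by (auto simp: double_points_def)
      have P: "p \<in> points D'" "q \<in> points D'" using double_points_in_points[OF pq] by blast+
      obtain p' where p': "p' \<in> {b, c} \<times> {1/2..1}" "position D' p' = position D' p" "wrap p' = p"
        using in_arc'[OF P(1) B(1)] by blast
      obtain q' where q': "q' \<in> {b, c} \<times> {1/2..1}" "position D' q' = position D' q" "wrap q' = q"
        using in_arc'[OF P(2) B(2)] by blast
      have pne: "position D' p = position D' q" "p \<noteq> q" using pq by (simp_all add: double_points_def)
      have "p' = q'" by (rule inj_onD[OF inj' _ p'(1) q'(1)]) (simp only: p'(2) q'(2) pne(1))
      then show False using p'(3) q'(3) pne(2) by simp
    qed
    have "x \<in> A' \<times> A'" if x: "x \<in> double_points D'" for x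
      using mem[of "fst x" "snd x"] mem[of "snd x" "fst x"] double_points_sym[of "fst x" "snd x" D'] x
      by (simp add: mem_Times_iff)
    then show ?thesis by blast
  qed
  have A'_cases: "fst p \<in> ?R \<and> fst p \<noteq> b \<and> fst p \<noteq> c \<and> \<beta> p = p \<and> \<gamma> (fst p) = fst p \<or>
      fst p = b \<and> \<beta> p = (a, 1/4 + snd p / 2) \<and> \<gamma> (fst p) = a \<and> 0 < snd p \<and> snd p < 1/2 \<or>
      fst p = c \<and> \<beta> p = (a, 3/4 + snd p / 2) \<and> \<gamma> (fst p) = a \<and> 0 < snd p \<and> snd p < 1/2"
    if "p \<in> A'" for p
    using that bc by (auto simp: A'_def \<beta>_def \<gamma>_def)
  have image: "\<beta> p \<in> A" if "p \<in> A'" for p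
    using that A'_cases[OF that] bc by (auto simp: A_def A'_def)
  have pos: "position D (\<beta> p) = position D' p" "is_over D (\<beta> p) = is_over D' p" if p: "p \<in> A'" for p
  proof -
    obtain d t where dt: "p = (d, t)" by (cases p)
    show "position D (\<beta> p) = position D' p" "is_over D (\<beta> p) = is_over D' p"
      using A'_cases[OF p] old[of d t] cut[of t] by (auto simp: dt position_def is_over_def)
  qed
  have vel: "\<exists>m>0. velocity D' p = m *\<^sub>R velocity D (\<beta> p)" if p: "p \<in> A'" for p
  proof -
    obtain d t where dt: "p = (d, t)" by (cases p)
    have half: "velocity D' (d', t) = (1/2) *\<^sub>R velocity D (a, x + t / 2)"
      if t: "0 < t" "t < 1/2" and eq: "\<And>u. u \<in> {0..1/2} \<Longrightarrow> curve D' d' u = curve D a (x + u / 2)" for d' x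
    proof -
      have "((\<lambda>u. x + u / 2) has_vector_derivative 1 / 2) (at t)"
        by (auto intro!: derivative_eq_intros simp: has_real_derivative_iff_has_vector_derivative[symmetric])
      then have "(curve D a \<circ> (\<lambda>u. x + u / 2) has_vector_derivative (1/2) *\<^sub>R velocity D (a, x + t / 2)) (at t)"
        using curve_has_derivative[OF valid(1) a] by (rule vector_diff_chain_at)
      then have "(curve D' d' has_vector_derivative (1/2) *\<^sub>R velocity D (a, x + t / 2)) (at t)"
        by (rule has_vector_derivative_transform_within_open[of _ _ _ "{0<..<1/2}"]) (use t eq in auto)
      then show ?thesis by (simp add: velocity_def vector_derivative_at)
    qed
    from A'_cases[OF p] consider "d \<in> ?R" "\<beta> p = p" | "d = b" "\<beta> p = (a, 1/4 + t / 2)" "0 < t" "t < 1/2"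
      | "d = c" "\<beta> p = (a, 3/4 + t / 2)" "0 < t" "t < 1/2" by (auto simp: dt)
    then show ?thesis
    proof cases
      case 1
      then have "curve D' d = curve D d" using old by auto
      then show ?thesis using 1 by (intro exI[of _ 1]) (simp add: velocity_def dt)
    next
      case 2
      then show ?thesis using half[of b "1/4"] cut by (intro exI[of _ "1/2"]) (simp add: dt)
    next
      case 3
      then show ?thesis using half[of c "3/4"] cut by (intro exI[of _ "1/2"]) (simp add: dt)
    qed
  qed
  have inj_\<beta>: "inj_on \<beta> A'"
  proof (rule inj_onI)
    fix p q assume "p \<in> A'" "q \<in> A'" "\<beta> p = \<beta> q"
    then show "p = q" using A'_cases[of p] A'_cases[of q] by (cases p; cases q) auto
  qed
  have surj_\<beta>: "A \<subseteq> \<beta> ` A'"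
  proof
    fix p assume "p \<in> A"
    then consider "p \<in> ?R \<times> {0..<1}" | t where "p = (a, t)" "1/4 < t" "t < 1/2" | t where "p = (a, t)" "3/4 < t" "t < 1"
      unfolding A_def by auto
    then show "p \<in> \<beta> ` A'"
    proof cases
      case 1 then show ?thesis using bc by (intro image_eqI[of _ _ p]) (auto simp: \<beta>_def A'_def)
    next
      case 2 then show ?thesis by (intro image_eqI[of _ _ "(b, 2 * t - 1/2)"]) (auto simp: \<beta>_def A'_def field_simps)
    next
      case 3 then show ?thesis using bc by (intro image_eqI[of _ _ "(c, 2 * t - 3/2)"]) (auto simp: \<beta>_def A'_def field_simps)
    qed
  qed
  have A_points: "A \<subseteq> points D" "A' \<subseteq> points D'"
    using a by (auto simp: A_def A'_def points_def circ)
  interpret crossing_correspondence D D' \<beta> \<gamma> A A' "circles D'" "\<lambda>p. snd (\<beta> p)" \<rho>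
  proof
    show "bij_betw \<beta> A' A" using inj_\<beta> surj_\<beta> image by (auto simp: bij_betw_def)
    show "(\<beta> p, \<beta> q) \<in> double_points D \<longleftrightarrow> (p, q) \<in> double_points D'" if pq: "p \<in> A'" "q \<in> A'" for p q
    proof -
      have "p \<in> points D'" "q \<in> points D'" "\<beta> p \<in> points D" "\<beta> q \<in> points D"
        using A_points pq image by blast+
      moreover have "\<beta> p = \<beta> q \<longleftrightarrow> p = q" using inj_\<beta> pq by (auto dest: inj_onD)
      ultimately show ?thesis using pos pq by (simp add: double_points_def)
    qed
    show "crossing_sign D (\<beta> p) (\<beta> q) = crossing_sign D' p q" if pq: "(p, q) \<in> double_points D'" for p q
    proof -
      have "p \<in> A'" "q \<in> A'" using pq sub' by auto
      then show ?thesis using vel[of p] vel[of q] crossing_sign_scaled by metis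
    qed
    show "\<gamma> ` circles D' \<subseteq> circles D" using a by (auto simp: \<gamma>_def circ)
    show "fst p \<in> circles D'" if "p \<in> A'" for p using that A_points by (auto simp: points_def)
    show "\<beta> p = wrap (\<gamma> (fst p), snd (\<beta> p))" if p: "p \<in> A'" for p
    proof -
      have "fst (\<beta> p) = \<gamma> (fst p)" using A'_cases[OF p] by auto
      moreover have "\<beta> p \<in> points D" using image[OF p] A_points by blast
      ultimately show ?thesis using wrap_id[of "\<beta> p" D] by (metis prod.collapse)
    qed
    show "step (snd (\<beta> p) - snd (\<beta> q)) = (if fst p = fst q then step (snd p - snd q) else 0) + \<rho> (fst p) q"
      if pq: "p \<in> A'" "q \<in> A'" and g: "\<gamma> (fst p) = \<gamma> (fst q)" for p q
    proof -
      have half: "step (x / 2 - y / 2) = step (x - y)" if "0 < x" "x < 1/2" "0 < y" "y < 1/2" for x y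
      proof -
        have "sgn (x / 2 - y / 2) = sgn (x - y)" by (simp add: sgn_real_def)
        then have "real_of_int (step (x / 2 - y / 2)) = real_of_int (step (x - y))"
          using step_small[of "x / 2 - y / 2"] step_small[of "x - y"] that by simp
        then show ?thesis by simp
      qed
      have diff: "step (1 / 4 + x / 2 - (3 / 4 + y / 2)) = -1" "step (3 / 4 + y / 2 - (1 / 4 + x / 2)) = 1"
        if "0 < x" "x < 1/2" "0 < y" "y < 1/2" for x y :: real
        using step_between[of "-1" "1 / 4 + x / 2 - (3 / 4 + y / 2)"] step_between[of 0 "3 / 4 + y / 2 - (1 / 4 + x / 2)"] that
        by simp_all
      define inb where "inb r \<longleftrightarrow> fst r = b \<and> snd (\<beta> r) = 1/4 + snd r / 2 \<and> \<gamma> (fst r) = a \<and> 0 < snd r \<and> snd r < 1/2" for r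
      define inc where "inc r \<longleftrightarrow> fst r = c \<and> snd (\<beta> r) = 3/4 + snd r / 2 \<and> \<gamma> (fst r) = a \<and> 0 < snd r \<and> snd r < 1/2" for r
      define rest where "rest r \<longleftrightarrow> fst r \<noteq> a \<and> fst r \<noteq> b \<and> fst r \<noteq> c \<and> \<beta> r = r \<and> \<gamma> (fst r) = fst r" for r
      have cases: "rest r \<or> inb r \<or> inc r" if "r \<in> A'" for r
        using A'_cases[OF that] unfolding inb_def inc_def rest_def by auto
      have "rest p \<and> rest q \<and> fst p = fst q \<or> (inb p \<or> inc p) \<and> (inb q \<or> inc q)"
        using cases[OF pq(1)] cases[OF pq(2)] g unfolding rest_def inb_def inc_def by metis
      then show ?thesis
      proof
        assume "rest p \<and> rest q \<and> fst p = fst q"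
        then have "\<beta> p = p" "\<beta> q = q" "fst p = fst q" "fst p \<noteq> b" "fst p \<noteq> c" by (simp_all add: rest_def)
        then show ?thesis by (simp add: \<rho>_def)
      next
        assume "(inb p \<or> inc p) \<and> (inb q \<or> inc q)"
        then consider "inb p" "inb q" | "inb p" "inc q" | "inc p" "inb q" | "inc p" "inc q" by blast
        then show ?thesis
        proof cases
          case 1 then show ?thesis using half[of "snd p" "snd q"] bc(1) by (simp add: inb_def \<rho>_def)
        next
          case 2 then show ?thesis using diff(1)[of "snd p" "snd q"] bc(1) by (simp add: inb_def inc_def \<rho>_def)
        next
          case 3 then show ?thesis using diff(2)[of "snd q" "snd p"] bc(1) by (simp add: inb_def inc_def \<rho>_def)
        next
          case 4 then show ?thesis using half[of "snd p" "snd q"] bc(1) by (simp add: inc_def \<rho>_def)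
        qed
      qed
    qed
  qed (use valid sub sub' pos in auto)
  have "{(\<gamma> d, d) | d. d \<in> circles D'} = Id_on (circles D - {a}) \<union> {(a, b), (a, c)}"
    using bc by (auto simp: \<gamma>_def circ)
  then show ?thesis using transports_correspondence by simp
qed

section \<open>Planar isotopies\<close>

text \<open>
  Along the isotopy the Jacobian determinant keeps its sign, and it starts at the identity.
\<close>

lemma plane_isotopy_orientation:
  assumes "plane_isotopy H"
  shows "\<exists>A. (\<forall>z. (H 1 has_derivative A z) (at z)) \<and>
    (\<forall>z v w. sgn (plane_det (A z v) (A z w)) = sgn (plane_det v w))"
proof -
  obtain H' :: "real \<Rightarrow> complex \<Rightarrow> complex \<Rightarrow>\<^sub>L complex" where H0: "H 0 = id"
    and der: "\<And>s z. s \<in> {0..1} \<Longrightarrow> (H s has_derivative blinfun_apply (H' s z)) (at z)"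
    and bij: "\<And>s z. s \<in> {0..1} \<Longrightarrow> bij (blinfun_apply (H' s z))"
    and cont: "continuous_on ({0..1} \<times> UNIV) (\<lambda>(s, z). H' s z)"
    using assms unfolding plane_isotopy_def by blast
  define J where "J s z = plane_det (H' s z 1) (H' s z \<i>)" for s z
  have J: "sgn (J 1 z) = 1" for z
  proof -
    have "continuous_on {0..1} (\<lambda>s. (\<lambda>(s, z). H' s z) (s, z))"
      by (rule continuous_on_compose2[OF cont]) (auto intro!: continuous_intros)
    then have "continuous_on {0..1} (\<lambda>s. J s z)"
      unfolding J_def plane_det_def by (intro continuous_intros) auto
    moreover have "J s z \<noteq> 0" if "s \<in> {0..1}" for s
      unfolding J_def by (rule plane_det_bij_nonzero[OF blinfun.bounded_linear_right bij[OF that]])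
    ultimately have "sgn (J 0 z) = sgn (J 1 z)"
      by (intro sgn_constant_on_connected[of "{0..1::real}" "\<lambda>s. J s z"]) auto
    moreover have "blinfun_apply (H' 0 z) = id"
    proof (rule has_derivative_unique)
      show "(H 0 has_derivative blinfun_apply (H' 0 z)) (at z)" by (rule der) simp
      show "(H 0 has_derivative id) (at z)" unfolding H0 id_def by (rule has_derivative_ident)
    qed
    ultimately show ?thesis by (simp add: J_def plane_det_def)
  qed
  show ?thesis
  proof (intro exI conjI allI)
    show "(H 1 has_derivative blinfun_apply (H' 1 z)) (at z)" for z by (rule der) simp
    show "sgn (plane_det (H' 1 z v) (H' 1 z w)) = sgn (plane_det v w)" for z v w
      using plane_det_linear[OF blinfun.bounded_linear_right[of "H' 1 z"], of v w] J[of z]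
      by (simp add: J_def sgn_mult)
  qed
qed

text \<open>
  A lift of an orientation-preserving circle diffeomorphism is strictly increasing and commutes with integer
  translations, hence maps the intervals between consecutive translates of \<open>u\<close> to those of
  \<open>h u\<close>; therefore it is compatible with \<open>step\<close>.
\<close>

lemma circle_diffeo_props:
  assumes "circle_diffeo h"
  shows "h (t + of_int m) = h t + of_int m" "s < t \<Longrightarrow> h s < h t" "step (h t - h u) = step (t - u)"
    "\<exists>t. h t = y" "\<exists>d>0. (h has_real_derivative d) (at t)"
proof -
  have shift: "h (t + 1) = h t + 1" for t using assms by (simp add: circle_diffeo_def)
  have "(\<lambda>t. h t - t) (t + of_int m) = (\<lambda>t. h t - t) t" for t m
    by (rule periodic_int) (simp add: shift)
  then show add: "h (t + of_int m) = h t + of_int m" for t m by (simp add: algebra_simps)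
  show der: "\<exists>d>0. (h has_real_derivative d) (at t)" for t
  proof -
    obtain f where "\<And>x. (h has_vector_derivative f x) (at x)"
      using assms unfolding circle_diffeo_def C1_differentiable_on_def by auto
    moreover have "vector_derivative h (at t) > 0" using assms by (simp add: circle_diffeo_def)
    ultimately show ?thesis
      unfolding has_real_derivative_iff_has_vector_derivative by (metis vector_derivative_at)
  qed
  show mono: "h s < h t" if "s < t" for s t
    by (rule DERIV_pos_imp_increasing[OF that]) (use der in blast)
  show "step (h t - h u) = step (t - u)" for t u
  proof -
    define m where "m = \<lfloor>t - u\<rfloor>"
    have m: "of_int m \<le> t - u" "t - u < of_int m + 1" unfolding m_def by linarith+
    show ?thesis
    proof (cases "t - u = of_int m")
      case True
      then have "t = u + of_int m" by simp
      then have "h t - h u = of_int m" using add[of u m] by simp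
      then show ?thesis using True by simp
    next
      case False
      then have "u + of_int m < t" "t < u + of_int (m + 1)" using m by auto
      then have "h u + of_int m < h t" "h t < h u + of_int (m + 1)"
        using mono add[of u m] add[of u "m + 1"] by metis+
      then show ?thesis using step_between[of m "h t - h u"] step_between[of m "t - u"] m False by simp
    qed
  qed
  show "\<exists>t. h t = y"
  proof -
    define m where "m = \<lfloor>y - h 0\<rfloor>"
    have m: "of_int m \<le> y - h 0" "y - h 0 < of_int m + 1" unfolding m_def by linarith+
    have "h (of_int m) \<le> y" "y \<le> h (of_int (m + 1))"
      using add[of 0 m] add[of 0 "m + 1"] m by simp_all
    moreover have "continuous_on {of_int m..of_int (m + 1)} h"
      by (rule continuous_at_imp_continuous_on) (use der DERIV_isCont in blast)
    ultimately show ?thesis using IVT'[of h "of_int m" y "of_int (m + 1)"] by auto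
  qed
qed

lemma transports_isotopy:
  assumes valid: "virtual_link_diagram D" "virtual_link_diagram D'" and iso: "planar_isotopic \<pi> D D'"
  shows "transports D {(c, \<pi> c) | c. c \<in> circles D} D'"
proof -
  obtain H where \<pi>: "bij_betw \<pi> (circles D) (circles D')" and H: "plane_isotopy H"
    and ex: "\<forall>c\<in>circles D. \<exists>h. circle_diffeo h \<and>
        (\<forall>t. curve D' (\<pi> c) t = H 1 (curve D c (h t)) \<and> over D' (\<pi> c) t = over D c (h t))"
    using iso unfolding planar_isotopic_def by blast
  then obtain h where h: "\<And>c. c \<in> circles D \<Longrightarrow> circle_diffeo (h c)"
    and cur: "\<And>c t. c \<in> circles D \<Longrightarrow> curve D' (\<pi> c) t = H 1 (curve D c (h c t)) \<and> over D' (\<pi> c) t = over D c (h c t)"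
    by metis
  obtain A where derH: "\<And>z. (H 1 has_derivative A z) (at z)"
    and orient: "\<And>z v w. sgn (plane_det (A z v) (A z w)) = sgn (plane_det v w)"
    using plane_isotopy_orientation[OF H] by blast
  have injH: "H 1 z = H 1 w \<longleftrightarrow> z = w" for z w
    using H by (auto simp: plane_isotopy_def bij_def inj_eq)
  define \<gamma> where "\<gamma> = inv_into (circles D) \<pi>"
  have \<gamma>: "\<gamma> d \<in> circles D" "\<pi> (\<gamma> d) = d" if "d \<in> circles D'" for d
    using \<pi> that unfolding \<gamma>_def bij_betw_def by (auto simp: inv_into_into f_inv_into_f)
  have \<gamma>\<pi>: "\<gamma> (\<pi> c) = c" "\<pi> c \<in> circles D'" if "c \<in> circles D" for c
    using \<pi> that unfolding \<gamma>_def bij_betw_def by auto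
  define lft where "lft p = h (\<gamma> (fst p)) (snd p)" for p :: "nat \<times> real"
  define \<beta> where "\<beta> p = wrap (\<gamma> (fst p), lft p)" for p :: "nat \<times> real"
  have pos: "position D' p = H 1 (position D (\<beta> p))" "is_over D (\<beta> p) = is_over D' p"
    "\<exists>m>0. velocity D' p = A (position D (\<beta> p)) (m *\<^sub>R velocity D (\<beta> p))"
    if "p \<in> points D'" for p
  proof -
    obtain d t where dt: "p = (d, t)" by (cases p)
    have d: "d \<in> circles D'" using that dt by (simp add: points_def)
    define c where "c = \<gamma> d"
    have c: "c \<in> circles D" "d = \<pi> c" using \<gamma>[OF d] by (simp_all add: c_def)
    have \<beta>p: "\<beta> p = wrap (c, h c t)" by (simp add: \<beta>_def lft_def dt c_def)
    have inv: "position D (\<beta> p) = curve D c (h c t)" "is_over D (\<beta> p) = over D c (h c t)"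
      "velocity D (\<beta> p) = velocity D (c, h c t)"
      using wrap_invariant[OF valid(1), of "(c, h c t)"] c(1) by (simp_all add: \<beta>p position_def is_over_def)
    show "position D' p = H 1 (position D (\<beta> p))" "is_over D (\<beta> p) = is_over D' p"
      using cur[OF c(1), of t] unfolding inv by (simp_all add: dt c(2) position_def is_over_def)
    obtain m where m: "m > 0" "(h c has_real_derivative m) (at t)"
      using circle_diffeo_props(5)[OF h[OF c(1)]] by blast
    have "(curve D c \<circ> h c has_vector_derivative m *\<^sub>R velocity D (c, h c t)) (at t)"
      using m(2) curve_has_derivative[OF valid(1) c(1)]
      unfolding has_real_derivative_iff_has_vector_derivative by (rule vector_diff_chain_at)
    moreover have "(H 1 has_derivative A (position D (\<beta> p))) (at ((curve D c \<circ> h c) t) within X)" for X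
      using derH[of "position D (\<beta> p)"] unfolding inv by (simp add: has_derivative_at_withinI)
    ultimately have "(H 1 \<circ> (curve D c \<circ> h c) has_vector_derivative
        A (position D (\<beta> p)) (m *\<^sub>R velocity D (c, h c t))) (at t)"
      by (rule vector_derivative_diff_chain_within)
    moreover have "H 1 \<circ> (curve D c \<circ> h c) = curve D' d" using cur[OF c(1)] c(2) by auto
    ultimately have "velocity D' p = A (position D (\<beta> p)) (m *\<^sub>R velocity D (c, h c t))"
      by (simp add: velocity_def dt vector_derivative_at)
    then show "\<exists>m>0. velocity D' p = A (position D (\<beta> p)) (m *\<^sub>R velocity D (\<beta> p))"
      using m(1) inv(3) by auto
  qed
  have \<beta>_points: "\<beta> p \<in> points D" if "p \<in> points D'" for p
  proof -
    have "fst p \<in> circles D'" using that by (auto simp: points_def)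
    then show ?thesis using \<gamma>(1) by (simp add: \<beta>_def wrap_in_points)
  qed
  have inj\<beta>: "inj_on \<beta> (points D')"
  proof (rule inj_onI)
    fix p q assume p: "p \<in> points D'" and q: "q \<in> points D'" and eq: "\<beta> p = \<beta> q"
    obtain d t where dt: "p = (d, t)" by (cases p)
    obtain e u where eu: "q = (e, u)" by (cases q)
    have "\<gamma> d = \<gamma> e" "lft p - lft q \<in> \<int>" using eq by (simp_all add: \<beta>_def wrap_eq_iff dt eu)
    moreover have "d \<in> circles D'" "e \<in> circles D'" using p q by (simp_all add: dt eu points_def)
    ultimately have de: "d = e" using \<gamma>(2) by metis
    have c: "\<gamma> e \<in> circles D" using \<gamma>(1) \<open>e \<in> circles D'\<close> by blast
    have "h (\<gamma> e) t - h (\<gamma> e) u \<in> \<int>" using \<open>lft p - lft q \<in> \<int>\<close> by (simp add: lft_def dt eu de)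
    then obtain m :: int where "h (\<gamma> e) t - h (\<gamma> e) u = of_int m" by (rule Ints_cases)
    then have "h (\<gamma> e) t = h (\<gamma> e) (u + of_int m)"
      using circle_diffeo_props(1)[OF h[OF c], of u m] by simp
    then have "t = u + of_int m"
      using circle_diffeo_props(2)[OF h[OF c], of t "u + of_int m"] circle_diffeo_props(2)[OF h[OF c], of "u + of_int m" t]
      by linarith
    then have "wrap p = wrap q" by (simp add: dt eu de wrap_add_int)
    then show "p = q" using wrap_id p q by metis
  qed
  have surj\<beta>: "points D \<subseteq> \<beta> ` points D'"
  proof
    fix p assume p: "p \<in> points D"
    obtain c t where ct: "p = (c, t)" by (cases p)
    have c: "c \<in> circles D" using p by (simp add: ct points_def)
    obtain u where u: "h c u = t" using circle_diffeo_props(4)[OF h[OF c]] by blast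
    have "h c (frac u) = t - of_int \<lfloor>u\<rfloor>"
      using circle_diffeo_props(1)[OF h[OF c], of "frac u" "\<lfloor>u\<rfloor>"] u by (simp add: frac_def)
    then have "\<beta> (wrap (\<pi> c, u)) = wrap (c, t + of_int (- \<lfloor>u\<rfloor>))"
      by (simp add: \<beta>_def lft_def \<gamma>\<pi>[OF c])
    also have "\<dots> = p" unfolding wrap_add_int using wrap_id[OF p] ct by simp
    finally show "p \<in> \<beta> ` points D'"
      using \<gamma>\<pi>(2)[OF c] by (intro image_eqI[of _ _ "wrap (\<pi> c, u)"]) (simp_all add: wrap_in_points)
  qed
  \<comment> \<open>The correction arises because \<open>\<beta> q\<close> is recorded at the fractional part of \<open>lft q\<close>.\<close>
  interpret crossing_correspondence D D' \<beta> \<gamma> "points D" "points D'" "circles D'" lft "\<lambda>d q. 2 * \<lfloor>lft q\<rfloor>"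
  proof
    show "bij_betw \<beta> (points D') (points D)"
      using inj\<beta> surj\<beta> \<beta>_points by (auto simp: bij_betw_def)
    show "(\<beta> p, \<beta> q) \<in> double_points D \<longleftrightarrow> (p, q) \<in> double_points D'" if pq: "p \<in> points D'" "q \<in> points D'" for p q
    proof -
      have "\<beta> p = \<beta> q \<longleftrightarrow> p = q" using inj\<beta> pq by (auto dest: inj_onD)
      then show ?thesis using pos(1) pq \<beta>_points injH by (simp add: double_points_def)
    qed
    show "is_over D (\<beta> p) = is_over D' p" if "p \<in> points D'" for p using pos(2)[OF that] .
    show "crossing_sign D (\<beta> p) (\<beta> q) = crossing_sign D' p q" if dp: "(p, q) \<in> double_points D'" for p q
    proof -
      have pq: "p \<in> points D'" "q \<in> points D'" "position D' p = position D' q"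
        using dp unfolding double_points_def by simp_all
      have z: "position D (\<beta> q) = position D (\<beta> p)" using pq pos(1) injH by simp
      obtain m n where m: "m > 0" "velocity D' p = A (position D (\<beta> p)) (m *\<^sub>R velocity D (\<beta> p))"
        and n: "n > 0" "velocity D' q = A (position D (\<beta> p)) (n *\<^sub>R velocity D (\<beta> q))"
        using pos(3)[OF pq(1)] pos(3)[OF pq(2)] unfolding z by blast
      have "sgn (plane_det (velocity D' p) (velocity D' q)) =
          sgn (plane_det (m *\<^sub>R velocity D (\<beta> p)) (n *\<^sub>R velocity D (\<beta> q)))"
        unfolding m(2) n(2) by (rule orient)
      also have "plane_det (m *\<^sub>R velocity D (\<beta> p)) (n *\<^sub>R velocity D (\<beta> q)) =
          m * n * plane_det (velocity D (\<beta> p)) (velocity D (\<beta> q))"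
        by (simp add: plane_det_def algebra_simps)
      finally have "sgn (plane_det (velocity D' p) (velocity D' q)) = sgn (plane_det (velocity D (\<beta> p)) (velocity D (\<beta> q)))"
        using m(1) n(1) by (simp add: sgn_mult)
      then have "plane_det (velocity D' p) (velocity D' q) > 0 \<longleftrightarrow> plane_det (velocity D (\<beta> p)) (velocity D (\<beta> q)) > 0"
        by (metis sgn_greater)
      then show ?thesis by (simp add: crossing_sign_def)
    qed
    show "\<gamma> ` circles D' \<subseteq> circles D" using \<gamma>(1) by blast
    show "fst p \<in> circles D'" if "p \<in> points D'" for p using that by (auto simp: points_def)
    show "step (lft p - snd (\<beta> q)) = (if fst p = fst q then step (snd p - snd q) else 0) + 2 * \<lfloor>lft q\<rfloor>"
      if pq: "p \<in> points D'" "q \<in> points D'" and g: "\<gamma> (fst p) = \<gamma> (fst q)" for p q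
    proof -
      have d: "fst p \<in> circles D'" "fst q \<in> circles D'" using pq by (auto simp: points_def)
      then have eq: "fst p = fst q" using g \<gamma>(2) by metis
      have c: "\<gamma> (fst q) \<in> circles D" using \<gamma>(1) d by blast
      have "step (lft p - snd (\<beta> q)) = step (lft p - lft q) + 2 * \<lfloor>lft q\<rfloor>"
        by (simp add: \<beta>_def step_frac)
      also have "step (lft p - lft q) = step (snd p - snd q)"
        using circle_diffeo_props(3)[OF h[OF c]] by (simp add: lft_def eq)
      finally show ?thesis using eq by simp
    qed
  qed (use valid in \<open>auto simp: double_points_def \<beta>_def\<close>)
  have "{(\<gamma> d, d) | d. d \<in> circles D'} = {(c, \<pi> c) | c. c \<in> circles D}"
    using \<gamma> \<gamma>\<pi> by force
  then show ?thesis using transports_correspondence by simp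
qed

section \<open>Steps of a cobordism\<close>

lemma card_Id_on: "card (Id_on A) = card A"
proof -
  have "Id_on A = (\<lambda>c. (c, c)) ` A" by auto
  moreover have "inj_on (\<lambda>c. (c, c)) A" by (rule inj_onI) simp
  ultimately show ?thesis by (metis card_image)
qed

lemma reidemeister_circles:
  "reidemeister1 D D' \<Longrightarrow> circles D' = circles D"
  "reidemeister2 D D' \<Longrightarrow> circles D' = circles D"
  "reidemeister3 D D' \<Longrightarrow> circles D' = circles D"
  unfolding reidemeister1_def reidemeister2_def reidemeister3_def replaces_strands_def
  by (elim exE conjE, assumption)+

lemma reidemeister_step_transports:
  "reidemeister_step D T D' \<Longrightarrow> virtual_link_diagram D \<and> virtual_link_diagram D' \<and> transports D T D' \<and>
    card T = card (circles D) \<and> card (circles D') = card (circles D)"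
proof (induction rule: reidemeister_step.induct)
  case (isotopy D D' \<pi>)
  have "bij_betw \<pi> (circles D) (circles D')" using isotopy(3) by (simp add: planar_isotopic_def)
  then have "card (circles D') = card (circles D)" by (metis bij_betw_same_card)
  moreover have "card {(c, \<pi> c) | c. c \<in> circles D} = card (circles D)"
  proof -
    have "{(c, \<pi> c) | c. c \<in> circles D} = (\<lambda>c. (c, \<pi> c)) ` circles D" by auto
    moreover have "inj_on (\<lambda>c. (c, \<pi> c)) (circles D)" by (rule inj_onI) simp
    ultimately show ?thesis by (simp add: card_image)
  qed
  ultimately show ?case using isotopy(1,2) transports_isotopy[OF isotopy] by simp
next
  case (move D D')
  have "circles D' = circles D"
    using move(3) reidemeister_circles by blast
  moreover have "transports D (Id_on (circles D)) D'"
    using move(3) transports_reidemeister1[OF move(1,2)] transports_reidemeister2[OF move(1,2)]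
      transports_reidemeister3[OF move(1,2)] by blast
  ultimately show ?case using move(1,2) by (simp add: card_Id_on)
next
  case (inverse D T D')
  have "card (T\<inverse>) = card T" by (simp add: card_inverse)
  then show ?case using inverse transports_converse by simp
qed

text \<open>
  The contribution of a step to twice the Euler characteristic of the graph of circles, apart from that of
  the two ends: a vertex belongs half to the step before and half to the step after it.
\<close>

definition euler_change :: "step_kind \<Rightarrow> int" where
  "euler_change s = (case s of Reidemeister \<Rightarrow> 0 | Birth \<Rightarrow> 1 | Death \<Rightarrow> 1 | Saddle \<Rightarrow> -1)"

lemma saddle_cards:
  assumes "virtual_link_diagram D" "saddle_split a b c D D'"
  shows "card (circles D) = card (circles D - {a}) + 1" "card (circles D') = card (circles D - {a}) + 2"
    "card (Id_on (circles D - {a}) \<union> {(a, b), (a, c)}) = card (circles D - {a}) + 2"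
proof -
  let ?R = "circles D - {a}"
  have s: "a \<in> circles D" "b \<noteq> c" "b \<notin> ?R" "c \<notin> ?R" "circles D' = ?R \<union> {b, c}"
    using assms(2) unfolding saddle_split_def by blast+
  have fin: "finite ?R" "finite (circles D)" using valid_finite(2)[OF assms(1)] by simp_all
  show "card (circles D) = card ?R + 1" using card.remove[OF fin(2) s(1)] by simp
  have "card (?R \<union> {b, c}) = card ?R + card {b, c}" using fin s by (intro card_Un_disjoint) auto
  then show "card (circles D') = card ?R + 2" using s by simp
  have "card (Id_on ?R \<union> {(a, b), (a, c)}) = card (Id_on ?R) + card {(a, b), (a, c)}"
  proof (rule card_Un_disjoint)
    show "finite (Id_on ?R)" using finite_subset[of "Id_on ?R" "?R \<times> ?R"] fin by auto
  qed auto
  then show "card (Id_on ?R \<union> {(a, b), (a, c)}) = card ?R + 2" using s(2) by (simp add: card_Id_on)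
qed

lemma cobordism_step_transports:
  assumes "cobordism_step s D T D'"
  shows "virtual_link_diagram D \<and> virtual_link_diagram D' \<and> transports D T D' \<and>
    int (card (circles D)) + int (card (circles D')) - 2 * int (card T) = euler_change s"
  using assms
proof (cases rule: cobordism_step.cases)
  case reidemeister
  then show ?thesis using reidemeister_step_transports[of D T D'] by (simp add: euler_change_def)
next
  case (birth c)
  have "card (circles D') = card (circles D) + 1"
    using birth(5) valid_finite(2)[OF birth(3)] by (simp add: birth_def)
  then show ?thesis using birth transports_birth by (simp add: euler_change_def card_Id_on)
next
  case (death c)
  have "card (circles D) = card (circles D') + 1"
    using death(5) valid_finite(2)[OF death(4)] by (simp add: birth_def)
  moreover have "transports D (Id_on (circles D')) D'"
    using transports_converse[OF transports_birth[OF death(4,3,5)]] by simp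
  ultimately show ?thesis using death by (simp add: euler_change_def card_Id_on)
next
  case (split a b c)
  then show ?thesis using transports_saddle_split[OF split(3-5)] saddle_cards[OF split(3,5)]
    by (simp add: euler_change_def)
next
  case (merge a b c)
  have conv: "(Id_on (circles D' - {a}) \<union> {(a, b), (a, c)})\<inverse> = T" using merge(2) by auto
  then have "card T = card (Id_on (circles D' - {a}) \<union> {(a, b), (a, c)})" by (metis card_inverse)
  then show ?thesis using transports_converse[OF transports_saddle_split[OF merge(4,3,5)]] saddle_cards[OF merge(4,5)]
      merge(1,3,4) unfolding conv by (simp add: euler_change_def)
qed

section \<open>Knots\<close>

lemma knot_balanced:
  assumes "virtual_link_diagram D" "card (circles D) = 1" "c \<in> circles D"
  shows "monodromy D c = 0"
proof -
  have "circles D = {c}" using assms(2,3) by (metis card_1_singletonE singletonD)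
  then show ?thesis using sum_monodromy[OF assms(1)] by simp
qed

lemma knot_shifted:
  assumes "card (circles D) = 1"
  shows "index_writhe D (shifted D h) n = index_writhe D (numbering D) n"
proof -
  obtain c where c: "circles D = {c}" using assms by (metis card_1_singletonE)
  have "shifted D h (snd x) - shifted D h (fst x) = numbering D (snd x) - numbering D (fst x)"
    if "x \<in> classical D" for x
  proof -
    have "fst x \<in> points D" "snd x \<in> points D" using classical_in_points[of "fst x" "snd x" D] that by simp_all
    then have "fst (fst x) = c" "fst (snd x) = c" by (simp_all add: points_def mem_Times_iff c)
    then show ?thesis by (simp add: shifted_def)
  qed
  then show ?thesis unfolding local_writhe_def by (intro sum.cong) auto
qed

lemma knot_step:
  assumes step: "reidemeister_step D T D'" and knot: "card (circles D) = 1" and n: "n \<noteq> 0"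
  shows "index_writhe D (numbering D) n = index_writhe D' (numbering D') n"
proof -
  have D: "virtual_link_diagram D" "virtual_link_diagram D'" "transports D T D'" "card (circles D') = 1"
    using reidemeister_step_transports[OF step] knot by auto
  obtain c c' where c: "circles D = {c}" "circles D' = {c'}" using knot D(4) by (metis card_1_singletonE)
  have "balanced D" "balanced D'" using knot_balanced D knot by (auto simp: balanced_def)
  then have "\<exists>g. \<forall>h h'. (\<forall>(c, c')\<in>T. h' c' - h c = g (c, c')) \<longrightarrow>
      (\<forall>n. n \<noteq> 0 \<longrightarrow> index_writhe D (shifted D h) n = index_writhe D' (shifted D' h') n)"
    using D(3) unfolding transports_def by simp
  then obtain g where g: "\<And>h h'. (\<forall>(c, c')\<in>T. h' c' - h c = g (c, c')) \<Longrightarrow>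
      \<forall>n. n \<noteq> 0 \<longrightarrow> index_writhe D (shifted D h) n = index_writhe D' (shifted D' h') n" by blast
  have T: "T \<subseteq> circles D \<times> circles D'" using D(3) by (simp add: transports_def)
  have "\<forall>(e, e')\<in>T. (\<lambda>_. g (c, c')) e' - (\<lambda>_. 0) e = g (e, e')"
    using T unfolding c by auto
  from g[OF this] n
  have "index_writhe D (shifted D (\<lambda>_. 0)) n = index_writhe D' (shifted D' (\<lambda>_. g (c, c'))) n"
    by blast
  then show ?thesis using knot_shifted[OF knot] knot_shifted[OF D(4)] by simp
qed

lemma virtual_knot_invariant:
  assumes K: "K \<in> virtual_knots" and D: "D \<in> K" "D' \<in> K" and n: "n \<noteq> 0"
  shows "index_writhe D (numbering D) n = index_writhe D' (numbering D') n"
    and "virtual_link_diagram D" "card (circles D) = 1"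
proof -
  have "K \<in> {D. virtual_link_diagram D} // equivalent_diagrams" and knot: "\<And>D. D \<in> K \<Longrightarrow> card (circles D) = 1"
    using K by (auto simp: virtual_knots_def virtual_links_def)
  then obtain E where E: "virtual_link_diagram E" "K = equivalent_diagrams `` {E}"
    by (auto elim!: quotientE)
  have "E \<in> K" using E by (simp add: equivalent_diagrams_def)
  then have cE: "card (circles E) = 1" using knot by blast
  have path: "virtual_link_diagram F \<and> card (circles F) = 1 \<and>
      index_writhe E (numbering E) n = index_writhe F (numbering F) n"
    if "(\<lambda>E E'. \<exists>T. reidemeister_step E T E')\<^sup>*\<^sup>* E F" for F
    using that
  proof (induction rule: rtranclp_induct)
    case base
    then show ?case using E(1) cE by simp
  next
    case (step F F')
    then obtain T where T: "reidemeister_step F T F'" by blast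
    then show ?case using step.IH knot_step[OF T _ n] reidemeister_step_transports[OF T] by simp
  qed
  have "(\<lambda>E E'. \<exists>T. reidemeister_step E T E')\<^sup>*\<^sup>* E D" "(\<lambda>E E'. \<exists>T. reidemeister_step E T E')\<^sup>*\<^sup>* E D'"
    using D E(2) by (auto simp: equivalent_diagrams_def)
  from path[OF this(1)] path[OF this(2)]
  show "index_writhe D (numbering D) n = index_writhe D' (numbering D') n"
    "virtual_link_diagram D" "card (circles D) = 1" by simp_all
qed

section \<open>Invariance under concordance\<close>

lemma sum_euler_change:
  "(\<Sum>i<n. euler_change (k i)) =
    int (num_steps Birth n k) + int (num_steps Death n k) - int (num_steps Saddle n k)"
proof (induction n)
  case (Suc n)
  have "{i. i < Suc n \<and> k i = s} = (if k n = s then insert n {i. i < n \<and> k i = s} else {i. i < n \<and> k i = s})" for s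
    by (auto simp: less_Suc_eq)
  then have "num_steps s (Suc n) k = num_steps s n k + (if k n = s then 1 else 0)" for s
    by (simp add: num_steps_def)
  then show ?case using Suc by (cases "k n") (simp_all add: euler_change_def)
qed (simp add: num_steps_def)

text \<open>
  Genus zero makes the graph of circles a tree. Then the flows of the steps, being a circulation,
  vanish, all diagrams are balanced, and the constants of their numberings can be matched along all edges at
  once.
\<close>

lemma concordance_invariant:
  assumes cob: "cobordism n k D T K0 K1" and genus: "cobordism_genus n k = 0"
    and valid: "virtual_link_diagram (D 0)" "virtual_link_diagram (D n)"
    and knots: "card (circles (D 0)) = 1" "card (circles (D n)) = 1" and m: "m \<noteq> 0"
  shows "index_writhe (D 0) (numbering (D 0)) m = index_writhe (D n) (numbering (D n)) m"
proof -
  have steps: "\<And>i. i < n \<Longrightarrow> cobordism_step (k i) (D i) (T i) (D (Suc i))"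
    and conn: "surface_connected n D T" using cob by (auto simp: cobordism_def)
  note step = cobordism_step_transports[OF steps]
  have vD: "virtual_link_diagram (D i)" if "i \<le> n" for i
    using step[of i] valid(2) that by (cases "i = n") auto
  let ?V = "surface_vertices n D" and ?E = "surface_edges n T"
  have Tsub: "T i \<subseteq> circles (D i) \<times> circles (D (Suc i))" if "i < n" for i
    using step[OF that] by (simp add: transports_def)
  have finT: "finite (T i)" if "i < n" for i
    by (rule finite_subset[OF Tsub[OF that]]) (use valid_finite(2) vD that in auto)
  have V: "?V = (SIGMA i:{..n}. circles (D i))" by (auto simp: surface_vertices_def)
  have finV: "finite ?V" unfolding V using valid_finite(2) vD by auto
  have cardV: "card ?V = (\<Sum>i\<le>n. card (circles (D i)))"
    unfolding V using valid_finite(2) vD by (intro card_SigmaI) auto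
  define ed where "ed = (\<lambda>(i, c, c'). ((i, c), (Suc i, c')) :: (nat \<times> nat) \<times> (nat \<times> nat))"
  have E: "?E = ed ` (SIGMA i:{..<n}. T i)" by (force simp: surface_edges_def ed_def)
  have inj_ed: "inj ed" by (rule injI) (auto simp: ed_def)
  have "card ?E = card (SIGMA i:{..<n}. T i)" unfolding E by (rule card_image) (rule inj_on_subset[OF inj_ed], simp)
  then have cardE: "card ?E = (\<Sum>i<n. card (T i))" using finT by (simp add: card_SigmaI)
  have EV: "?E \<subseteq> ?V \<times> ?V"
    using Tsub by (fastforce simp: surface_edges_def surface_vertices_def)
  have conn': "\<forall>v\<in>?V. \<forall>w\<in>?V. (v, w) \<in> (?E \<union> ?E\<inverse>)\<^sup>*"
    using conn by (simp add: surface_connected_def)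
  \<comment> \<open>Counting circles once for the step before and once for the step after, everything but the two ends
    is accounted for by the steps, whose contributions add up to minus twice the genus.\<close>
  have card: "card ?V = card ?E + 1"
  proof -
    let ?m = "\<lambda>i. int (card (circles (D i)))"
    have "(\<Sum>i<n. ?m i + ?m (Suc i) - 2 * int (card (T i))) = (\<Sum>i<n. euler_change (k i))"
      by (rule sum.cong) (use step in auto)
    also have "\<dots> = 0" using genus by (simp add: sum_euler_change cobordism_genus_def)
    finally have zero: "(\<Sum>i<n. ?m i) + (\<Sum>i<n. ?m (Suc i)) - 2 * (\<Sum>i<n. int (card (T i))) = 0"
      by (simp add: sum.distrib sum_subtractf sum_distrib_left)
    have "(\<Sum>i\<le>n. ?m i) = (\<Sum>i<n. ?m i) + ?m n" "(\<Sum>i\<le>n. ?m i) = ?m 0 + (\<Sum>i<n. ?m (Suc i))"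
      unfolding lessThan_Suc_atMost[symmetric] by (rule sum.lessThan_Suc, rule sum.lessThan_Suc_shift)
    moreover note knots
    ultimately have "2 * int (card ?V) = 2 * int (card ?E) + 2" unfolding cardV cardE using zero by simp
    then show ?thesis by linarith
  qed
  have sum_edges_from: "(\<Sum>e | e \<in> ?E \<and> fst e = (i, c). F e) = (if i < n then \<Sum>e | e \<in> T i \<and> fst e = c. F (ed (i, e)) else 0)"
    for F :: "_ \<Rightarrow> int" and i c
  proof -
    have eq: "{e. e \<in> ?E \<and> fst e = (i, c)} = (if i < n then (\<lambda>e. ed (i, e)) ` {e. e \<in> T i \<and> fst e = c} else {})"
      unfolding E by (force simp: ed_def)
    have "inj_on (\<lambda>e. ed (i, e)) X" for X by (rule inj_onI) (use inj_ed in \<open>auto dest: injD\<close>)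
    then show ?thesis unfolding eq by (simp add: sum.reindex)
  qed
  have sum_edges_to: "(\<Sum>e | e \<in> ?E \<and> snd e = (j, c). F e) =
      (case j of 0 \<Rightarrow> 0 | Suc i \<Rightarrow> if i < n then \<Sum>e | e \<in> T i \<and> snd e = c. F (ed (i, e)) else 0)"
    for F :: "_ \<Rightarrow> int" and j c
  proof (cases j)
    case 0
    have eq: "{e. e \<in> ?E \<and> snd e = (j, c)} = {}" unfolding E 0 by (auto simp: ed_def)
    show ?thesis unfolding eq by (simp add: 0)
  next
    case (Suc i)
    have eq: "{e. e \<in> ?E \<and> snd e = (j, c)} = (if i < n then (\<lambda>e. ed (i, e)) ` {e. e \<in> T i \<and> snd e = c} else {})"
      unfolding E Suc by (force simp: ed_def)
    have "inj_on (\<lambda>e. ed (i, e)) X" for X by (rule inj_onI) (use inj_ed in \<open>auto dest: injD\<close>)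
    then show ?thesis unfolding eq by (simp add: sum.reindex Suc)
  qed
  have "\<forall>i. \<exists>f :: nat \<times> nat \<Rightarrow> int. i < n \<longrightarrow>
      (\<forall>c\<in>circles (D i). (\<Sum>e | e \<in> T i \<and> fst e = c. f e) = monodromy (D i) c) \<and>
      (\<forall>c\<in>circles (D (Suc i)). (\<Sum>e | e \<in> T i \<and> snd e = c. f e) = monodromy (D (Suc i)) c)"
    using step unfolding transports_def by meson
  from choice[OF this] obtain f :: "nat \<Rightarrow> nat \<times> nat \<Rightarrow> int" where f: "\<forall>i. i < n \<longrightarrow>
      (\<forall>c\<in>circles (D i). (\<Sum>e | e \<in> T i \<and> fst e = c. f i e) = monodromy (D i) c) \<and>
      (\<forall>c\<in>circles (D (Suc i)). (\<Sum>e | e \<in> T i \<and> snd e = c. f i e) = monodromy (D (Suc i)) c)"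
    by (elim exE)
  have f_from: "(\<Sum>e | e \<in> T i \<and> fst e = c. f i e) = monodromy (D i) c" if "i < n" "c \<in> circles (D i)" for i c
    using f that by simp
  have f_to: "(\<Sum>e | e \<in> T i \<and> snd e = c. f i e) = monodromy (D (Suc i)) c" if "i < n" "c \<in> circles (D (Suc i))" for i c
    using f that by simp
  define F where "F = (\<lambda>((i, c), (j :: nat, c')). f i (c, c') :: int)"
  have F_ed: "F (ed (i, e)) = f i e" for i e by (cases e) (simp add: F_def ed_def)
  have F0: "F e = 0" if "e \<in> ?E" for e
  proof (rule circulation_on_tree[OF finV EV conn' card _ that])
    fix v assume "v \<in> ?V"
    then obtain i c where v: "v = (i, c)" "i \<le> n" "c \<in> circles (D i)" by (auto simp: surface_vertices_def)
    have "(\<Sum>e | e \<in> ?E \<and> fst e = v. F e) = monodromy (D i) c"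
      unfolding v(1) sum_edges_from F_ed using f_from v knot_balanced[OF valid(2) knots(2)] by (cases "i = n") auto
    moreover have "(\<Sum>e | e \<in> ?E \<and> snd e = v. F e) = monodromy (D i) c"
      unfolding v(1) sum_edges_to F_ed using f_to v knot_balanced[OF valid(1) knots(1)] by (cases i) auto
    ultimately show "(\<Sum>e | e \<in> ?E \<and> snd e = v. F e) = (\<Sum>e | e \<in> ?E \<and> fst e = v. F e)" by simp
  qed
  have bal: "balanced (D i)" if "i \<le> n" for i
    unfolding balanced_def
  proof
    fix c assume c: "c \<in> circles (D i)"
    show "monodromy (D i) c = 0"
    proof (cases "i = n")
      case True
      then show ?thesis using knot_balanced[OF valid(2) knots(2)] c by simp
    next
      case False
      then have i: "i < n" using that by simp
      have "f i e = 0" if "e \<in> T i" for e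
        using F0[of "ed (i, e)"] that i F_ed unfolding E by auto
      then show ?thesis using f_from[OF i c] by simp
    qed
  qed
  have "\<forall>i. \<exists>g. i < n \<longrightarrow> (\<forall>h h'. (\<forall>(c, c')\<in>T i. h' c' - h c = g (c, c')) \<longrightarrow>
      index_writhe (D i) (shifted (D i) h) m = index_writhe (D (Suc i)) (shifted (D (Suc i)) h') m)"
  proof
    fix i
    show "\<exists>g. i < n \<longrightarrow> (\<forall>h h'. (\<forall>(c, c')\<in>T i. h' c' - h c = g (c, c')) \<longrightarrow>
      index_writhe (D i) (shifted (D i) h) m = index_writhe (D (Suc i)) (shifted (D (Suc i)) h') m)"
    proof (cases "i < n")
      case True
      then have "balanced (D i) \<and> balanced (D (Suc i))" using bal by simp
      then obtain g where g0: "\<forall>h h'. (\<forall>(c, c')\<in>T i. h' c' - h c = g (c, c')) \<longrightarrow>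
        (\<forall>m. m \<noteq> 0 \<longrightarrow> index_writhe (D i) (shifted (D i) h) m = index_writhe (D (Suc i)) (shifted (D (Suc i)) h') m)"
        using step[OF True] unfolding transports_def by auto
      show ?thesis
      proof (intro exI[of _ g] impI allI)
        fix h h' assume "\<forall>(c, c')\<in>T i. h' c' - h c = g (c, c')"
        from mp[OF spec[OF mp[OF spec[OF spec[OF g0]] this]] m]
        show "index_writhe (D i) (shifted (D i) h) m = index_writhe (D (Suc i)) (shifted (D (Suc i)) h') m" .
      qed
    qed simp
  qed
  from choice[OF this] obtain g where g': "\<forall>i. i < n \<longrightarrow> (\<forall>h h'. (\<forall>(c, c')\<in>T i. h' c' - h c = g i (c, c')) \<longrightarrow>
      index_writhe (D i) (shifted (D i) h) m = index_writhe (D (Suc i)) (shifted (D (Suc i)) h') m)"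
    by (elim exE)
  have g: "index_writhe (D i) (shifted (D i) h) m = index_writhe (D (Suc i)) (shifted (D (Suc i)) h') m"
    if "i < n" "\<forall>(c, c')\<in>T i. h' c' - h c = g i (c, c')" for i h h'
    using g' that by blast
  define G where "G = (\<lambda>((i, c), (j :: nat, c')). g i (c, c') :: int)"
  obtain h where h: "\<forall>(v, w)\<in>?E. h w - h v = G (v, w)"
    using potential_on_tree[OF finV EV conn' card] by blast
  have "index_writhe (D 0) (shifted (D 0) (\<lambda>c. h (0, c))) m = index_writhe (D i) (shifted (D i) (\<lambda>c. h (i, c))) m"
    if "i \<le> n" for i
    using that
  proof (induction i)
    case (Suc i)
    have "\<forall>(c, c')\<in>T i. h (Suc i, c') - h (i, c) = g i (c, c')"
    proof clarify
      fix c c' assume "(c, c') \<in> T i"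
      then have "((i, c), (Suc i, c')) \<in> ?E" using Suc.prems by (auto simp: surface_edges_def)
      then have "h (Suc i, c') - h (i, c) = G ((i, c), (Suc i, c'))" using h by blast
      then show "h (Suc i, c') - h (i, c) = g i (c, c')" by (simp add: G_def)
    qed
    then show ?case using g[of i "\<lambda>c. h (Suc i, c)" "\<lambda>c. h (i, c)"] Suc by simp
  qed simp
  from this[of n] show ?thesis using knot_shifted knots by simp
qed

section \<open>The index of a chord\<close>

lemma step_difference:
  assumes "s \<in> {0..<1}" "t \<in> {0..<1}" "u \<in> {0..<1}" "s \<noteq> t"
  shows "step (t - u) - step (s - u) =
    2 * of_bool (u \<in> ccw_arc s t) + of_bool (u = s) + of_bool (u = t) - 2 * of_bool (t < s)"
proof -
  have st: "step (x - u) = (if u < x then 1 else if u = x then 0 else -1)" if "x \<in> {0..<1}" for x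
    using step_between[of 0 "x - u"] step_between[of "-1" "x - u"] that assms(3) by auto
  show ?thesis unfolding st[OF assms(1)] st[OF assms(2)] using assms by (auto simp: ccw_arc_def)
qed

lemma ccw_arc_partition:
  assumes "s \<in> {0..<1}" "t \<in> {0..<1}" "u \<in> {0..<1}" "s \<noteq> t"
  shows "u \<in> ccw_arc t s \<longleftrightarrow> u \<notin> ccw_arc s t \<and> u \<noteq> s \<and> u \<noteq> t"
  using assms by (auto simp: ccw_arc_def)

lemma int_card_eq_sum: "finite A \<Longrightarrow> int (card {x \<in> A. P x}) = (\<Sum>x\<in>A. of_bool (P x))"
  by (simp add: of_bool_def sum.inter_filter[symmetric])

locale knot_diagram =
  fixes D :: diagram and c :: nat
  assumes valid: "virtual_link_diagram D" and circle: "circles D = {c}"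
begin

definition arrows :: "(real \<times> real) set" where
  "arrows = {(s, t). ((c, s), (c, t)) \<in> double_points D \<and> over D c s}"

definition chord_of :: "real \<times> real \<Rightarrow> chord" where
  "chord_of = (\<lambda>(s, t). \<lparr>tail = s, head = t, sign = crossing_sign D (c, s) (c, t)\<rparr>)"

lemma gauss_diagram_eq: "gauss_diagram D = chord_of ` arrows"
proof -
  have "d = c" if "((d, s), (d, t)) \<in> double_points D" for d s t
    using double_points_in_points[OF that] circle by (simp add: points_def)
  note circle_c = this
  show ?thesis
  proof (intro set_eqI iffI)
    fix x assume "x \<in> gauss_diagram D"
    then obtain d s t where x: "x = \<lparr>tail = s, head = t, sign = crossing_sign D (d, s) (d, t)\<rparr>"
      "((d, s), (d, t)) \<in> double_points D" "over D d s"
      unfolding gauss_diagram_def by blast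
    then have "(s, t) \<in> arrows" "x = chord_of (s, t)"
      using circle_c[OF x(2)] by (simp_all add: arrows_def chord_of_def)
    then show "x \<in> chord_of ` arrows" by blast
  next
    fix x assume "x \<in> chord_of ` arrows"
    then obtain s t where "(s, t) \<in> arrows" "x = chord_of (s, t)" by auto
    then show "x \<in> gauss_diagram D"
      unfolding gauss_diagram_def by (auto simp: arrows_def chord_of_def)
  qed
qed

lemma inj_chord_of: "inj_on chord_of arrows"
  by (rule inj_onI) (auto simp: chord_of_def)

lemma arrow_ends:
  assumes "(s, t) \<in> arrows"
  shows "s \<in> {0..<1}" "t \<in> {0..<1}" "s \<noteq> t" "over D c s" "\<not> over D c t" "((c, s), (c, t)) \<in> double_points D"
proof -
  show dp: "((c, s), (c, t)) \<in> double_points D" and o: "over D c s" using assms by (auto simp: arrows_def)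
  then show "s \<in> {0..<1}" "t \<in> {0..<1}" "s \<noteq> t" by (auto simp: double_points_def points_def)
  show "\<not> over D c t" using valid_not_both_over[OF valid dp] o by (simp add: is_over_def)
qed

text \<open>
  No two chords share an end, since the diagram has no points of multiplicity three.
\<close>

lemma arrow_unique:
  assumes "(s, t) \<in> arrows" "(u, v) \<in> arrows"
  shows "u = s \<longleftrightarrow> v = t" "u \<noteq> t" "v \<noteq> s"
proof -
  note a = arrow_ends[OF assms(1)] and b = arrow_ends[OF assms(2)]
  show "u \<noteq> t" "v \<noteq> s" using a b by auto
  have "v = t" if "u = s" using valid_unique[OF valid a(6), of "(c, v)"] b(6) that by simp
  moreover have "u = s" if "v = t"
    using valid_unique[OF valid double_points_sym[OF a(6)], of "(c, u)"] double_points_sym[OF b(6)] that by simp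
  ultimately show "u = s \<longleftrightarrow> v = t" by blast
qed

lemma finite_arrows: "finite arrows"
proof -
  have "arrows \<subseteq> (\<lambda>(p, q). (snd p, snd q)) ` double_points D"
    by (force simp: arrows_def)
  then show ?thesis using valid_finite(1)[OF valid] finite_surj by blast
qed

lemma classical_eq:
  "classical D = (\<lambda>(s, t). ((c, s), (c, t))) ` arrows \<union> (\<lambda>(s, t). ((c, t), (c, s))) ` arrows"
proof (intro set_eqI iffI)
  fix x assume x: "x \<in> classical D"
  obtain p q where pq: "x = (p, q)" by (cases x)
  have "p \<in> points D" "q \<in> points D" using classical_in_points x pq by blast+
  then obtain s t where st: "p = (c, s)" "q = (c, t)" using circle by (cases p; cases q) (simp add: points_def)
  have "((c, s), (c, t)) \<in> double_points D" "over D c s \<or> over D c t"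
    using x by (simp_all add: classical_def pq st is_over_def)
  then have "(s, t) \<in> arrows \<or> (t, s) \<in> arrows" using double_points_sym by (auto simp: arrows_def)
  then show "x \<in> (\<lambda>(s, t). ((c, s), (c, t))) ` arrows \<union> (\<lambda>(s, t). ((c, t), (c, s))) ` arrows"
    unfolding pq st by force
next
  fix x assume "x \<in> (\<lambda>(s, t). ((c, s), (c, t))) ` arrows \<union> (\<lambda>(s, t). ((c, t), (c, s))) ` arrows"
  then obtain s t where st: "(s, t) \<in> arrows" "x = ((c, s), (c, t)) \<or> x = ((c, t), (c, s))" by auto
  have "((c, s), (c, t)) \<in> classical D"
    using arrow_ends[OF st(1)] by (simp add: classical_def is_over_def)
  then show "x \<in> classical D" using st(2) classical_sym by auto
qed

lemma weigh_arrows: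
  "weigh D \<kappa> c = (\<Sum>(s, t)\<in>arrows. crossing_sign D (c, s) (c, t) * (\<kappa> s - \<kappa> t))"
proof -
  have all: "{x. x \<in> classical D \<and> fst (fst x) = c} = classical D" unfolding classical_eq by auto
  have inj: "inj_on (\<lambda>(s, t). ((c, s), (c, t))) arrows" "inj_on (\<lambda>(s, t). ((c, t), (c, s))) arrows"
    by (auto simp: inj_on_def)
  have disj: "(\<lambda>(s, t). ((c, s), (c, t))) ` arrows \<inter> (\<lambda>(s, t). ((c, t), (c, s))) ` arrows = {}"
    using arrow_unique(2) by fastforce
  have split: "sum F ((\<lambda>(s, t). ((c, s), (c, t))) ` arrows \<union> (\<lambda>(s, t). ((c, t), (c, s))) ` arrows) =
      (\<Sum>(s, t)\<in>arrows. F ((c, s), (c, t))) + (\<Sum>(s, t)\<in>arrows. F ((c, t), (c, s)))"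
    for F :: "_ \<Rightarrow> int"
    unfolding sum.union_disjoint[OF finite_imageI[OF finite_arrows] finite_imageI[OF finite_arrows] disj]
      sum.reindex[OF inj(1)] sum.reindex[OF inj(2)] by (simp add: case_prod_unfold)
  have "weigh D \<kappa> c = (\<Sum>(s, t)\<in>arrows. weight D ((c, s), (c, t)) * \<kappa> s) +
      (\<Sum>(s, t)\<in>arrows. weight D ((c, t), (c, s)) * \<kappa> t)"
    unfolding local_weigh_def all unfolding classical_eq split by simp
  also have "\<dots> = (\<Sum>(s, t)\<in>arrows. crossing_sign D (c, s) (c, t) * (\<kappa> s - \<kappa> t))"
    unfolding sum.distrib[symmetric]
  proof (rule sum.cong[OF refl], clarify)
    fix s t assume "(s, t) \<in> arrows"
    then have "crossing_sign D (c, t) (c, s) = - crossing_sign D (c, s) (c, t)"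
      using crossing_sign_swap[OF valid] arrow_ends(6) by blast
    then show "weight D ((c, s), (c, t)) * \<kappa> s + weight D ((c, t), (c, s)) * \<kappa> t =
        crossing_sign D (c, s) (c, t) * (\<kappa> s - \<kappa> t)"
      by (simp add: weight_def algebra_simps)
  qed
  finally show ?thesis .
qed

text \<open>
  From tail to head, the number changes at the passages on the arc in between. The ends of the chord
  itself contribute half a jump each, in opposite directions.
\<close>

lemma numbering_jump:
  assumes st: "(s, t) \<in> arrows"
  shows "numbering D (c, t) - numbering D (c, s) =
    2 * (\<Sum>(u, v)\<in>arrows. crossing_sign D (c, u) (c, v) * (of_bool (u \<in> ccw_arc s t) - of_bool (v \<in> ccw_arc s t)))"
proof -
  note S = arrow_ends[OF st]
  have "numbering D (c, t) - numbering D (c, s) =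
    (\<Sum>(u, v)\<in>arrows. crossing_sign D (c, u) (c, v) * ((step (t - u) - step (t - v)) - (step (s - u) - step (s - v))))"
    unfolding numbering_def fst_conv snd_conv weigh_arrows sum_subtractf[symmetric]
    by (rule sum.cong) (auto simp: algebra_simps)
  also have "\<dots> = (\<Sum>(u, v)\<in>arrows. 2 * (crossing_sign D (c, u) (c, v) * (of_bool (u \<in> ccw_arc s t) - of_bool (v \<in> ccw_arc s t))))"
  proof (rule sum.cong[OF refl], clarify)
    fix u v assume uv: "(u, v) \<in> arrows"
    note U = arrow_ends[OF uv] and A = arrow_unique[OF st uv]
    have "(step (t - u) - step (s - u)) - (step (t - v) - step (s - v)) =
        2 * (of_bool (u \<in> ccw_arc s t) - of_bool (v \<in> ccw_arc s t))"
      unfolding step_difference[OF S(1,2) U(1) S(3)] step_difference[OF S(1,2) U(2) S(3)]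
      using A by (auto simp: of_bool_def)
    then have eq: "(step (t - u) - step (t - v)) - (step (s - u) - step (s - v)) =
        2 * (of_bool (u \<in> ccw_arc s t) - of_bool (v \<in> ccw_arc s t))" by linarith
    show "crossing_sign D (c, u) (c, v) * ((step (t - u) - step (t - v)) - (step (s - u) - step (s - v))) =
        2 * (crossing_sign D (c, u) (c, v) * (of_bool (u \<in> ccw_arc s t) - of_bool (v \<in> ccw_arc s t)))"
      unfolding eq by simp
  qed
  finally show ?thesis by (simp add: sum_distrib_left case_prod_unfold)
qed

text \<open>
  Chords with both ends on the left of the given one contribute twice with opposite signs; the others with an end
  on the left are the chords counted by the index.
\<close>

lemma ind_eq_numbering:
  assumes st: "(s, t) \<in> arrows"
  shows "numbering D (c, t) - numbering D (c, s) = 2 * ind (gauss_diagram D) (chord_of (s, t))"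
proof -
  note S = arrow_ends[OF st]
  let ?G = "gauss_diagram D" and ?x = "chord_of (s, t)"
  let ?L = "ccw_arc s t" and ?R = "ccw_arc t s"
  have fin: "finite ?G" unfolding gauss_diagram_eq using finite_arrows by simp
  have "ind ?G ?x = (\<Sum>y\<in>?G. of_bool (sign y = 1 \<and> tail y \<in> ?L \<and> head y \<in> ?R)
      - of_bool (sign y = -1 \<and> tail y \<in> ?L \<and> head y \<in> ?R)
      - of_bool (sign y = 1 \<and> tail y \<in> ?R \<and> head y \<in> ?L)
      + of_bool (sign y = -1 \<and> tail y \<in> ?R \<and> head y \<in> ?L))"
    unfolding ind_def left_to_right_def right_to_left_def int_card_eq_sum[OF fin]
    by (simp add: sum.distrib sum_subtractf left_of_def right_of_def chord_of_def)
  also have "\<dots> = (\<Sum>y\<in>arrows. of_bool (sign (chord_of y) = 1 \<and> tail (chord_of y) \<in> ?L \<and> head (chord_of y) \<in> ?R)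
      - of_bool (sign (chord_of y) = -1 \<and> tail (chord_of y) \<in> ?L \<and> head (chord_of y) \<in> ?R)
      - of_bool (sign (chord_of y) = 1 \<and> tail (chord_of y) \<in> ?R \<and> head (chord_of y) \<in> ?L)
      + of_bool (sign (chord_of y) = -1 \<and> tail (chord_of y) \<in> ?R \<and> head (chord_of y) \<in> ?L))"
    unfolding gauss_diagram_eq sum.reindex[OF inj_chord_of] by simp
  also have "\<dots> = (\<Sum>(u, v)\<in>arrows. crossing_sign D (c, u) (c, v) * (of_bool (u \<in> ?L) - of_bool (v \<in> ?L)))"
  proof (rule sum.cong[OF refl])
    fix y assume y: "y \<in> arrows"
    obtain u v where uv: "y = (u, v)" by (cases y)
    note U = arrow_ends[OF y[unfolded uv]] and A = arrow_unique[OF st y[unfolded uv]]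
    have R: "u \<in> ?R \<longleftrightarrow> u \<notin> ?L \<and> u \<noteq> s" "v \<in> ?R \<longleftrightarrow> v \<notin> ?L \<and> v \<noteq> t"
      using ccw_arc_partition[OF S(1,2) U(1) S(3)] ccw_arc_partition[OF S(1,2) U(2) S(3)] A by auto
    have ends: "s \<notin> ?L" "t \<notin> ?L" using S by (auto simp: ccw_arc_def)
    have sg: "crossing_sign D (c, u) (c, v) = 1 \<or> crossing_sign D (c, u) (c, v) = -1"
      by (simp add: crossing_sign_def)
    show "of_bool (sign (chord_of y) = 1 \<and> tail (chord_of y) \<in> ?L \<and> head (chord_of y) \<in> ?R)
      - of_bool (sign (chord_of y) = -1 \<and> tail (chord_of y) \<in> ?L \<and> head (chord_of y) \<in> ?R)
      - of_bool (sign (chord_of y) = 1 \<and> tail (chord_of y) \<in> ?R \<and> head (chord_of y) \<in> ?L)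
      + of_bool (sign (chord_of y) = -1 \<and> tail (chord_of y) \<in> ?R \<and> head (chord_of y) \<in> ?L) =
      (case y of (u, v) \<Rightarrow> crossing_sign D (c, u) (c, v) * (of_bool (u \<in> ?L) - of_bool (v \<in> ?L)))"
      using sg R ends A(1) by (cases "u = s") (auto simp: uv chord_of_def)
  qed
  finally show ?thesis using numbering_jump[OF st] by simp
qed

lemma index_writhe_eq:
  "index_writhe D (numbering D) n = (\<Sum>x | x \<in> gauss_diagram D \<and> ind (gauss_diagram D) x = n. sign x)"
proof -
  let ?G = "gauss_diagram D"
  have 1: "{x. x \<in> classical D \<and> is_over D (fst x) \<and> numbering D (snd x) - numbering D (fst x) = 2 * n} =
      (\<lambda>(s, t). ((c, s), (c, t))) ` {y. y \<in> arrows \<and> ind ?G (chord_of y) = n}" (is "?A = ?B")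
  proof (intro set_eqI iffI)
    fix x assume x: "x \<in> ?A"
    then obtain s t where st: "(s, t) \<in> arrows" "x = ((c, s), (c, t)) \<or> x = ((c, t), (c, s))"
      unfolding classical_eq by auto
    have "x = ((c, s), (c, t))" using st x arrow_ends(5)[OF st(1)] by (auto simp: is_over_def)
    then show "x \<in> ?B" using x st(1) ind_eq_numbering[OF st(1)] by force
  next
    fix x assume "x \<in> ?B"
    then obtain s t where st: "(s, t) \<in> arrows" "ind ?G (chord_of (s, t)) = n" "x = ((c, s), (c, t))" by auto
    then show "x \<in> ?A"
      using ind_eq_numbering[OF st(1)] arrow_ends(4)[OF st(1)] unfolding classical_eq by (auto simp: is_over_def)
  qed
  have 2: "{x. x \<in> ?G \<and> ind ?G x = n} = chord_of ` {y. y \<in> arrows \<and> ind ?G (chord_of y) = n}"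
    unfolding gauss_diagram_eq by auto
  have inj: "inj_on (\<lambda>(s, t). ((c, s), (c, t))) X" for X :: "(real \<times> real) set" by (auto simp: inj_on_def)
  have inj': "inj_on chord_of {y. y \<in> arrows \<and> ind ?G (chord_of y) = n}"
    using inj_chord_of by (rule inj_on_subset) auto
  show ?thesis unfolding local_writhe_def 1 2 sum.reindex[OF inj] sum.reindex[OF inj']
    by (rule sum.cong) (auto simp: weight_def chord_of_def)
qed

lemma finite_gauss_diagram: "finite (gauss_diagram D)"
  unfolding gauss_diagram_eq using finite_arrows by simp

end

section \<open>The three invariants\<close>

text \<open>
  Any expression that weighs the signs of the chords by a function of their non-zero index is determined by
  the sums of signs for each index. All three invariants are of this form, odd indices being non-zero.
\<close>

lemma sum_by_index:
  fixes F :: "int \<Rightarrow> 'a::comm_ring_1"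
  assumes fin: "finite G" "finite G'"
    and eq: "\<And>n. n \<noteq> 0 \<Longrightarrow> (\<Sum>x | x \<in> G \<and> ind G x = n. sign x) = (\<Sum>x | x \<in> G' \<and> ind G' x = n. sign x)"
  shows "(\<Sum>x | x \<in> G \<and> ind G x \<noteq> 0. of_int (sign x) * F (ind G x)) =
    (\<Sum>x | x \<in> G' \<and> ind G' x \<noteq> 0. of_int (sign x) * F (ind G' x))"
proof -
  define N where "N = (ind G ` G \<union> ind G' ` G') - {0}"
  have finN: "finite N" using fin by (simp add: N_def)
  have group: "(\<Sum>x | x \<in> H \<and> ind H x \<noteq> 0. of_int (sign x) * F (ind H x)) =
      (\<Sum>n\<in>N. of_int (\<Sum>x | x \<in> H \<and> ind H x = n. sign x) * F n)"
    if H: "finite H" "ind H ` H - {0} \<subseteq> N" for H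
  proof -
    have "(\<Sum>x | x \<in> H \<and> ind H x \<noteq> 0. of_int (sign x) * F (ind H x)) =
      (\<Sum>n\<in>N. \<Sum>x | x \<in> {x. x \<in> H \<and> ind H x \<noteq> 0} \<and> ind H x = n. of_int (sign x) * F (ind H x))"
      by (rule sum.group[symmetric]) (use H finN in auto)
    also have "\<dots> = (\<Sum>n\<in>N. of_int (\<Sum>x | x \<in> H \<and> ind H x = n. sign x) * F n)"
    proof (rule sum.cong[OF refl])
      fix n assume "n \<in> N"
      then have "{x. x \<in> {x. x \<in> H \<and> ind H x \<noteq> 0} \<and> ind H x = n} = {x. x \<in> H \<and> ind H x = n}"
        by (auto simp: N_def)
      then show "(\<Sum>x | x \<in> {x. x \<in> H \<and> ind H x \<noteq> 0} \<and> ind H x = n. of_int (sign x) * F (ind H x)) =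
          of_int (\<Sum>x | x \<in> H \<and> ind H x = n. sign x) * F n"
        by (simp add: sum_distrib_right)
    qed
    finally show ?thesis .
  qed
  have "(\<Sum>n\<in>N. of_int (\<Sum>x | x \<in> G \<and> ind G x = n. sign x) * F n) =
      (\<Sum>n\<in>N. of_int (\<Sum>x | x \<in> G' \<and> ind G' x = n. sign x) * F n)"
    by (rule sum.cong) (auto simp: N_def eq)
  moreover have "ind G ` G - {0} \<subseteq> N" "ind G' ` G' - {0} \<subseteq> N" by (auto simp: N_def)
  ultimately show ?thesis by (simp only: group[OF fin(1)] group[OF fin(2)])
qed

lemma odd_writhe_by_index:
  assumes "finite G"
  shows "odd_writhe G = (\<Sum>x | x \<in> G \<and> ind G x \<noteq> 0. of_int (sign x) * of_bool (odd (ind G x)))"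
proof -
  have "odd_writhe G = (\<Sum>x | x \<in> G \<and> odd (ind G x). of_int (sign x) * of_bool (odd (ind G x)))"
    unfolding odd_writhe_def by (rule sum.cong) auto
  also have "\<dots> = (\<Sum>x | x \<in> G \<and> ind G x \<noteq> 0. of_int (sign x) * of_bool (odd (ind G x)))"
    by (rule sum.mono_neutral_left) (use assms in auto)
  finally show ?thesis .
qed

lemma writhe_polynomial_by_index:
  "writhe_polynomial G = (\<Sum>x | x \<in> G \<and> ind G x \<noteq> 0. of_int (sign x) * fls_X_intpow (ind G x))"
  unfolding writhe_polynomial_def by (rule sum.cong) (simp_all add: fls_of_int)

lemma henrich_turaev_polynomial_by_index:
  "henrich_turaev_polynomial G = (\<Sum>x | x \<in> G \<and> ind G x \<noteq> 0. of_int (sign x) * monom 1 (nat \<bar>ind G x\<bar>))"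
proof -
  have "monom (k :: int) n = of_int k * monom 1 n" for k n
    by (simp add: of_int_poly smult_monom)
  then show ?thesis unfolding henrich_turaev_polynomial_def by (intro sum.cong refl)
qed

theorem theorem7:
  fixes K0 K1 :: "diagram set" and G0 G1 :: "chord set"
  assumes "K0 \<in> virtual_knots" and "K1 \<in> virtual_knots"
    and "concordant K0 K1"
    and "G0 \<in> gauss_diagrams K0" and "G1 \<in> gauss_diagrams K1"
  shows "odd_writhe G0 = odd_writhe G1 \<and>
    writhe_polynomial G0 = writhe_polynomial G1 \<and>
    henrich_turaev_polynomial G0 = henrich_turaev_polynomial G1"
proof -
  obtain n k D T where cob: "cobordism n k D T K0 K1" and genus: "cobordism_genus n k = 0"
    using assms(3) unfolding concordant_def by blast
  have ends: "D 0 \<in> K0" "D n \<in> K1" using cob by (simp_all add: cobordism_def)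
  obtain D0 D1 where D: "D0 \<in> K0" "G0 = gauss_diagram D0" "D1 \<in> K1" "G1 = gauss_diagram D1"
    using assms(4,5) by (auto simp: gauss_diagrams_def)
  note K0 = virtual_knot_invariant[OF assms(1)] and K1 = virtual_knot_invariant[OF assms(2)]
  have one: "(1::int) \<noteq> 0" by simp
  have valid: "virtual_link_diagram D0" "virtual_link_diagram D1" "virtual_link_diagram (D 0)" "virtual_link_diagram (D n)"
    using K0(2)[OF D(1) D(1) one] K1(2)[OF D(3) D(3) one] K0(2)[OF ends(1,1) one] K1(2)[OF ends(2,2) one] by simp_all
  have knots: "card (circles D0) = 1" "card (circles D1) = 1" "card (circles (D 0)) = 1" "card (circles (D n)) = 1"
    using K0(3)[OF D(1) D(1) one] K1(3)[OF D(3) D(3) one] K0(3)[OF ends(1,1) one] K1(3)[OF ends(2,2) one] by simp_all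
  obtain c0 c1 where c: "circles D0 = {c0}" "circles D1 = {c1}"
    using knots(1,2) by (metis card_1_singletonE)
  interpret k0: knot_diagram D0 c0 by (rule knot_diagram.intro) (use valid c in auto)
  interpret k1: knot_diagram D1 c1 by (rule knot_diagram.intro) (use valid c in auto)
  have "(\<Sum>x | x \<in> G0 \<and> ind G0 x = m. sign x) = (\<Sum>x | x \<in> G1 \<and> ind G1 x = m. sign x)"
    if m: "m \<noteq> 0" for m
  proof -
    have "index_writhe D0 (numbering D0) m = index_writhe (D 0) (numbering (D 0)) m"
      by (rule K0(1)[OF D(1) ends(1) m])
    also have "\<dots> = index_writhe (D n) (numbering (D n)) m"
      by (rule concordance_invariant[OF cob genus valid(3,4) knots(3,4) m])
    also have "\<dots> = index_writhe D1 (numbering D1) m"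
      by (rule K1(1)[OF ends(2) D(3) m])
    finally show ?thesis unfolding k0.index_writhe_eq k1.index_writhe_eq D(2,4) .
  qed
  note same_index_writhe = this
  have fin: "finite G0" "finite G1"
    unfolding D(2,4) by (rule k0.finite_gauss_diagram k1.finite_gauss_diagram)+
  note by_index = sum_by_index[OF fin same_index_writhe]
  show ?thesis
    unfolding odd_writhe_by_index[OF fin(1)] odd_writhe_by_index[OF fin(2)]
      writhe_polynomial_by_index henrich_turaev_polynomial_by_index
    by (intro conjI by_index[of "\<lambda>n. of_bool (odd n)"] by_index[of fls_X_intpow]
        by_index[of "\<lambda>n. monom 1 (nat \<bar>n\<bar>)"])
qed

end
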